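(* Every canonically testable property $\mathcal{P}$ of $\Sigma$-edge-colored ordered graphs or of images is estimable; moreover, the corresponding constant-query $(\epsilon,\eta)$-tolerant tests can be taken to be canonical.
   Context: $\Sigma$ is a finite alphabet. A $\Sigma$-edge-colored ordered graph on $n$ vertices is a function $G\colon\binom{[n]}{2}\to\Sigma$; a property is a set of such functions. $d_H(G,G')=|\{e:G(e)\ne G'(e)\}|/\binom n2$, $d_H(G,\mathcal{P})$ is the minimum over $G'\in\mathcal{P}$ on $n$ vertices; $\epsilon$-far means $d_H>\epsilon$, $\epsilon$-close otherwise. An image $f\colon[n]\times[n]\to\Sigma$ is identified with the ordered graph $g$ on $[2n]$ with colors $\Sigma\cup\{\sigma^*\}$, where $g(x,y)=\sigma^*$ if $x\ne y$ both lie in $[n]$ or both in $\{n+1,\dots,2n\}$, and $g(x,n+y)=f(x,y)$; all notions for images are those of the representing graphs. A canonical test with $q$ vertex queries picks a uniformly random $q$-subset $v_1<\dots<v_q$ of $[n]$, queries all $G(v_iv_j)$, and decides (possibly randomly) based only on the ordered tuple $(G(v_iv_j))_{i<j}$. An $\epsilon$-test accepts graphs in $\mathcal{P}$ with probability $\ge2/3$ and rejects $\epsilon$-far graphs with probability $\ge2/3$. For $\eta\colon(0,1)\to(0,1)$ with $\eta(x)<x$, an $(\epsilon,\eta)$-tolerant test accepts graphs that are $\eta(\epsilon)$-close to $\mathcal{P}$ with probability $\ge2/3$ and rejects $\epsilon$-far graphs with probability $\ge2/3$. $\mathcal{P}$ is canonically testable if for every $\epsilon>0$ it has a canonical $\epsilon$-test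 with a number of queries depending only on $\epsilon$. $\mathcal{P}$ is estimable if for every $\eta\colon(0,1)\to(0,1)$ with $\eta(x)<x$ for all $x$ and every $\epsilon>0$, it has an $(\epsilon,\eta)$-tolerant test whose number of queries depends only on $\epsilon$ (and $\eta$), not on $n$. *)

theory Defs
  imports "HOL-Probability.Probability"
begin

section \<open>Edge-colored ordered graphs and their properties\<close>

definition edges :: "nat \<Rightarrow> nat set set" where
  "edges n = {e. e \<subseteq> {1..n} \<and> card e = 2}"

type_synonym 'c ograph = "nat set \<Rightarrow> 'c"

text \<open>The number of vertices is not recoverable from the coloring alone when it is 0 or 1,
  so families of graphs (in particular properties) are indexed by it.\<close>

type_synonym 'c ograph_family = "nat \<Rightarrow> 'c ograph set"

definition ordered_graphs :: "'c ograph_family" where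
  "ordered_graphs n = (edges n \<rightarrow>\<^sub>E UNIV)"

definition graph_property :: "'c ograph_family \<Rightarrow> bool" where
  "graph_property P \<longleftrightarrow> (\<forall>n. P n \<subseteq> ordered_graphs n)"

definition hamming_dist :: "nat \<Rightarrow> 'c ograph \<Rightarrow> 'c ograph \<Rightarrow> real" where
  "hamming_dist n G G' = real (card {e \<in> edges n. G e \<noteq> G' e}) / real (n choose 2)"

text \<open>There are finitely many \<open>n\<close>-vertex graphs, so the infimum below is a minimum whenever the
  property contains an \<open>n\<close>-vertex graph; otherwise the distance is infinite, and every
  \<open>n\<close>-vertex graph is far from the property.\<close>

definition dist_to_property :: "'c ograph_family \<Rightarrow> nat \<Rightarrow> 'c ograph \<Rightarrow> ereal" where
  "dist_to_property P n G = (INF G' \<in> P n. ereal (hamming_dist n G G'))"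

definition far :: "real \<Rightarrow> 'c ograph_family \<Rightarrow> nat \<Rightarrow> 'c ograph \<Rightarrow> bool" where
  "far \<epsilon> P n G \<longleftrightarrow> dist_to_property P n G > ereal \<epsilon>"

abbreviation close :: "real \<Rightarrow> 'c ograph_family \<Rightarrow> nat \<Rightarrow> 'c ograph \<Rightarrow> bool" where
  "close \<epsilon> P n G \<equiv> \<not> far \<epsilon> P n G"


section \<open>Images\<close>

type_synonym 'c image_family = "nat \<Rightarrow> (nat \<times> nat \<Rightarrow> 'c) set"

definition images :: "'c image_family" where
  "images n = ({1..n} \<times> {1..n} \<rightarrow>\<^sub>E UNIV)"

definition image_property :: "'c image_family \<Rightarrow> bool" where
  "image_property Q \<longleftrightarrow> (\<forall>n. Q n \<subseteq> images n)"

text \<open>\<open>None\<close> is the additional color \<open>\<sigma>\<^sup>*\<close>.\<close>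

definition image_graph :: "nat \<Rightarrow> (nat \<times> nat \<Rightarrow> 'c) \<Rightarrow> 'c option ograph" where
  "image_graph n f = (\<lambda>e \<in> edges (2 * n).
     if Min e \<le> n \<and> n < Max e then Some (f (Min e, Max e - n)) else None)"

definition image_graphs :: "'c image_family \<Rightarrow> 'c option ograph_family" where
  "image_graphs Q m = {image_graph n f | n f. m = 2 * n \<and> f \<in> Q n}"


section \<open>Tests\<close>

text \<open>A test maps the number of vertices, which it knows, and an input graph to the
  distribution of its answer, where \<open>True\<close> means acceptance.\<close>

type_synonym 'c test = "nat \<Rightarrow> 'c ograph \<Rightarrow> bool pmf"

text \<open>A deterministic adaptive query algorithm is a decision tree whose inner nodes query the
  color of an edge. A randomized one is a distribution over such trees.\<close>

datatype 'c query_tree = Answer bool | Query "nat set" "'c \<Rightarrow> 'c query_tree"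

primrec run_tree :: "'c ograph \<Rightarrow> 'c query_tree \<Rightarrow> bool" where
  "run_tree G (Answer b) = b"
| "run_tree G (Query e k) = run_tree G (k (G e))"

inductive tree_queries_le :: "nat \<Rightarrow> nat \<Rightarrow> 'c query_tree \<Rightarrow> bool" for n where
  "tree_queries_le n q (Answer b)"
| "e \<in> edges n \<Longrightarrow> (\<And>c. tree_queries_le n q (k c)) \<Longrightarrow> tree_queries_le n (Suc q) (Query e k)"

definition query_test :: "nat \<Rightarrow> 'c test \<Rightarrow> bool" where
  "query_test q A \<longleftrightarrow>
     (\<exists>T. (\<forall>n. \<forall>t \<in> set_pmf (T n). tree_queries_le n q t) \<and>
          A = (\<lambda>n G. map_pmf (run_tree G) (T n)))"

text \<open>For \<open>S = {v\<^sub>1 < \<dots> < v\<^sub>q}\<close>, the tuple of all \<open>G(v\<^sub>i v\<^sub>j)\<close> with \<open>i < j\<close>, indexed by the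
  sets \<open>{i, j}\<close>.\<close>

definition induced_tuple :: "nat set \<Rightarrow> 'c ograph \<Rightarrow> 'c ograph" where
  "induced_tuple S G =
     (\<lambda>e \<in> edges (card S). G ((\<lambda>i. sorted_list_of_set S ! (i - 1)) ` e))"

text \<open>If there are fewer than \<open>q\<close> vertices, all of them are queried. The decision rule is
  attached to the number of vertices of the input; apart from that it sees the tuple only.\<close>

definition canonical_test :: "nat \<Rightarrow> 'c test \<Rightarrow> bool" where
  "canonical_test q A \<longleftrightarrow>
     (\<exists>D :: nat \<Rightarrow> 'c ograph \<Rightarrow> bool pmf.
        A = (\<lambda>n G. bind_pmf (pmf_of_set {S. S \<subseteq> {1..n} \<and> card S = min q n})
                            (\<lambda>S. D n (induced_tuple S G))))"

text \<open>The argument \<open>U\<close> is the class of admissible inputs: all ordered graphs when testing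
  graphs, all graphs representing an image when testing images.\<close>

definition eps_test :: "'c ograph_family \<Rightarrow> 'c ograph_family \<Rightarrow> real \<Rightarrow> 'c test \<Rightarrow> bool" where
  "eps_test U P \<epsilon> A \<longleftrightarrow>
     (\<forall>n. \<forall>G \<in> U n.
        (G \<in> P n \<longrightarrow> pmf (A n G) True \<ge> 2 / 3) \<and>
        (far \<epsilon> P n G \<longrightarrow> pmf (A n G) False \<ge> 2 / 3))"

definition tolerant_test ::
    "'c ograph_family \<Rightarrow> 'c ograph_family \<Rightarrow> real \<Rightarrow> (real \<Rightarrow> real) \<Rightarrow> 'c test \<Rightarrow> bool" where
  "tolerant_test U P \<epsilon> \<eta> A \<longleftrightarrow>
     (\<forall>n. \<forall>G \<in> U n.
        (close (\<eta> \<epsilon>) P n G \<longrightarrow> pmf (A n G) True \<ge> 2 / 3) \<and>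
        (far \<epsilon> P n G \<longrightarrow> pmf (A n G) False \<ge> 2 / 3))"

definition tolerance_function :: "(real \<Rightarrow> real) \<Rightarrow> bool" where
  "tolerance_function \<eta> \<longleftrightarrow> (\<forall>x \<in> {0<..<1}. \<eta> x \<in> {0<..<1} \<and> \<eta> x < x)"

definition canonically_testable :: "'c ograph_family \<Rightarrow> 'c ograph_family \<Rightarrow> bool" where
  "canonically_testable U P \<longleftrightarrow>
     (\<forall>\<epsilon>>0. \<exists>q A. canonical_test q A \<and> eps_test U P \<epsilon> A)"

definition estimable :: "'c ograph_family \<Rightarrow> 'c ograph_family \<Rightarrow> bool" where
  "estimable U P \<longleftrightarrow>
     (\<forall>\<eta>. tolerance_function \<eta> \<longrightarrow>
        (\<forall>\<epsilon> \<in> {0<..<1}. \<exists>q A. query_test q A \<and> tolerant_test U P \<epsilon> \<eta> A))"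

definition canonically_estimable :: "'c ograph_family \<Rightarrow> 'c ograph_family \<Rightarrow> bool" where
  "canonically_estimable U P \<longleftrightarrow>
     (\<forall>\<eta>. tolerance_function \<eta> \<longrightarrow>
        (\<forall>\<epsilon> \<in> {0<..<1}. \<exists>q A. canonical_test q A \<and> tolerant_test U P \<epsilon> \<eta> A))"

end

theory Submission imports Defs begin

text \<open>A large vertex sample is accepted if it can be recolored, within the distance budget, into a
  graph that looks acceptable to the canonical test. Completeness is concentration of subgraph
  statistics. For soundness, a recoloring \<open>F\<close> of the sample must be lifted to the whole graph
  \<open>G\<close>. This needs no strong regularity: the weak regularity lemma, applied to \<open>F\<close> \<^emph>\<open>relative to\<close> the
  sampled graph, approximates \<open>F\<close> by recoloring probabilities on a partition whose size is
  independent of \<open>G\<close>. So one may afterwards choose a weakly regular partition of \<open>G\<close> with an error that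
  is tiny compared with that size; the sample inherits its regularity because the 4-cycle norm is a
  statistic of 4 vertices. The partition of the sample is then transferred to \<open>G\<close> by matching the
  sizes of all intersections with parts of \<open>G\<close>, and \<open>G\<close> is recolored at random. The order of the vertices enters
  only through the kernels \<open>color_kernel\<close>, which vanish unless \<open>x < y\<close>.\<close>

section \<open>Statistics of random samples\<close>

text \<open>The recoloring \<open>F\<close> is chosen after the sample is seen, so no concentration
  statement about \<open>F\<close> is available, and there are far too many recolorings for a union
  bound. Hence all that is demanded of a good sample concerns \<open>G\<close>: the sizes of its
  parts and its 4-cycle sums, boundedly many statistics of at most 4 vertices. This dictates the
  order of the constants. The accuracy \<gamma> fixes the number K of parts for \<open>F\<close>.
  Multiplication by a step function on K parts can inflate a cut norm by the square of K, so
  \<open>G\<close> is needed with an accuracy \<zeta> of order \<gamma> / K^2. Cut norm and 4-cycle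
  sum control each other only up to a fourth power, so \<open>G\<close> is regularized up to order
  \<zeta>^4. The map \<kappa> treats graphs and images at once: a recoloring may not change its
  value on an edge. It is constant for graphs and singles out the color \<open>None\<close> for
  images. The lift respects \<kappa> because an edge of \<open>G\<close> either keeps its color or
  gets one that \<open>F\<close> gave to a sample edge of the same color in the corresponding
  cell.\<close>

definition tuples :: "nat \<Rightarrow> 'a set \<Rightarrow> 'a list set" where
  "tuples r X = {l. set l \<subseteq> X \<and> length l = r}"

text \<open>Entries of a tuple may repeat. The coordinates are then independent, products of means
  are again means, and 4-cycle sums have this form. Compared with injective tuples the price is of
  order \<open>r\<^sup>2 / card X\<close>.\<close>

definition tuple_mean :: "nat \<Rightarrow> 'a set \<Rightarrow> ('a list \<Rightarrow> real) \<Rightarrow> real" where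
  "tuple_mean r X h = (\<Sum>l\<in>tuples r X. h l) / real (card X) ^ r"

lemma finite_tuples [simp]: "finite X \<Longrightarrow> finite (tuples r X)"
  unfolding tuples_def by (rule finite_lists_length_eq)

lemma card_tuples: "finite X \<Longrightarrow> card (tuples r X) = card X ^ r"
  unfolding tuples_def by (rule card_lists_length_eq)

lemma sum_tuples_append:
  fixes g :: "'a list \<Rightarrow> real"
  shows "(\<Sum>l\<in>tuples (r + s) X. g l) = (\<Sum>l\<in>tuples r X. \<Sum>l'\<in>tuples s X. g (l @ l'))"
proof -
  have "(\<Sum>l\<in>tuples r X. \<Sum>l'\<in>tuples s X. g (l @ l'))
      = (\<Sum>(l, l')\<in>tuples r X \<times> tuples s X. g (l @ l'))"
    by (simp add: sum.cartesian_product)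
  also have "\<dots> = (\<Sum>l\<in>tuples (r + s) X. g l)"
    by (rule sum.reindex_bij_witness[where i="\<lambda>l. (take r l, drop r l)" and j="\<lambda>(l, l'). l @ l'"])
       (auto simp: tuples_def dest: in_set_takeD in_set_dropD)
  finally show ?thesis by simp
qed

lemma sum_tuples_Suc:
  fixes g :: "'a list \<Rightarrow> real"
  shows "(\<Sum>l\<in>tuples (Suc r) X. g l) = (\<Sum>x\<in>X. \<Sum>l\<in>tuples r X. g (x # l))"
proof -
  have "(\<Sum>x\<in>X. \<Sum>l\<in>tuples r X. g (x # l)) = (\<Sum>(x, l)\<in>X \<times> tuples r X. g (x # l))"
    by (simp add: sum.cartesian_product)
  also have "\<dots> = (\<Sum>l\<in>tuples (Suc r) X. g l)"
    by (rule sum.reindex_bij_witness[where i="\<lambda>l. (hd l, tl l)" and j="\<lambda>(x, l). x # l"])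
       (auto simp: tuples_def length_Suc_conv)
  finally show ?thesis by simp
qed

lemma tuples_0 [simp]: "tuples 0 X = {[]}"
  by (auto simp: tuples_def)

lemma abs_tuple_mean_le:
  assumes "finite X" and "\<And>l. l \<in> tuples r X \<Longrightarrow> \<bar>h l\<bar> \<le> c" and "c \<ge> 0"
  shows "\<bar>tuple_mean r X h\<bar> \<le> c"
proof -
  have "\<bar>\<Sum>l\<in>tuples r X. h l\<bar> \<le> (\<Sum>l\<in>tuples r X. c)"
    using assms by (intro order_trans[OF sum_abs] sum_mono) auto
  also have "\<dots> = c * real (card X) ^ r"
    using assms by (simp add: card_tuples)
  finally show ?thesis
    unfolding tuple_mean_def using assms(3)
    by (cases "real (card X) ^ r = 0") (auto simp: divide_le_eq abs_divide)
qed

text \<open>Reduces the second moment of a sample mean to the first moment of a mean over tuples of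
  twice the length.\<close>

lemma tuple_mean_square:
  "(tuple_mean r X h)\<^sup>2 = tuple_mean (r + r) X (\<lambda>l. h (take r l) * h (drop r l))"
proof -
  have "(\<Sum>l\<in>tuples (r + r) X. h (take r l) * h (drop r l))
      = (\<Sum>l\<in>tuples r X. \<Sum>l'\<in>tuples r X. h l * h l')"
    unfolding sum_tuples_append by (intro sum.cong refl) (auto simp: tuples_def)
  then show ?thesis
    by (simp add: tuple_mean_def power2_eq_square sum_product power_add)
qed

section \<open>Random subsets: bias, second moment and concentration of tuple means\<close>

definition subsets_of_card :: "nat \<Rightarrow> 'a set \<Rightarrow> 'a set set" where
  "subsets_of_card m V = {S. S \<subseteq> V \<and> card S = m}"

definition subset_mean :: "nat \<Rightarrow> 'a set \<Rightarrow> ('a set \<Rightarrow> real) \<Rightarrow> real" where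
  "subset_mean m V f = (\<Sum>S\<in>subsets_of_card m V. f S) / real (card V choose m)"

lemma finite_subsets_of_card [simp]: "finite V \<Longrightarrow> finite (subsets_of_card m V)"
  by (simp add: subsets_of_card_def)

lemma card_subsets_of_card: "finite V \<Longrightarrow> card (subsets_of_card m V) = card V choose m"
  by (simp add: subsets_of_card_def n_subsets)

definition distinct_tuples :: "nat \<Rightarrow> 'a set \<Rightarrow> 'a list set" where
  "distinct_tuples r X = {l \<in> tuples r X. distinct l}"

lemma finite_distinct_tuples [simp]: "finite X \<Longrightarrow> finite (distinct_tuples r X)"
  by (simp add: distinct_tuples_def)

lemma card_distinct_tuples:
  assumes "finite X" "r \<le> card X"
  shows "card (distinct_tuples r X) = \<Prod>{card X - r + 1..card X}"
proof -
  have "distinct_tuples r X = {xs. length xs = r \<and> distinct xs \<and> set xs \<subseteq> X}"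
    by (auto simp: distinct_tuples_def tuples_def)
  then show ?thesis using card_lists_distinct_length_eq[OF assms] by simp
qed

text \<open>Every factor of the falling factorial is at least \<open>card X - r\<close>; Bernoulli's
  inequality does the rest.\<close>

lemma card_distinct_tuples_ge:
  assumes "finite X" "r \<le> card X" "card X > 0"
  shows "real (card (distinct_tuples r X)) \<ge> (1 - real r ^ 2 / card X) * real (card X) ^ r"
proof -
  let ?N = "card X"
  have "real (?N - r) ^ r = (\<Prod>i\<in>{?N - r + 1..?N}. real (?N - r))"
    using assms by simp
  also have "\<dots> \<le> (\<Prod>i\<in>{?N - r + 1..?N}. real i)"
    by (intro prod_mono) auto
  also have "\<dots> = real (card (distinct_tuples r X))"
    using assms by (simp add: card_distinct_tuples)
  finally have 1: "real (?N - r) ^ r \<le> real (card (distinct_tuples r X))" .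
  have "1 + real r * (- (r / ?N)) \<le> (1 + (- (r / ?N))) ^ r"
    using assms by (intro Bernoulli_inequality) auto
  then have "(1 - real r ^ 2 / ?N) * real ?N ^ r \<le> (1 - r / ?N) ^ r * real ?N ^ r"
    by (intro mult_right_mono) (auto simp: power2_eq_square)
  also have "\<dots> = real (?N - r) ^ r"
    using assms(2,3) by (simp add: power_mult_distrib[symmetric] left_diff_distrib of_nat_diff del: card_gt_0_iff)
  finally show ?thesis using 1 by linarith
qed

lemma tuple_sum_vs_distinct:
  assumes "finite X" "r \<le> card X" "card X > 0" "\<And>l. \<bar>h l\<bar> \<le> (1::real)"
  shows "\<bar>(\<Sum>l\<in>tuples r X. h l) - (\<Sum>l\<in>distinct_tuples r X. h l)\<bar>
           \<le> real r ^ 2 / card X * real (card X) ^ r"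
proof -
  have sub: "distinct_tuples r X \<subseteq> tuples r X" by (auto simp: distinct_tuples_def)
  have "(\<Sum>l\<in>tuples r X. h l) - (\<Sum>l\<in>distinct_tuples r X. h l)
      = (\<Sum>l\<in>tuples r X - distinct_tuples r X. h l)"
    using sum_diff[OF _ sub, of h] assms by simp
  also have "\<bar>\<dots>\<bar> \<le> (\<Sum>l\<in>tuples r X - distinct_tuples r X. 1)"
    using assms by (intro order_trans[OF sum_abs] sum_mono) auto
  also have "\<dots> = real (card (tuples r X)) - real (card (distinct_tuples r X))"
    using sub assms by (simp add: card_Diff_subset of_nat_diff card_mono)
  also have "\<dots> \<le> real r ^ 2 / card X * real (card X) ^ r"
    using card_distinct_tuples_ge[OF assms(1-3)] assms(1)
    by (simp add: card_tuples algebra_simps)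
  finally show ?thesis .
qed

lemma card_supersets:
  assumes "finite V" "R \<subseteq> V" "card R \<le> m"
  shows "card {S \<in> subsets_of_card m V. R \<subseteq> S} = (card V - card R) choose (m - card R)"
proof -
  have fR: "finite R" using assms finite_subset by auto
  have "bij_betw (\<lambda>S. S - R) {S \<in> subsets_of_card m V. R \<subseteq> S} (subsets_of_card (m - card R) (V - R))"
  proof (rule bij_betw_byWitness[where f'="\<lambda>S. S \<union> R"])
    show "(\<lambda>S. S \<union> R) ` subsets_of_card (m - card R) (V - R) \<subseteq> {S \<in> subsets_of_card m V. R \<subseteq> S}"
    proof (clarsimp simp: subsets_of_card_def, intro conjI)
      fix S assume S: "S \<subseteq> V - R" "card S = m - card R"
      then show "S \<subseteq> V" "R \<subseteq> V" using assms by auto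
      have "card (S \<union> R) = card S + card R"
        using S fR assms(1) by (intro card_Un_disjoint) (auto intro: finite_subset)
      then show "card (S \<union> R) = m" using S assms by simp
    qed
  qed (use fR in \<open>auto simp: subsets_of_card_def card_Diff_subset\<close>)
  then have "card {S \<in> subsets_of_card m V. R \<subseteq> S} = card (subsets_of_card (m - card R) (V - R))"
    by (rule bij_betw_same_card)
  also have "\<dots> = (card V - card R) choose (m - card R)"
    using assms fR by (simp add: card_subsets_of_card card_Diff_subset)
  finally show ?thesis .
qed

text \<open>Double counting: the entries of an injective tuple lie in exactly
  \<open>(card V - r) choose (m - r)\<close> of the subsets.\<close>

lemma sum_subsets_distinct_tuples:
  fixes h :: "'a list \<Rightarrow> real"
  assumes "finite V" "r \<le> m"
  shows "(\<Sum>S\<in>subsets_of_card m V. \<Sum>l\<in>distinct_tuples r S. h l)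
       = real ((card V - r) choose (m - r)) * (\<Sum>l\<in>distinct_tuples r V. h l)"
proof -
  have "(\<Sum>S\<in>subsets_of_card m V. \<Sum>l\<in>distinct_tuples r S. h l)
      = (\<Sum>S\<in>subsets_of_card m V. \<Sum>l\<in>distinct_tuples r V. if set l \<subseteq> S then h l else 0)"
  proof (rule sum.cong[OF refl])
    fix S assume "S \<in> subsets_of_card m V"
    then have "distinct_tuples r S = {l \<in> distinct_tuples r V. set l \<subseteq> S}"
      by (auto simp: distinct_tuples_def tuples_def subsets_of_card_def)
    then show "(\<Sum>l\<in>distinct_tuples r S. h l) = (\<Sum>l\<in>distinct_tuples r V. if set l \<subseteq> S then h l else 0)"
      using assms by (simp add: sum.inter_filter)
  qed
  also have "\<dots> = (\<Sum>l\<in>distinct_tuples r V. \<Sum>S\<in>subsets_of_card m V. if set l \<subseteq> S then h l else 0)"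
    by (rule sum.swap)
  also have "\<dots> = (\<Sum>l\<in>distinct_tuples r V. real ((card V - r) choose (m - r)) * h l)"
  proof (rule sum.cong[OF refl])
    fix l assume l: "l \<in> distinct_tuples r V"
    then have c: "card (set l) = r" "set l \<subseteq> V"
      by (auto simp: distinct_tuples_def tuples_def distinct_card)
    have "(\<Sum>S\<in>subsets_of_card m V. if set l \<subseteq> S then h l else 0)
        = (\<Sum>S\<in>{S \<in> subsets_of_card m V. set l \<subseteq> S}. h l)"
      using assms by (simp only: sum.inter_filter finite_subsets_of_card)
    also have "\<dots> = real ((card V - r) choose (m - r)) * h l"
      using card_supersets[OF assms(1) c(2)] c assms by simp
    finally show "(\<Sum>S\<in>subsets_of_card m V. if set l \<subseteq> S then h l else 0)
        = real ((card V - r) choose (m - r)) * h l" .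
  qed
  finally show ?thesis by (simp add: sum_distrib_left)
qed

text \<open>For injective tuples there is no bias: their average over a random subset has
  expectation \<open>D\<close>, their average over \<open>V\<close>. Passing to arbitrary tuples
  costs \<open>r\<^sup>2 / m\<close> in the sample and \<open>r\<^sup>2 / card V\<close> in
  \<open>V\<close>, each once for the tuples with repetitions and once for the normalization; this
  makes four errors.\<close>

lemma sampling_bias:
  assumes V: "finite V" "m \<le> card V" and r: "r \<le> m" "m > 0" and h: "\<And>l. \<bar>h l\<bar> \<le> (1::real)"
  shows "\<bar>subset_mean m V (\<lambda>S. tuple_mean r S h) - tuple_mean r V h\<bar> \<le> 4 * real r ^ 2 / m"
proof -
  let ?n = "card V" and ?c = "real ((card V - r) choose (m - r))"
  let ?b = "real (card V choose m)"
  let ?dn = "real (card (distinct_tuples r V))"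
  define dm where "dm = real (\<Prod>{m - r + 1..m})"
  define E where "E = (\<Sum>l\<in>distinct_tuples r V. h l)"
  have fin: "finite S" "card S = m" if "S \<in> subsets_of_card m V" for S
    using that V finite_subset by (auto simp: subsets_of_card_def)
  have dm: "real (card (distinct_tuples r S)) = dm" if "S \<in> subsets_of_card m V" for S
    using fin[OF that] r by (simp add: card_distinct_tuples dm_def)
  have b: "?b > 0" using V by simp
  have "(\<Sum>S\<in>subsets_of_card m V. \<Sum>l\<in>distinct_tuples r S. 1) = ?c * (\<Sum>l\<in>distinct_tuples r V. 1)"
    by (rule sum_subsets_distinct_tuples[OF V(1) r(1)])
  then have cb: "?b * dm = ?c * ?dn"
    using dm V by (simp add: card_subsets_of_card)
  obtain S0 where S0: "S0 \<subseteq> V" "card S0 = m" using V obtain_subset_with_card_n by metis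
  have S0': "S0 \<in> subsets_of_card m V" using S0 by (simp add: subsets_of_card_def)
  have dm_ge: "dm \<ge> (1 - real r ^ 2 / m) * real m ^ r"
    using card_distinct_tuples_ge[of S0 r] fin[OF S0'] r dm[OF S0'] by simp
  have dm_le: "dm \<le> real m ^ r"
  proof -
    have "card (distinct_tuples r S0) \<le> card (tuples r S0)"
      using fin[OF S0'] by (intro card_mono) (auto simp: distinct_tuples_def)
    then have "real (card (distinct_tuples r S0)) \<le> real (card (tuples r S0))" by simp
    then show ?thesis using dm[OF S0'] fin[OF S0'] by (simp add: card_tuples)
  qed
  have dn_pos: "?dn > 0"
  proof -
    have "\<Prod>{?n - r + 1..?n} > 0" by (rule prod_pos) auto
    then show ?thesis using card_distinct_tuples[OF V(1), of r] V r by (simp del: of_nat_prod)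
  qed
  have npos: "?n > 0" using V r by linarith
  define D where "D = E / ?dn"
  have D1: "\<bar>D\<bar> \<le> 1"
  proof -
    have "\<bar>E\<bar> \<le> (\<Sum>l\<in>distinct_tuples r V. 1)" unfolding E_def
      using h by (intro order_trans[OF sum_abs] sum_mono) auto
    then show ?thesis using dn_pos by (simp add: D_def abs_divide divide_le_eq)
  qed
  have mpos: "real m ^ r > 0" using r by simp
  have 1: "\<bar>subset_mean m V (\<lambda>S. tuple_mean r S h) - dm / real m ^ r * D\<bar> \<le> real r ^ 2 / m"
  proof -
    have "(\<Sum>S\<in>subsets_of_card m V. (\<Sum>l\<in>distinct_tuples r S. h l)) = ?c * E"
      unfolding E_def by (rule sum_subsets_distinct_tuples[OF V(1) r(1)])
    also have "\<dots> = ?b * dm * D" using cb dn_pos by (simp add: D_def)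
    finally have e: "?b * (dm / real m ^ r * D) = (\<Sum>S\<in>subsets_of_card m V. (\<Sum>l\<in>distinct_tuples r S. h l) / real m ^ r)"
      by (simp add: sum_divide_distrib[symmetric])
    have "\<bar>(\<Sum>S\<in>subsets_of_card m V. tuple_mean r S h)
        - (\<Sum>S\<in>subsets_of_card m V. (\<Sum>l\<in>distinct_tuples r S. h l) / real m ^ r)\<bar>
      \<le> (\<Sum>S\<in>subsets_of_card m V. real r ^ 2 / m)"
      unfolding sum_subtractf[symmetric]
    proof (intro order_trans[OF sum_abs] sum_mono)
      fix S assume S: "S \<in> subsets_of_card m V"
      have "\<bar>(\<Sum>l\<in>tuples r S. h l) - (\<Sum>l\<in>distinct_tuples r S. h l)\<bar> \<le> real r ^ 2 / m * real m ^ r"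
        using tuple_sum_vs_distinct[of S r h] fin[OF S] r h by simp
      then have "\<bar>((\<Sum>l\<in>tuples r S. h l) - (\<Sum>l\<in>distinct_tuples r S. h l)) / real m ^ r\<bar> \<le> real r ^ 2 / m"
        using mpos by (simp add: abs_divide divide_le_eq)
      then show "\<bar>tuple_mean r S h - (\<Sum>l\<in>distinct_tuples r S. h l) / real m ^ r\<bar> \<le> real r ^ 2 / m"
        using fin[OF S] by (simp add: tuple_mean_def diff_divide_distrib)
    qed
    also have "\<dots> = ?b * (real r ^ 2 / m)" using V by (simp add: card_subsets_of_card)
    finally have "\<bar>(\<Sum>S\<in>subsets_of_card m V. tuple_mean r S h) - ?b * (dm / real m ^ r * D)\<bar> \<le> ?b * (real r ^ 2 / m)"
      unfolding e .
    moreover have "(\<Sum>S\<in>subsets_of_card m V. tuple_mean r S h) - ?b * (dm / real m ^ r * D)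
      = ?b * (subset_mean m V (\<lambda>S. tuple_mean r S h) - dm / real m ^ r * D)"
      using b by (simp add: subset_mean_def field_simps)
    ultimately have "?b * \<bar>subset_mean m V (\<lambda>S. tuple_mean r S h) - dm / real m ^ r * D\<bar> \<le> ?b * (real r ^ 2 / m)"
      using b by (simp only: abs_mult)
    then show ?thesis using b by (rule mult_left_le_imp_le)
  qed
  have shrink: "\<bar>x * D - D\<bar> \<le> y" if "1 - y \<le> x" "x \<le> 1" for x y
  proof -
    have "x * D - D = - ((1 - x) * D)" by (simp add: algebra_simps)
    then have "\<bar>x * D - D\<bar> = (1 - x) * \<bar>D\<bar>" using that by (simp add: abs_mult)
    also have "\<dots> \<le> (1 - x) * 1" using D1 that by (intro mult_left_mono) auto
    finally show ?thesis using that by simp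
  qed
  have 2: "\<bar>dm / real m ^ r * D - D\<bar> \<le> real r ^ 2 / m"
    using dm_ge dm_le mpos by (intro shrink) (auto simp: pos_le_divide_eq)
  have nn: "real r ^ 2 / ?n \<le> real r ^ 2 / m"
    using V r by (intro divide_left_mono) auto
  have npow: "real ?n ^ r > 0" using npos by simp
  have 3: "\<bar>tuple_mean r V h - ?dn / real ?n ^ r * D\<bar> \<le> real r ^ 2 / ?n"
  proof -
    have "\<bar>(\<Sum>l\<in>tuples r V. h l) - E\<bar> \<le> real r ^ 2 / ?n * real ?n ^ r"
      unfolding E_def using V r npos h by (intro tuple_sum_vs_distinct) auto
    then have "\<bar>((\<Sum>l\<in>tuples r V. h l) - E) / real ?n ^ r\<bar> \<le> real r ^ 2 / ?n"
      using npow by (simp add: abs_divide divide_le_eq)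
    then show ?thesis using dn_pos by (simp add: tuple_mean_def D_def diff_divide_distrib)
  qed
  have dn_le: "?dn \<le> real ?n ^ r"
  proof -
    have "card (distinct_tuples r V) \<le> card (tuples r V)"
      using V by (intro card_mono) (auto simp: distinct_tuples_def)
    then have "real (card (distinct_tuples r V)) \<le> real (card (tuples r V))" by (simp only: of_nat_le_iff)
    then show ?thesis using V by (simp add: card_tuples)
  qed
  have 4: "\<bar>?dn / real ?n ^ r * D - D\<bar> \<le> real r ^ 2 / ?n"
    using card_distinct_tuples_ge[of V r] V r npos npow dn_le
    by (intro shrink) (auto simp: pos_le_divide_eq)
  have "4 * real r ^ 2 / m = 4 * (real r ^ 2 / m)" by simp
  then show ?thesis using 1 2 3 4 nn by linarith
qed

lemma subset_mean_const: "finite V \<Longrightarrow> m \<le> card V \<Longrightarrow> subset_mean m V (\<lambda>S. c) = c"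
  by (simp add: subset_mean_def card_subsets_of_card)

text \<open>Expanding the square leaves two biases: that of the 2r-tuples, at most
  \<open>4 * (2 * r)\<^sup>2 / m\<close>, and twice that of the r-tuples, at most
  \<open>2 * 4 * r\<^sup>2 / m\<close>. Hence 24 = 16 + 8.\<close>

lemma sampling_second_moment:
  assumes V: "finite V" "m \<le> card V" and r: "r + r \<le> m" "m > 0" and h: "\<And>l. \<bar>h l\<bar> \<le> (1::real)"
  shows "subset_mean m V (\<lambda>S. (tuple_mean r S h - tuple_mean r V h)\<^sup>2) \<le> 24 * real r ^ 2 / m"
proof -
  define t where "t = tuple_mean r V h"
  define M where "M = subset_mean m V (\<lambda>S. tuple_mean r S h)"
  define M2 where "M2 = subset_mean m V (\<lambda>S. (tuple_mean r S h)\<^sup>2)"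
  have "subset_mean m V (\<lambda>S. (tuple_mean r S h - t)\<^sup>2) =
      subset_mean m V (\<lambda>S. (tuple_mean r S h)\<^sup>2 - 2 * t * tuple_mean r S h + t\<^sup>2)"
    by (simp add: power2_diff algebra_simps)
  also have "\<dots> = M2 - 2 * t * M + subset_mean m V (\<lambda>S. t\<^sup>2)"
    by (simp add: M2_def M_def subset_mean_def sum.distrib sum_subtractf sum_distrib_left[symmetric] add_divide_distrib diff_divide_distrib)
  also have "\<dots> = (M2 - t\<^sup>2) - 2 * (t * (M - t))"
    using V by (simp add: subset_mean_const algebra_simps power2_eq_square)
  finally have e: "subset_mean m V (\<lambda>S. (tuple_mean r S h - t)\<^sup>2) = (M2 - t\<^sup>2) - 2 * (t * (M - t))" .
  have "\<bar>h (take r l) * h (drop r l)\<bar> \<le> 1" for l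
    using h mult_mono[OF h h, of "take r l" "drop r l"] by (simp add: abs_mult mult.commute)
  then have 1: "M2 - t\<^sup>2 \<le> 4 * real (r + r) ^ 2 / m"
    using sampling_bias[OF V r, of "\<lambda>l. h (take r l) * h (drop r l)"]
    by (simp add: M2_def t_def tuple_mean_square)
  have "\<bar>t\<bar> \<le> 1" unfolding t_def using V h by (intro abs_tuple_mean_le) auto
  moreover have "\<bar>M - t\<bar> \<le> 4 * real r ^ 2 / m"
    using sampling_bias[OF V _ r(2) h, of r] r by (simp add: M_def t_def)
  ultimately have "\<bar>t\<bar> * \<bar>M - t\<bar> \<le> 1 * (4 * real r ^ 2 / m)" by (intro mult_mono) auto
  then have 2: "\<bar>t * (M - t)\<bar> \<le> 4 * real r ^ 2 / m" by (simp add: abs_mult)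
  have "4 * real (r + r) ^ 2 / m = 4 * (4 * real r ^ 2 / m)" "24 * real r ^ 2 / m = 6 * (4 * real r ^ 2 / m)"
    by (simp_all add: power2_eq_square)
  with 1 2 show ?thesis unfolding t_def[symmetric] e by linarith
qed

text \<open>Markov's inequality for the sum \<open>Z\<close> of all squared deviations. Each has
  mean at most \<open>24 * q\<^sup>2 / m\<close>, so the factor 72 in the bound on \<open>m\<close>
  pushes the mean of \<open>Z\<close> below a third of \<open>\<xi>\<^sup>2\<close>, while a bad
  sample has \<open>Z\<close> at least \<open>\<xi>\<^sup>2\<close>.\<close>

lemma sampling_lemma:
  fixes V :: "'a set" and h :: "'i \<Rightarrow> 'a list \<Rightarrow> real"
  assumes V: "finite V" "m \<le> card V" and I: "finite I" "real (card I) \<le> N"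
    and q: "\<And>i. i \<in> I \<Longrightarrow> r i \<le> q" and h: "\<And>i l. i \<in> I \<Longrightarrow> \<bar>h i l\<bar> \<le> 1"
    and \<xi>: "\<xi> > 0" and m: "real m \<ge> 72 * real q ^ 2 * N / \<xi>\<^sup>2" "2 * q \<le> m" "m > 0"
  shows "real (card {S \<in> subsets_of_card m V. \<forall>i\<in>I. \<bar>tuple_mean (r i) S (h i) - tuple_mean (r i) V (h i)\<bar> \<le> \<xi>})
           \<ge> 2 / 3 * real (card V choose m)"
proof -
  define good where "good = {S \<in> subsets_of_card m V. \<forall>i\<in>I. \<bar>tuple_mean (r i) S (h i) - tuple_mean (r i) V (h i)\<bar> \<le> \<xi>}"
  define Z where "Z S = (\<Sum>i\<in>I. (tuple_mean (r i) S (h i) - tuple_mean (r i) V (h i))\<^sup>2)" for S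
  let ?b = "real (card V choose m)"
  have b: "?b > 0" using V by simp
  have "subset_mean m V Z = (\<Sum>i\<in>I. subset_mean m V (\<lambda>S. (tuple_mean (r i) S (h i) - tuple_mean (r i) V (h i))\<^sup>2))"
    unfolding Z_def subset_mean_def sum_divide_distrib by (rule sum.swap)
  also have "\<dots> \<le> (\<Sum>i\<in>I. 24 * real q ^ 2 / m)"
  proof (rule sum_mono)
    fix i assume i: "i \<in> I"
    have "subset_mean m V (\<lambda>S. (tuple_mean (r i) S (h i) - tuple_mean (r i) V (h i))\<^sup>2) \<le> 24 * real (r i) ^ 2 / m"
      using q[OF i] m h[OF i] by (intro sampling_second_moment V) auto
    also have "\<dots> \<le> 24 * real q ^ 2 / m"
      using q[OF i] by (intro divide_right_mono mult_left_mono power_mono) auto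
    finally show "subset_mean m V (\<lambda>S. (tuple_mean (r i) S (h i) - tuple_mean (r i) V (h i))\<^sup>2) \<le> 24 * real q ^ 2 / m" .
  qed
  also have "\<dots> = real (card I) * (24 * real q ^ 2 / m)" by simp
  also have "\<dots> \<le> N * (24 * real q ^ 2 / m)" using I by (intro mult_right_mono) auto
  also have "\<dots> \<le> \<xi>\<^sup>2 / 3"
    using m \<xi> by (simp add: field_simps)
  finally have Zm: "(\<Sum>S\<in>subsets_of_card m V. Z S) \<le> \<xi>\<^sup>2 / 3 * ?b"
    using b by (simp add: subset_mean_def divide_le_eq)
  have bad: "\<xi>\<^sup>2 \<le> Z S" if S: "S \<in> subsets_of_card m V - good" for S
  proof -
    obtain i where i: "i \<in> I" "\<bar>tuple_mean (r i) S (h i) - tuple_mean (r i) V (h i)\<bar> > \<xi>"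
      using S by (auto simp: good_def not_le)
    then have "\<xi>\<^sup>2 \<le> (tuple_mean (r i) S (h i) - tuple_mean (r i) V (h i))\<^sup>2"
      using \<xi> by (simp add: abs_le_square_iff[symmetric])
    also have "\<dots> \<le> Z S" unfolding Z_def using i I by (intro member_le_sum) auto
    finally show ?thesis .
  qed
  have "real (card (subsets_of_card m V - good)) * \<xi>\<^sup>2 = (\<Sum>S\<in>subsets_of_card m V - good. \<xi>\<^sup>2)" by simp
  also have "\<dots> \<le> (\<Sum>S\<in>subsets_of_card m V - good. Z S)" by (intro sum_mono bad)
  also have "\<dots> \<le> (\<Sum>S\<in>subsets_of_card m V. Z S)"
    using V by (intro sum_mono2) (auto simp: Z_def sum_nonneg)
  also note Zm
  finally have "real (card (subsets_of_card m V - good)) \<le> ?b / 3" using \<xi> by simp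
  moreover have "card (subsets_of_card m V - good) = card (subsets_of_card m V) - card good"
    using V by (intro card_Diff_subset) (auto simp: good_def)
  moreover have "card good \<le> card (subsets_of_card m V)"
    using V by (intro card_mono) (auto simp: good_def)
  ultimately show ?thesis
    using V by (simp add: card_subsets_of_card of_nat_diff flip: good_def)
qed

section \<open>Cut norm and relative weak regularity\<close>

text \<open>The cut norm of Frieze and Kannan. \<open>u\<close> need not be symmetric and
  \<open>A\<close>, \<open>B\<close> are independent of each other, so kernels supported on
  \<open>x < y\<close> are covered directly.\<close>

definition cut_le :: "'a set \<Rightarrow> real \<Rightarrow> ('a \<Rightarrow> 'a \<Rightarrow> real) \<Rightarrow> bool" where
  "cut_le X \<gamma> u \<longleftrightarrow> (\<forall>A\<subseteq>X. \<forall>B\<subseteq>X. \<bar>\<Sum>x\<in>A. \<Sum>y\<in>B. u x y\<bar> \<le> \<gamma> * real (card X) ^ 2)"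

lemma fractional_subset_sum_le:
  fixes r :: "'a \<Rightarrow> real"
  assumes "finite X" "\<And>x. x \<in> X \<Longrightarrow> 0 \<le> f x \<and> f x \<le> 1"
  obtains A where "A \<subseteq> X" "(\<Sum>x\<in>X. f x * r x) \<le> (\<Sum>x\<in>A. r x)"
proof
  show "{x \<in> X. r x > 0} \<subseteq> X" by auto
  have "f x * r x \<le> (if r x > 0 then r x else 0)" if "x \<in> X" for x
    using assms(2)[OF that] by (cases "r x > 0") (simp_all add: mult_left_le_one_le mult_nonneg_nonpos)
  then have "(\<Sum>x\<in>X. f x * r x) \<le> (\<Sum>x\<in>X. if r x > 0 then r x else 0)"
    by (rule sum_mono)
  also have "\<dots> = (\<Sum>x\<in>{x \<in> X. r x > 0}. r x)"
    by (rule sum.inter_filter[symmetric]) (rule assms(1))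
  finally show "(\<Sum>x\<in>X. f x * r x) \<le> (\<Sum>x\<in>{x \<in> X. r x > 0}. r x)" .
qed

text \<open>The form is linear in \<open>f\<close> and in \<open>g\<close> separately, so first
  \<open>f\<close> and then \<open>g\<close> can be rounded to 0/1 values without decreasing
  it.\<close>

lemma bilinear_le_of_subsets:
  fixes u :: "'a \<Rightarrow> 'a \<Rightarrow> real"
  assumes X: "finite X" and c: "\<And>A B. A \<subseteq> X \<Longrightarrow> B \<subseteq> X \<Longrightarrow> (\<Sum>x\<in>A. \<Sum>y\<in>B. u x y) \<le> c"
    and f: "\<And>x. x \<in> X \<Longrightarrow> 0 \<le> f x \<and> f x \<le> 1" and g: "\<And>x. x \<in> X \<Longrightarrow> 0 \<le> g x \<and> g x \<le> 1"
  shows "(\<Sum>x\<in>X. \<Sum>y\<in>X. f x * g y * u x y) \<le> c"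
proof -
  obtain A where A: "A \<subseteq> X" "(\<Sum>x\<in>X. f x * (\<Sum>y\<in>X. g y * u x y)) \<le> (\<Sum>x\<in>A. \<Sum>y\<in>X. g y * u x y)"
    by (rule fractional_subset_sum_le[OF X f, where r="\<lambda>x. \<Sum>y\<in>X. g y * u x y"])
  obtain B where B: "B \<subseteq> X" "(\<Sum>y\<in>X. g y * (\<Sum>x\<in>A. u x y)) \<le> (\<Sum>y\<in>B. \<Sum>x\<in>A. u x y)"
    by (rule fractional_subset_sum_le[OF X g, where r="\<lambda>y. \<Sum>x\<in>A. u x y"])
  have "(\<Sum>x\<in>X. \<Sum>y\<in>X. f x * g y * u x y) \<le> (\<Sum>x\<in>A. \<Sum>y\<in>X. g y * u x y)"
    using A(2) by (simp add: sum_distrib_left mult.assoc)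
  also have "\<dots> = (\<Sum>y\<in>X. g y * (\<Sum>x\<in>A. u x y))"
    by (simp add: sum_distrib_left sum.swap[of _ A])
  also have "\<dots> \<le> (\<Sum>x\<in>A. \<Sum>y\<in>B. u x y)"
    using B(2) by (simp add: sum.swap[of _ A])
  also have "\<dots> \<le> c" using c A B by auto
  finally show ?thesis .
qed

lemma cut_le_bilinear:
  assumes "finite X" "cut_le X \<gamma> u"
    and "\<And>x. x \<in> X \<Longrightarrow> 0 \<le> f x \<and> f x \<le> 1" and "\<And>x. x \<in> X \<Longrightarrow> 0 \<le> g x \<and> g x \<le> 1"
  shows "\<bar>\<Sum>x\<in>X. \<Sum>y\<in>X. f x * g y * u x y\<bar> \<le> \<gamma> * real (card X) ^ 2"
proof -
  have *: "\<bar>\<Sum>x\<in>A. \<Sum>y\<in>B. u x y\<bar> \<le> \<gamma> * real (card X) ^ 2" if "A \<subseteq> X" "B \<subseteq> X" for A B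
    using assms(2) that unfolding cut_le_def by blast
  have "(\<Sum>x\<in>X. \<Sum>y\<in>X. f x * g y * u x y) \<le> \<gamma> * real (card X) ^ 2"
    using * by (intro bilinear_le_of_subsets assms) (auto simp: abs_le_iff)
  moreover have "(\<Sum>x\<in>X. \<Sum>y\<in>X. f x * g y * (- u x y)) \<le> \<gamma> * real (card X) ^ 2"
    using * by (intro bilinear_le_of_subsets assms) (auto simp: abs_le_iff sum_negf)
  ultimately show ?thesis by (simp add: sum_negf abs_le_iff)
qed

text \<open>Positive and negative parts of \<open>f\<close> and \<open>g\<close> give four forms
  with weights in [0, 1].\<close>

lemma cut_le_bilinear_signed:
  assumes X: "finite X" and u: "cut_le X \<gamma> u"
    and f: "\<And>x. x \<in> X \<Longrightarrow> \<bar>f x\<bar> \<le> 1" and g: "\<And>x. x \<in> X \<Longrightarrow> \<bar>g x\<bar> \<le> 1"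
  shows "\<bar>\<Sum>x\<in>X. \<Sum>y\<in>X. f x * g y * u x y\<bar> \<le> 4 * \<gamma> * real (card X) ^ 2"
proof -
  let ?p = "\<lambda>f x. max 0 (f x)" and ?n = "\<lambda>f x. max 0 (- f x :: real)"
  let ?S = "\<lambda>f g. \<Sum>x\<in>X. \<Sum>y\<in>X. f x * g y * u x y"
  have split: "f x = ?p f x - ?n f x" for f :: "'a \<Rightarrow> real" and x by auto
  have "f x * g y * u x y = ?p f x * ?p g y * u x y - ?p f x * ?n g y * u x y
      - ?n f x * ?p g y * u x y + ?n f x * ?n g y * u x y" for x y
    by (subst split[of f], subst split[of g]) (simp add: algebra_simps)
  then have "?S f g = ?S (?p f) (?p g) - ?S (?p f) (?n g) - ?S (?n f) (?p g) + ?S (?n f) (?n g)"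
    by (simp add: sum.distrib sum_subtractf)
  moreover have "\<bar>?S (?p f) (?p g)\<bar> \<le> \<gamma> * real (card X) ^ 2" "\<bar>?S (?p f) (?n g)\<bar> \<le> \<gamma> * real (card X) ^ 2"
     "\<bar>?S (?n f) (?p g)\<bar> \<le> \<gamma> * real (card X) ^ 2" "\<bar>?S (?n f) (?n g)\<bar> \<le> \<gamma> * real (card X) ^ 2"
    using f g by (intro cut_le_bilinear[OF X u]; force simp: abs_le_iff)+
  ultimately show ?thesis by linarith
qed

lemma cut_le_mono: "cut_le X \<gamma> u \<Longrightarrow> \<gamma> \<le> \<gamma>' \<Longrightarrow> cut_le X \<gamma>' u"
  unfolding cut_le_def by (meson mult_right_mono order_trans zero_le_power2)

lemma cut_le_cong:
  assumes "\<And>x y. x \<in> X \<Longrightarrow> y \<in> X \<Longrightarrow> u x y = v x y"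
  shows "cut_le X \<gamma> u \<longleftrightarrow> cut_le X \<gamma> v"
proof -
  have "(\<Sum>x\<in>A. \<Sum>y\<in>B. u x y) = (\<Sum>x\<in>A. \<Sum>y\<in>B. v x y)" if "A \<subseteq> X" "B \<subseteq> X" for A B
    using assms that by (intro sum.cong refl) auto
  then show ?thesis by (simp add: cut_le_def)
qed

lemma cut_le_add:
  assumes "cut_le X \<gamma> u" "cut_le X \<gamma>' v"
  shows "cut_le X (\<gamma> + \<gamma>') (\<lambda>x y. u x y + v x y)"
  unfolding cut_le_def
proof (intro allI impI)
  fix A B assume "A \<subseteq> X" "B \<subseteq> X"
  then have "\<bar>\<Sum>x\<in>A. \<Sum>y\<in>B. u x y\<bar> \<le> \<gamma> * real (card X) ^ 2" "\<bar>\<Sum>x\<in>A. \<Sum>y\<in>B. v x y\<bar> \<le> \<gamma>' * real (card X) ^ 2"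
    using assms unfolding cut_le_def by blast+
  then show "\<bar>\<Sum>x\<in>A. \<Sum>y\<in>B. u x y + v x y\<bar> \<le> (\<gamma> + \<gamma>') * real (card X) ^ 2"
    by (simp add: sum.distrib distrib_right)
qed

text \<open>The step function is constant on each of \<open>K\<^sup>2\<close> boxes, and the trace
  of a cut on a box is again a cut.\<close>

lemma cut_le_step_mult:
  assumes X: "finite X" and u: "cut_le X \<gamma> u"
    and \<rho>: "\<And>x. x \<in> X \<Longrightarrow> \<rho> x < (K::nat)" and p: "\<And>i j. 0 \<le> p i j \<and> p i j \<le> (1::real)"
  shows "cut_le X (real K ^ 2 * \<gamma>) (\<lambda>x y. p (\<rho> x) (\<rho> y) * u x y)"
  unfolding cut_le_def
proof (intro allI impI)
  fix A B assume AB: "A \<subseteq> X" "B \<subseteq> X"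
  have fin: "finite A" "finite B" using AB X finite_subset by auto
  let ?A = "\<lambda>i. {x \<in> A. \<rho> x = i}" and ?B = "\<lambda>i. {x \<in> B. \<rho> x = i}"
  have "(\<Sum>x\<in>A. \<Sum>y\<in>B. p (\<rho> x) (\<rho> y) * u x y)
      = (\<Sum>i<K. \<Sum>x\<in>?A i. \<Sum>j<K. \<Sum>y\<in>?B j. p (\<rho> x) (\<rho> y) * u x y)"
  proof -
    have "(\<Sum>j<K. \<Sum>y\<in>?B j. p (\<rho> x) (\<rho> y) * u x y) = (\<Sum>y\<in>B. p (\<rho> x) (\<rho> y) * u x y)" for x
      using AB \<rho> fin by (intro sum.group) auto
    moreover have "(\<Sum>i<K. \<Sum>x\<in>?A i. \<Sum>y\<in>B. p (\<rho> x) (\<rho> y) * u x y) = (\<Sum>x\<in>A. \<Sum>y\<in>B. p (\<rho> x) (\<rho> y) * u x y)"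
      using AB \<rho> fin by (intro sum.group) auto
    ultimately show ?thesis by (simp only:)
  qed
  also have "\<dots> = (\<Sum>i<K. \<Sum>j<K. p i j * (\<Sum>x\<in>?A i. \<Sum>y\<in>?B j. u x y))"
  proof (rule sum.cong[OF refl])
    fix i
    have "(\<Sum>x\<in>?A i. \<Sum>j<K. \<Sum>y\<in>?B j. p (\<rho> x) (\<rho> y) * u x y)
        = (\<Sum>j<K. \<Sum>x\<in>?A i. \<Sum>y\<in>?B j. p (\<rho> x) (\<rho> y) * u x y)" by (rule sum.swap)
    then show "(\<Sum>x\<in>?A i. \<Sum>j<K. \<Sum>y\<in>?B j. p (\<rho> x) (\<rho> y) * u x y)
        = (\<Sum>j<K. p i j * (\<Sum>x\<in>?A i. \<Sum>y\<in>?B j. u x y))"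
      by (simp add: sum_distrib_left)
  qed
  also have "\<bar>\<dots>\<bar> \<le> (\<Sum>i<K. \<Sum>j<K. \<gamma> * real (card X) ^ 2)"
  proof (intro order_trans[OF sum_abs] sum_mono)
    fix i j
    have "\<bar>\<Sum>x\<in>?A i. \<Sum>y\<in>?B j. u x y\<bar> \<le> \<gamma> * real (card X) ^ 2"
      using AB by (intro u[unfolded cut_le_def, rule_format]) auto
    then have "\<bar>p i j\<bar> * \<bar>\<Sum>x\<in>?A i. \<Sum>y\<in>?B j. u x y\<bar> \<le> 1 * (\<gamma> * real (card X) ^ 2)"
      using p[of i j] by (intro mult_mono) auto
    then show "\<bar>p i j * (\<Sum>x\<in>?A i. \<Sum>y\<in>?B j. u x y)\<bar> \<le> \<gamma> * real (card X) ^ 2"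
      by (simp add: abs_mult)
  qed
  also have "\<dots> = real K ^ 2 * \<gamma> * real (card X) ^ 2" by (simp add: power2_eq_square)
  finally show "\<bar>\<Sum>x\<in>A. \<Sum>y\<in>B. p (\<rho> x) (\<rho> y) * u x y\<bar> \<le> real K ^ 2 * \<gamma> * real (card X) ^ 2" .
qed

section \<open>The 4-cycle norm and its equivalence with the cut norm\<close>

definition c4_sum :: "'a set \<Rightarrow> ('a \<Rightarrow> 'a \<Rightarrow> real) \<Rightarrow> real" where
  "c4_sum X u = (\<Sum>x\<in>X. \<Sum>x'\<in>X. \<Sum>y\<in>X. \<Sum>y'\<in>X. u x y * u x' y * u x y' * u x' y')"

lemma c4_sum_eq_codegree_squares: "c4_sum X u = (\<Sum>y\<in>X. \<Sum>y'\<in>X. (\<Sum>x\<in>X. u x y * u x y')\<^sup>2)"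
proof -
  have "(\<Sum>y\<in>X. \<Sum>y'\<in>X. (\<Sum>x\<in>X. u x y * u x y')\<^sup>2)
      = (\<Sum>y\<in>X. \<Sum>y'\<in>X. \<Sum>x\<in>X. \<Sum>x'\<in>X. u x y * u x' y * u x y' * u x' y')"
    by (simp add: power2_eq_square sum_product mult_ac)
  also have "\<dots> = (\<Sum>y\<in>X. \<Sum>x\<in>X. \<Sum>y'\<in>X. \<Sum>x'\<in>X. u x y * u x' y * u x y' * u x' y')"
    by (intro sum.cong refl sum.swap)
  also have "\<dots> = (\<Sum>x\<in>X. \<Sum>y\<in>X. \<Sum>y'\<in>X. \<Sum>x'\<in>X. u x y * u x' y * u x y' * u x' y')"
    by (rule sum.swap)
  also have "\<dots> = (\<Sum>x\<in>X. \<Sum>y\<in>X. \<Sum>x'\<in>X. \<Sum>y'\<in>X. u x y * u x' y * u x y' * u x' y')"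
    by (intro sum.cong refl sum.swap)
  also have "\<dots> = (\<Sum>x\<in>X. \<Sum>x'\<in>X. \<Sum>y\<in>X. \<Sum>y'\<in>X. u x y * u x' y * u x y' * u x' y')"
    by (intro sum.cong refl sum.swap)
  finally show ?thesis by (simp add: c4_sum_def)
qed

text \<open>Cauchy-Schwarz twice, over \<open>x\<close> and then over pairs of values of
  \<open>y\<close>; each time the resulting sum of squares is enlarged from the cut to all of
  \<open>X\<close>.\<close>

lemma cut_pow4_le_c4:
  assumes "finite X" "A \<subseteq> X" "B \<subseteq> X"
  shows "(\<Sum>x\<in>A. \<Sum>y\<in>B. u x y) ^ 4 \<le> real (card X) ^ 4 * c4_sum X u"
proof -
  let ?N = "real (card X)"
  define c where "c y y' = (\<Sum>x\<in>X. u x y * u x y')" for y y'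
  define T where "T = (\<Sum>x\<in>X. (\<Sum>y\<in>B. u x y)\<^sup>2)"
  have fin: "finite A" "finite B" using assms finite_subset by auto
  have "(\<Sum>x\<in>A. 1 * (\<Sum>y\<in>B. u x y))\<^sup>2 \<le> (\<Sum>x\<in>A. 1\<^sup>2) * (\<Sum>x\<in>A. (\<Sum>y\<in>B. u x y)\<^sup>2)"
    by (rule Cauchy_Schwarz_ineq_sum)
  also have "\<dots> \<le> ?N * T" unfolding T_def
    using assms by (intro mult_mono sum_mono2) (auto intro: card_mono sum_nonneg)
  finally have 1: "(\<Sum>x\<in>A. \<Sum>y\<in>B. u x y)\<^sup>2 \<le> ?N * T" by simp
  have "T = (\<Sum>x\<in>X. \<Sum>y\<in>B. \<Sum>y'\<in>B. u x y * u x y')"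
    by (simp add: T_def power2_eq_square sum_product)
  also have "\<dots> = (\<Sum>y\<in>B. \<Sum>y'\<in>B. c y y')"
    unfolding c_def sum.swap[of _ X] by simp
  finally have T: "T = (\<Sum>z\<in>B \<times> B. 1 * c (fst z) (snd z))"
    by (simp add: sum.cartesian_product case_prod_unfold)
  have "T\<^sup>2 \<le> (\<Sum>z\<in>B \<times> B. 1\<^sup>2) * (\<Sum>z\<in>B \<times> B. (c (fst z) (snd z))\<^sup>2)"
    unfolding T by (rule Cauchy_Schwarz_ineq_sum)
  also have "\<dots> \<le> ?N ^ 2 * (\<Sum>z\<in>X \<times> X. (c (fst z) (snd z))\<^sup>2)"
  proof (intro mult_mono)
    have "card B \<le> card X" using assms by (intro card_mono)
    then have "real (card B) * real (card B) \<le> ?N * ?N" by (intro mult_mono) auto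
    then show "(\<Sum>z\<in>B \<times> B. 1\<^sup>2) \<le> ?N ^ 2" by (simp add: power2_eq_square card_cartesian_product)
  qed (use assms in \<open>auto intro!: sum_mono2 sum_nonneg\<close>)
  also have "(\<Sum>z\<in>X \<times> X. (c (fst z) (snd z))\<^sup>2) = c4_sum X u"
    by (simp add: c4_sum_eq_codegree_squares c_def sum.cartesian_product case_prod_unfold)
  finally have 2: "T\<^sup>2 \<le> ?N ^ 2 * c4_sum X u" .
  have "((\<Sum>x\<in>A. \<Sum>y\<in>B. u x y)\<^sup>2)\<^sup>2 \<le> (?N * T)\<^sup>2"
    using 1 by (intro power_mono) auto
  also have "\<dots> \<le> ?N\<^sup>2 * (?N ^ 2 * c4_sum X u)"
    unfolding power_mult_distrib using 2 by (intro mult_left_mono) auto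
  finally show ?thesis by (simp flip: power_mult power_add mult.assoc)
qed

lemma cut_le_of_c4:
  assumes "finite X" "c4_sum X u \<le> \<gamma> ^ 4 * real (card X) ^ 4" "\<gamma> \<ge> 0"
  shows "cut_le X \<gamma> u"
  unfolding cut_le_def
proof (intro allI impI)
  fix A B assume "A \<subseteq> X" "B \<subseteq> X"
  let ?s = "\<Sum>x\<in>A. \<Sum>y\<in>B. u x y"
  have "?s ^ 4 \<le> real (card X) ^ 4 * c4_sum X u"
    by (rule cut_pow4_le_c4) fact+
  also have "\<dots> \<le> real (card X) ^ 4 * (\<gamma> ^ 4 * real (card X) ^ 4)"
    using assms by (intro mult_left_mono) auto
  also have "\<dots> = (\<gamma> * real (card X) ^ 2) ^ 4"
    by (simp add: power_mult_distrib flip: power_mult power_add)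
  finally have "\<bar>?s\<bar> ^ 4 \<le> (\<gamma> * real (card X) ^ 2) ^ 4" by (simp add: power_abs[symmetric])
  then show "\<bar>?s\<bar> \<le> \<gamma> * real (card X) ^ 2"
    using power_mono_iff[of "\<bar>?s\<bar>" "\<gamma> * real (card X) ^ 2" 4] assms(3) by simp
qed

text \<open>Once \<open>x'\<close> and \<open>y'\<close> are fixed, \<open>u x y\<close> is
  integrated against one weight in \<open>x\<close> and one weight in \<open>y\<close>, both in
  [-1, 1]. Together with \<open>cut_le_of_c4\<close> this translates cut norm into a statistic of
  four vertices and back.\<close>

lemma c4_le_of_cut:
  assumes X: "finite X" and u: "cut_le X \<gamma> u" and b: "\<And>x y. \<bar>u x y\<bar> \<le> 1"
  shows "c4_sum X u \<le> 4 * \<gamma> * real (card X) ^ 4"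
proof -
  have "c4_sum X u = (\<Sum>x\<in>X. \<Sum>x'\<in>X. \<Sum>y'\<in>X. \<Sum>y\<in>X. u x y * u x' y * u x y' * u x' y')"
    unfolding c4_sum_def by (intro sum.cong refl sum.swap)
  also have "\<dots> = (\<Sum>x'\<in>X. \<Sum>x\<in>X. \<Sum>y'\<in>X. \<Sum>y\<in>X. u x y * u x' y * u x y' * u x' y')"
    by (rule sum.swap)
  also have "\<dots> = (\<Sum>x'\<in>X. \<Sum>y'\<in>X. \<Sum>x\<in>X. \<Sum>y\<in>X. u x y * u x' y * u x y' * u x' y')"
    by (intro sum.cong refl sum.swap)
  also have "\<dots> = (\<Sum>x'\<in>X. \<Sum>y'\<in>X. u x' y' * (\<Sum>x\<in>X. \<Sum>y\<in>X. u x y' * u x' y * u x y))"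
    by (simp add: sum_distrib_left mult_ac)
  also have "\<dots> \<le> (\<Sum>x'\<in>X. \<Sum>y'\<in>X. 4 * \<gamma> * real (card X) ^ 2)"
  proof (intro sum_mono)
    fix x' y'
    have "\<bar>\<Sum>x\<in>X. \<Sum>y\<in>X. u x y' * u x' y * u x y\<bar> \<le> 4 * \<gamma> * real (card X) ^ 2"
      using b by (intro cut_le_bilinear_signed[OF X u]) auto
    then have "\<bar>u x' y'\<bar> * \<bar>\<Sum>x\<in>X. \<Sum>y\<in>X. u x y' * u x' y * u x y\<bar> \<le> 1 * (4 * \<gamma> * real (card X) ^ 2)"
      using b by (intro mult_mono) auto
    then show "u x' y' * (\<Sum>x\<in>X. \<Sum>y\<in>X. u x y' * u x' y * u x y) \<le> 4 * \<gamma> * real (card X) ^ 2"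
      unfolding abs_mult[symmetric] by linarith
  qed
  also have "\<dots> = 4 * \<gamma> * real (card X) ^ 4" by (simp add: power2_eq_square power4_eq_xxxx)
  finally show ?thesis .
qed

section \<open>Energy increment relative to a weight\<close>

definition cell_ratio :: "'w set \<Rightarrow> ('w \<Rightarrow> 'l) \<Rightarrow> ('w \<Rightarrow> real) \<Rightarrow> ('w \<Rightarrow> real) \<Rightarrow> 'l \<Rightarrow> real" where
  "cell_ratio \<Omega> lab u w l = (\<Sum>\<omega>\<in>{\<omega> \<in> \<Omega>. lab \<omega> = l}. u \<omega>) / (\<Sum>\<omega>\<in>{\<omega> \<in> \<Omega>. lab \<omega> = l}. w \<omega>)"

lemma cell_ratio_bounds:
  assumes "\<And>\<omega>. \<omega> \<in> \<Omega> \<Longrightarrow> 0 \<le> u \<omega> \<and> u \<omega> \<le> w \<omega>"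
  shows "0 \<le> cell_ratio \<Omega> lab u w l" "cell_ratio \<Omega> lab u w l \<le> 1"
proof -
  have "0 \<le> (\<Sum>\<omega>\<in>{\<omega> \<in> \<Omega>. lab \<omega> = l}. u \<omega>)" using assms by (intro sum_nonneg) auto
  moreover have "(\<Sum>\<omega>\<in>{\<omega> \<in> \<Omega>. lab \<omega> = l}. u \<omega>) \<le> (\<Sum>\<omega>\<in>{\<omega> \<in> \<Omega>. lab \<omega> = l}. w \<omega>)"
    using assms by (intro sum_mono) auto
  ultimately show "0 \<le> cell_ratio \<Omega> lab u w l" "cell_ratio \<Omega> lab u w l \<le> 1"
    by (auto simp: cell_ratio_def divide_le_eq_1)
qed

text \<open>\<open>cell_ratio\<close> is the conditional expectation of \<open>u / w\<close> under
  the weight \<open>w\<close>, so the residual sums to 0 on every cell. On a cell of total weight 0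
  the quotient is 0 by the convention for division, and \<open>0 \<le> u \<le> w\<close> forces the
  total of \<open>u\<close> to be 0 as well.\<close>

lemma cell_ratio_orthogonal:
  assumes \<Omega>: "finite \<Omega>" and u: "\<And>\<omega>. \<omega> \<in> \<Omega> \<Longrightarrow> 0 \<le> u \<omega> \<and> u \<omega> \<le> w \<omega>"
  shows "(\<Sum>\<omega>\<in>\<Omega>. (u \<omega> - cell_ratio \<Omega> lab u w (lab \<omega>) * w \<omega>) * g (lab \<omega>)) = 0"
proof -
  let ?cell = "\<lambda>l. {\<omega> \<in> \<Omega>. lab \<omega> = l}"
  have "(\<Sum>\<omega>\<in>\<Omega>. (u \<omega> - cell_ratio \<Omega> lab u w (lab \<omega>) * w \<omega>) * g (lab \<omega>))
      = (\<Sum>l\<in>lab ` \<Omega>. \<Sum>\<omega>\<in>?cell l. (u \<omega> - cell_ratio \<Omega> lab u w (lab \<omega>) * w \<omega>) * g (lab \<omega>))"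
    using \<Omega> by (subst sum.group) auto
  also have "\<dots> = (\<Sum>l\<in>lab ` \<Omega>. (sum u (?cell l) - cell_ratio \<Omega> lab u w l * sum w (?cell l)) * g l)"
    by (simp add: sum_subtractf sum_distrib_right[symmetric] sum_distrib_left[symmetric])
  also have "\<dots> = 0"
  proof (rule sum.neutral, rule ballI)
    fix l
    have "sum u (?cell l) = 0" if "sum w (?cell l) = 0"
    proof -
      have "sum u (?cell l) \<le> sum w (?cell l)" "0 \<le> sum u (?cell l)"
        using u by (auto intro!: sum_mono sum_nonneg)
      with that show ?thesis by simp
    qed
    then show "(sum u (?cell l) - cell_ratio \<Omega> lab u w l * sum w (?cell l)) * g l = 0"
      by (auto simp: cell_ratio_def)
  qed
  finally show ?thesis .
qed

text \<open>The squared norm, in the space weighted by \<open>w\<close>, of the projection of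
  \<open>u / w\<close> to the functions that are constant on cells.\<close>

definition energy :: "'w set \<Rightarrow> ('w \<Rightarrow> 'l) \<Rightarrow> ('w \<Rightarrow> real) \<Rightarrow> ('w \<Rightarrow> real) \<Rightarrow> real" where
  "energy \<Omega> lab u w = (\<Sum>\<omega>\<in>\<Omega>. w \<omega> * (cell_ratio \<Omega> lab u w (lab \<omega>))\<^sup>2)"

lemma energy_le_card:
  assumes "\<And>\<omega>. \<omega> \<in> \<Omega> \<Longrightarrow> 0 \<le> u \<omega> \<and> u \<omega> \<le> w \<omega> \<and> w \<omega> \<le> 1"
  shows "energy \<Omega> lab u w \<le> real (card \<Omega>)"
proof -
  have "energy \<Omega> lab u w \<le> (\<Sum>\<omega>\<in>\<Omega>. 1 * 1\<^sup>2)" unfolding energy_def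
  proof (intro sum_mono mult_mono power_mono)
    fix \<omega> assume "\<omega> \<in> \<Omega>"
    then show "w \<omega> \<le> 1" using assms by auto
  qed (use assms cell_ratio_bounds[of \<Omega> u w lab] in auto)
  then show ?thesis by simp
qed

text \<open>Pythagoras in the space weighted by \<open>w\<close>: \<open>p\<close> is the projection
  of the finer \<open>p'\<close>. For the second claim, the residual of \<open>p'\<close> is
  orthogonal to every union of fine cells, so the correlation with \<open>Z\<close> comes from
  \<open>p' - p\<close> alone, and Cauchy-Schwarz bounds it by the gain of energy.\<close>

lemma energy_increment:
  assumes \<Omega>: "finite \<Omega>" and u: "\<And>\<omega>. \<omega> \<in> \<Omega> \<Longrightarrow> 0 \<le> u \<omega> \<and> u \<omega> \<le> w \<omega> \<and> w \<omega> \<le> 1"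
    and lab: "\<And>\<omega>. lab \<omega> = \<phi> (lab' \<omega>)"
  shows "energy \<Omega> lab u w \<le> energy \<Omega> lab' u w"
    and "(\<Sum>\<omega>\<in>\<Omega>. (u \<omega> - cell_ratio \<Omega> lab u w (lab \<omega>) * w \<omega>) * of_bool (Z (lab' \<omega>)))\<^sup>2
       \<le> (energy \<Omega> lab' u w - energy \<Omega> lab u w) * real (card \<Omega>)"
proof -
  define p where "p \<omega> = cell_ratio \<Omega> lab u w (lab \<omega>)" for \<omega>
  define p' where "p' \<omega> = cell_ratio \<Omega> lab' u w (lab' \<omega>)" for \<omega>
  have u': "\<And>\<omega>. \<omega> \<in> \<Omega> \<Longrightarrow> 0 \<le> u \<omega> \<and> u \<omega> \<le> w \<omega>" using u by blast
  have o1: "(\<Sum>\<omega>\<in>\<Omega>. (u \<omega> - p \<omega> * w \<omega>) * p \<omega>) = 0"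
    unfolding p_def by (rule cell_ratio_orthogonal[OF \<Omega> u'])
  have o2: "(\<Sum>\<omega>\<in>\<Omega>. (u \<omega> - p' \<omega> * w \<omega>) * p \<omega>) = 0"
    unfolding p'_def p_def lab by (rule cell_ratio_orthogonal[OF \<Omega> u'])
  have o3: "(\<Sum>\<omega>\<in>\<Omega>. (u \<omega> - p' \<omega> * w \<omega>) * of_bool (Z (lab' \<omega>))) = 0"
    unfolding p'_def by (rule cell_ratio_orthogonal[OF \<Omega> u'])
  have "(\<Sum>\<omega>\<in>\<Omega>. w \<omega> * (p' \<omega> - p \<omega>)\<^sup>2)
     = (\<Sum>\<omega>\<in>\<Omega>. w \<omega> * (p' \<omega>)\<^sup>2 - w \<omega> * (p \<omega>)\<^sup>2 + 2 * ((u \<omega> - p' \<omega> * w \<omega>) * p \<omega>) - 2 * ((u \<omega> - p \<omega> * w \<omega>) * p \<omega>))"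
    by (intro sum.cong refl) (simp add: power2_eq_square algebra_simps)
  also have "\<dots> = energy \<Omega> lab' u w - energy \<Omega> lab u w"
    using o1 o2 by (simp add: sum.distrib sum_subtractf sum_distrib_left[symmetric] energy_def p_def p'_def)
  finally have diff: "(\<Sum>\<omega>\<in>\<Omega>. w \<omega> * (p' \<omega> - p \<omega>)\<^sup>2) = energy \<Omega> lab' u w - energy \<Omega> lab u w" .
  have w0: "w \<omega> \<ge> 0" if "\<omega> \<in> \<Omega>" for \<omega> using u[OF that] by linarith
  then have "0 \<le> (\<Sum>\<omega>\<in>\<Omega>. w \<omega> * (p' \<omega> - p \<omega>)\<^sup>2)" by (intro sum_nonneg) auto
  then show "energy \<Omega> lab u w \<le> energy \<Omega> lab' u w" using diff by simp
  let ?z = "\<lambda>\<omega>. of_bool (Z (lab' \<omega>)) :: real"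
  \<comment> \<open>The weight is split into two square roots so that Cauchy-Schwarz produces the
    weighted norm of \<open>p' - p\<close>.\<close>
  have "(\<Sum>\<omega>\<in>\<Omega>. (u \<omega> - p \<omega> * w \<omega>) * ?z \<omega>)
     = (\<Sum>\<omega>\<in>\<Omega>. (u \<omega> - p' \<omega> * w \<omega>) * ?z \<omega>) + (\<Sum>\<omega>\<in>\<Omega>. (sqrt (w \<omega>) * (p' \<omega> - p \<omega>)) * (sqrt (w \<omega>) * ?z \<omega>))"
    unfolding sum.distrib[symmetric]
  proof (intro sum.cong refl)
    fix \<omega> assume "\<omega> \<in> \<Omega>"
    then have s: "sqrt (w \<omega>) * sqrt (w \<omega>) = w \<omega>" using w0 by simp
    have "(sqrt (w \<omega>) * (p' \<omega> - p \<omega>)) * (sqrt (w \<omega>) * ?z \<omega>) = (sqrt (w \<omega>) * sqrt (w \<omega>)) * (p' \<omega> - p \<omega>) * ?z \<omega>"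
      by (simp only: mult_ac)
    then show "(u \<omega> - p \<omega> * w \<omega>) * ?z \<omega> = (u \<omega> - p' \<omega> * w \<omega>) * ?z \<omega> + (sqrt (w \<omega>) * (p' \<omega> - p \<omega>)) * (sqrt (w \<omega>) * ?z \<omega>)"
      unfolding s by (simp add: algebra_simps)
  qed
  also have "\<dots>\<^sup>2 \<le> (\<Sum>\<omega>\<in>\<Omega>. (sqrt (w \<omega>) * (p' \<omega> - p \<omega>))\<^sup>2) * (\<Sum>\<omega>\<in>\<Omega>. (sqrt (w \<omega>) * ?z \<omega>)\<^sup>2)"
    unfolding o3 add_0_left by (rule Cauchy_Schwarz_ineq_sum)
  also have "(\<Sum>\<omega>\<in>\<Omega>. (sqrt (w \<omega>) * (p' \<omega> - p \<omega>))\<^sup>2) = energy \<Omega> lab' u w - energy \<Omega> lab u w"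
    unfolding diff[symmetric] using w0 by (intro sum.cong refl) (simp add: power_mult_distrib)
  also have "\<dots> * (\<Sum>\<omega>\<in>\<Omega>. (sqrt (w \<omega>) * ?z \<omega>)\<^sup>2) \<le> \<dots> * real (card \<Omega>)"
  proof (rule mult_left_mono)
    have "(\<Sum>\<omega>\<in>\<Omega>. (sqrt (w \<omega>) * ?z \<omega>)\<^sup>2) \<le> (\<Sum>\<omega>\<in>\<Omega>. 1)"
    proof (rule sum_mono)
      fix \<omega> assume "\<omega> \<in> \<Omega>"
      then show "(sqrt (w \<omega>) * ?z \<omega>)\<^sup>2 \<le> 1"
        using u[of \<omega>] w0[of \<omega>] by (cases "Z (lab' \<omega>)") simp_all
    qed
    then show "(\<Sum>\<omega>\<in>\<Omega>. (sqrt (w \<omega>) * ?z \<omega>)\<^sup>2) \<le> real (card \<Omega>)" by simp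
  qed (use \<open>energy \<Omega> lab u w \<le> energy \<Omega> lab' u w\<close> in simp)
  finally show "(\<Sum>\<omega>\<in>\<Omega>. (u \<omega> - cell_ratio \<Omega> lab u w (lab \<omega>) * w \<omega>) * of_bool (Z (lab' \<omega>)))\<^sup>2
       \<le> (energy \<Omega> lab' u w - energy \<Omega> lab u w) * real (card \<Omega>)"
    by (simp add: p_def)
qed

definition cell_density :: "'a set \<Rightarrow> ('a \<Rightarrow> 'l) \<Rightarrow> ('a \<Rightarrow> 'a \<Rightarrow> real) \<Rightarrow> ('a \<Rightarrow> 'a \<Rightarrow> real) \<Rightarrow> 'l \<Rightarrow> 'l \<Rightarrow> real" where
  "cell_density X \<rho> u w i j = cell_ratio (X \<times> X) (\<lambda>(x, y). (\<rho> x, \<rho> y)) (\<lambda>(x, y). u x y) (\<lambda>(x, y). w x y) (i, j)"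

text \<open>Frieze-Kannan regularity with \<open>w\<close> as the ambient kernel; plain weak
  regularity is the case of \<open>w\<close> constantly 1. The energy summed over \<open>C\<close>
  never exceeds \<open>card C * card X ^ 2\<close>, and each violated cut raises it by
  \<open>\<gamma>\<^sup>2 * card X ^ 2\<close>, so after \<open>M\<close> rounds there would be too
  much of it. The error is measured against the full square, which keeps the number of parts
  independent of how sparse \<open>w\<close> is. One partition serves all members of
  \<open>C\<close>.\<close>

lemma relative_weak_regularity:
  fixes u w :: "'c \<Rightarrow> 'a \<Rightarrow> 'a \<Rightarrow> real"
  assumes X: "finite X" and C: "finite C" and \<gamma>: "\<gamma> > 0" "real M * \<gamma>\<^sup>2 > real (card C)"
    and u: "\<And>c x y. c \<in> C \<Longrightarrow> x \<in> X \<Longrightarrow> y \<in> X \<Longrightarrow> 0 \<le> u c x y \<and> u c x y \<le> w c x y \<and> w c x y \<le> 1"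
  obtains \<rho> :: "'a \<Rightarrow> nat" where "\<And>x. \<rho> x < 4 ^ M"
    "\<And>c. c \<in> C \<Longrightarrow> cut_le X \<gamma> (\<lambda>x y. u c x y - cell_density X \<rho> (u c) (w c) (\<rho> x) (\<rho> y) * w c x y)"
proof (cases "X = {}")
  case True
  then show ?thesis by (intro that[of "\<lambda>_. 0"]) (auto simp: cut_le_def)
next
  case False
  define good :: "('a \<Rightarrow> nat) \<Rightarrow> bool" where "good \<rho> \<longleftrightarrow> (\<forall>c\<in>C. cut_le X \<gamma>
      (\<lambda>x y. u c x y - cell_density X \<rho> (u c) (w c) (\<rho> x) (\<rho> y) * w c x y))" for \<rho>
  let ?lab = "\<lambda>\<rho> z. (\<rho> (fst z), \<rho> (snd z))"
  let ?u = "\<lambda>c z. u c (fst z) (snd z)" and ?w = "\<lambda>c z. w c (fst z) (snd z)"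
  let ?E = "\<lambda>\<rho>::'a \<Rightarrow> nat. \<Sum>c\<in>C. energy (X \<times> X) (?lab \<rho>) (?u c) (?w c)"
  let ?N = "real (card X) ^ 2"
  have N: "?N > 0" "real (card (X \<times> X)) = ?N"
    using X False by (auto simp: card_gt_0_iff card_cartesian_product power2_eq_square)
  have uw: "0 \<le> ?u c z \<and> ?u c z \<le> ?w c z \<and> ?w c z \<le> 1" if "c \<in> C" "z \<in> X \<times> X" for c z
    using u that by auto
  have step: "\<exists>\<rho>'. (\<forall>x. \<rho>' x < 4 * 4 ^ k) \<and> ?E \<rho>' \<ge> ?E \<rho> + \<gamma>\<^sup>2 * ?N"
    if \<rho>: "\<forall>x. \<rho> x < 4 ^ k" "\<not> good \<rho>" for \<rho> :: "'a \<Rightarrow> nat" and k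
  proof -
    obtain c A B where c: "c \<in> C" and AB: "A \<subseteq> X" "B \<subseteq> X"
      and big: "\<bar>\<Sum>x\<in>A. \<Sum>y\<in>B. u c x y - cell_density X \<rho> (u c) (w c) (\<rho> x) (\<rho> y) * w c x y\<bar> > \<gamma> * ?N"
      using \<rho>(2) unfolding good_def cut_le_def by (auto simp: not_le)
    \<comment> \<open>Two further binary digits record membership in \<open>A\<close> and in
      \<open>B\<close>. Division by 4 recovers the old label, and \<open>Z\<close> reads off from
      the new labels whether a pair belongs to the violated cut.\<close>
    define \<rho>' where "\<rho>' x = 4 * \<rho> x + 2 * of_bool (x \<in> A) + of_bool (x \<in> B)" for x
    define \<phi> where "\<phi> = map_prod (\<lambda>i::nat. i div 4) (\<lambda>i::nat. i div 4)"
    define Z where "Z = (\<lambda>(i::nat, j::nat). (i div 2) mod 2 = 1 \<and> j mod 2 = 1)"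
    have lab: "?lab \<rho> z = \<phi> (?lab \<rho>' z)" for z
      by (auto simp: \<phi>_def \<rho>'_def of_bool_def)
    have Z: "Z (?lab \<rho>' z) \<longleftrightarrow> fst z \<in> A \<and> snd z \<in> B" for z
      unfolding Z_def \<rho>'_def of_bool_def by (auto simp: mod_mult_left_eq) presburger+
    have "4 * \<rho> x + 3 < 4 * 4 ^ k" for x using \<rho>(1)[rule_format, of x] by linarith
    then have 1: "\<rho>' x < 4 * 4 ^ k" for x
      by (rule le_less_trans[rotated]) (auto simp: \<rho>'_def of_bool_def)
    define e where "e c = energy (X \<times> X) (?lab \<rho>) (?u c) (?w c)" for c
    define e' where "e' c = energy (X \<times> X) (?lab \<rho>') (?u c) (?w c)" for c
    have mono: "e c' \<le> e' c'" if "c' \<in> C" for c' unfolding e_def e'_def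
      using X uw[OF that] lab by (intro energy_increment(1)[where \<phi>=\<phi>]) auto
    let ?s = "\<Sum>z\<in>X \<times> X. (?u c z - cell_ratio (X \<times> X) (?lab \<rho>) (?u c) (?w c) (?lab \<rho> z) * ?w c z) * of_bool (Z (?lab \<rho>' z))"
    have inc: "?s\<^sup>2 \<le> (e' c - e c) * ?N" unfolding e_def e'_def N(2)[symmetric]
      using X uw[OF c] lab by (intro energy_increment(2)[where \<phi>=\<phi>]) auto
    have "?s = (\<Sum>z\<in>X \<times> X. if z \<in> A \<times> B then ?u c z - cell_density X \<rho> (u c) (w c) (\<rho> (fst z)) (\<rho> (snd z)) * ?w c z else 0)"
      unfolding Z by (intro sum.cong refl) (auto simp: cell_density_def case_prod_unfold)
    also have "\<dots> = (\<Sum>z\<in>A \<times> B. ?u c z - cell_density X \<rho> (u c) (w c) (\<rho> (fst z)) (\<rho> (snd z)) * ?w c z)"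
    proof -
      have "X \<times> X \<inter> A \<times> B = A \<times> B" using AB by auto
      then show ?thesis using X by (subst sum.inter_restrict[symmetric]) auto
    qed
    also have "\<dots> = (\<Sum>x\<in>A. \<Sum>y\<in>B. u c x y - cell_density X \<rho> (u c) (w c) (\<rho> x) (\<rho> y) * w c x y)"
      by (simp add: sum.cartesian_product case_prod_unfold)
    finally have "\<bar>?s\<bar> \<ge> \<gamma> * ?N" using big by linarith
    then have "(\<gamma> * ?N)\<^sup>2 \<le> \<bar>?s\<bar>\<^sup>2"
      using \<gamma> by (intro power_mono) auto
    then have "(\<gamma> * ?N)\<^sup>2 \<le> ?s\<^sup>2" by (simp only: power2_abs)
    then have "\<gamma>\<^sup>2 * ?N * ?N \<le> (e' c - e c) * ?N" using inc by (simp add: power_mult_distrib power2_eq_square mult_ac)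
    then have "\<gamma>\<^sup>2 * ?N \<le> e' c - e c" using N by (simp add: mult_le_cancel_right)
    moreover have "sum e' (C - {c}) \<ge> sum e (C - {c})" using mono by (intro sum_mono) auto
    ultimately have "sum e' C \<ge> sum e C + \<gamma>\<^sup>2 * ?N"
      using C c by (simp add: sum.remove[of C c])
    then show ?thesis using 1 unfolding e_def e'_def by blast
  qed
  have iter: "(\<exists>\<rho>. (\<forall>x. \<rho> x < 4 ^ M) \<and> good \<rho>) \<or> (\<exists>\<rho>. (\<forall>x. \<rho> x < 4 ^ k) \<and> ?E \<rho> \<ge> real k * \<gamma>\<^sup>2 * ?N)" if "k \<le> M" for k
    using that
  proof (induction k)
    case 0
    have "?E (\<lambda>_. 0) \<ge> 0"
      unfolding energy_def
    proof (intro sum_nonneg mult_nonneg_nonneg)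
      fix c z assume "c \<in> C" "z \<in> X \<times> X"
      then show "0 \<le> ?w c z" using uw[of c z] by linarith
    qed simp
    then have "(\<forall>x. (\<lambda>_::'a. 0::nat) x < 4 ^ 0) \<and> ?E (\<lambda>_. 0) \<ge> real 0 * \<gamma>\<^sup>2 * ?N" by simp
    then show ?case by (intro disjI2 exI[of _ "\<lambda>_. 0"])
  next
    case (Suc k)
    show ?case
    proof (rule disjCI)
      assume no: "\<not> (\<exists>\<rho>. (\<forall>x. \<rho> x < 4 ^ Suc k) \<and> ?E \<rho> \<ge> real (Suc k) * \<gamma>\<^sup>2 * ?N)"
      show "\<exists>\<rho>. (\<forall>x. \<rho> x < 4 ^ M) \<and> good \<rho>"
      proof (rule ccontr)
        assume ng: "\<not> ?thesis"
        then obtain \<rho> where \<rho>: "\<forall>x. \<rho> x < 4 ^ k" "?E \<rho> \<ge> real k * \<gamma>\<^sup>2 * ?N"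
          using Suc by auto
        have "\<not> good \<rho>"
        proof
          assume "good \<rho>"
          moreover have "(4::nat) ^ k \<le> 4 ^ M" using Suc.prems by (intro power_increasing) auto
          ultimately show False using ng \<rho>(1) by (meson less_le_trans)
        qed
        then obtain \<rho>' where "\<forall>x. \<rho>' x < 4 * 4 ^ k" "?E \<rho>' \<ge> ?E \<rho> + \<gamma>\<^sup>2 * ?N"
          using step \<rho>(1) by blast
        moreover have "real (Suc k) * \<gamma>\<^sup>2 * ?N = real k * \<gamma>\<^sup>2 * ?N + \<gamma>\<^sup>2 * ?N" by (simp add: algebra_simps)
        ultimately have "(\<forall>x. \<rho>' x < 4 ^ Suc k) \<and> ?E \<rho>' \<ge> real (Suc k) * \<gamma>\<^sup>2 * ?N"
          using \<rho>(2) unfolding power_Suc by (intro conjI) (assumption, linarith)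
        then show False using no by (elim notE) (rule exI)
      qed
    qed
  qed
  have "?E \<rho> < real M * \<gamma>\<^sup>2 * ?N" for \<rho>
  proof -
    have "?E \<rho> \<le> (\<Sum>c\<in>C. ?N)" using uw unfolding N(2)[symmetric] by (intro sum_mono energy_le_card) auto
    also have "\<dots> < real M * \<gamma>\<^sup>2 * ?N" using \<gamma> N(1) by (simp add: mult_strict_right_mono)
    finally show ?thesis .
  qed
  then obtain \<rho> where "\<forall>x. \<rho> x < 4 ^ M" "good \<rho>"
    using iter[of M] by (auto simp: not_le[symmetric])
  then show ?thesis by (intro that) (auto simp: good_def)
qed

section \<open>Counting in ordered colored graphs\<close>

lemma edgeE:
  assumes "e \<in> edges q"
  obtains a b where "1 \<le> a" "a < b" "b \<le> q" "e = {a, b}" "Min e = a" "Max e = b"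
proof -
  obtain x y where xy: "e = {x, y}" "x \<noteq> y" "x \<in> {1..q}" "y \<in> {1..q}"
    using assms by (auto simp: edges_def card_2_iff)
  show ?thesis
  proof (cases "x < y")
    case True
    then show ?thesis using xy by (intro that[of x y]) (auto simp: min_def max_def)
  next
    case False
    then show ?thesis using xy by (intro that[of y x]) (auto simp: min_def max_def)
  qed
qed

lemma edges_insert2 [simp]: "{a, b} \<in> edges n \<longleftrightarrow> a \<noteq> b \<and> a \<in> {1..n} \<and> b \<in> {1..n}"
  by (auto simp: edges_def card_insert_if)

lemma finite_edges [simp]: "finite (edges n)"
  by (rule finite_subset[of _ "Pow {1..n}"]) (auto simp: edges_def)

lemma finite_ordered_graphs [simp]: "finite (ordered_graphs n :: ('c::finite) ograph set)"
  unfolding ordered_graphs_def by (intro finite_PiE) auto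

definition color_kernel :: "(nat set \<Rightarrow> 'd) \<Rightarrow> 'd \<Rightarrow> nat \<Rightarrow> nat \<Rightarrow> real" where
  "color_kernel C c x y = of_bool (x < y \<and> C {x, y} = c)"

definition pattern :: "nat \<Rightarrow> (nat set \<Rightarrow> 'd) \<Rightarrow> nat list \<Rightarrow> 'd ograph" where
  "pattern q C l = (\<lambda>e\<in>edges q. C ((\<lambda>i. l ! (i - 1)) ` e))"

text \<open>Only increasing tuples contribute, so each \<open>q\<close>-set counts once although the
  normalization is by all tuples: the constant 1 gets the value
  \<open>(card X choose q) / card X ^ q\<close>.\<close>

definition stat :: "nat \<Rightarrow> nat set \<Rightarrow> ('d ograph \<Rightarrow> real) \<Rightarrow> (nat set \<Rightarrow> 'd) \<Rightarrow> real" where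
  "stat q X h C = tuple_mean q X (\<lambda>l. if sorted_wrt (<) l then h (pattern q C l) else 0)"

definition low :: "'a list \<Rightarrow> nat set \<Rightarrow> 'a" where "low l e = l ! (Min e - 1)"

definition high :: "'a list \<Rightarrow> nat set \<Rightarrow> 'a" where "high l e = l ! (Max e - 1)"

text \<open>The multilinear expansion over all possible patterns: in this form kernels can be
  exchanged edge by edge. The argument type \<open>'a\<close> is free because \<open>B\<close> is
  evaluated on vertices and also on types of vertices.\<close>

definition kernel_density ::
  "nat \<Rightarrow> ('d ograph \<Rightarrow> real) \<Rightarrow> ('d \<Rightarrow> 'a \<Rightarrow> 'a \<Rightarrow> real) \<Rightarrow> 'a list \<Rightarrow> real" where
  "kernel_density q h B l = (\<Sum>t\<in>ordered_graphs q. h t * (\<Prod>e\<in>edges q. B (t e) (low l e) (high l e)))"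

lemma pattern_in_ordered_graphs [simp]: "pattern q C l \<in> ordered_graphs q"
  by (auto simp: pattern_def ordered_graphs_def)

lemma prod_of_bool:
  "finite A \<Longrightarrow> (\<Prod>x\<in>A. of_bool (P x)) = (of_bool (\<forall>x\<in>A. P x) :: real)"
  by (induction A rule: finite_induct) auto

lemma image_edge:
  assumes "e \<in> edges q"
  shows "(\<lambda>i. l ! (i - 1)) ` e = {low l e, high l e}"
  using assms by (elim edgeE) (auto simp: low_def high_def)

lemma ordered_graphs_eqI:
  "G \<in> ordered_graphs n \<Longrightarrow> H \<in> ordered_graphs n \<Longrightarrow> (\<And>e. e \<in> edges n \<Longrightarrow> G e = H e) \<Longrightarrow> G = H"
  unfolding ordered_graphs_def by (rule PiE_ext)

text \<open>On an increasing tuple the product of kernels is the indicator of \<open>t\<close> being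
  the induced pattern, so one summand survives. On any other tuple some pair of positions is out of
  order, and its kernel kills every summand.\<close>

lemma pattern_indicator_eq_kernel_density:
  fixes C :: "nat set \<Rightarrow> 'd::finite"
  assumes "length l = q"
  shows "(if sorted_wrt (<) l then h (pattern q C l) else 0) = kernel_density q h (color_kernel C) l"
proof (cases "sorted_wrt (<) l")
  case True
  have lt: "low l e < high l e" if "e \<in> edges q" for e
    using that True assms by (elim edgeE) (auto simp: low_def high_def sorted_wrt_iff_nth_less)
  have "kernel_density q h (color_kernel C) l = (\<Sum>t\<in>ordered_graphs q. h t * of_bool (t = pattern q C l))"
    unfolding kernel_density_def
  proof (intro sum.cong refl arg_cong2[where f="(*)"])
    fix t :: "'d ograph" assume t: "t \<in> ordered_graphs q"
    have "(\<Prod>e\<in>edges q. color_kernel C (t e) (low l e) (high l e)) = (\<Prod>e\<in>edges q. of_bool (t e = pattern q C l e))"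
      using lt by (intro prod.cong refl) (auto simp: color_kernel_def pattern_def image_edge simp del: One_nat_def)
    also have "\<dots> = of_bool (\<forall>e\<in>edges q. t e = pattern q C l e)" by (simp add: prod_of_bool)
    also have "(\<forall>e\<in>edges q. t e = pattern q C l e) \<longleftrightarrow> t = pattern q C l"
      using ordered_graphs_eqI[OF t pattern_in_ordered_graphs] by auto
    finally show "(\<Prod>e\<in>edges q. color_kernel C (t e) (low l e) (high l e)) = of_bool (t = pattern q C l)" .
  qed
  also have "\<dots> = h (pattern q C l)"
    by (subst sum.remove[of _ "pattern q C l"]) auto
  finally show ?thesis using True by simp
next
  case False
  then obtain i j where ij: "i < j" "j < q" "\<not> l ! i < l ! j"
    using assms by (auto simp: sorted_wrt_iff_nth_less)
  have "(\<Prod>e\<in>edges q. color_kernel C (t e) (low l e) (high l e)) = 0" for t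
  proof (rule prod_zero)
    show "\<exists>e\<in>edges q. color_kernel C (t e) (low l e) (high l e) = 0"
    proof (rule bexI)
      \<comment> \<open>Positions in a list start at 0, vertices of a pattern at 1.\<close>
      show "{Suc i, Suc j} \<in> edges q" using ij by auto
      show "color_kernel C (t {Suc i, Suc j}) (low l {Suc i, Suc j}) (high l {Suc i, Suc j}) = 0"
        using ij by (auto simp: color_kernel_def low_def high_def)
    qed
  qed simp
  then show ?thesis using False by (simp add: kernel_density_def del: prod_zero_iff)
qed

text \<open>Exchanging the overwritten entry with the new one is an involution on pairs of a tuple
  and a value. This makes it possible to average over one coordinate with the others held
  fixed.\<close>

lemma sum_tuples_update:
  fixes F :: "'a list \<Rightarrow> real"
  assumes "i < q"
  shows "(\<Sum>l\<in>tuples q X. \<Sum>x\<in>X. F (l[i := x])) = real (card X) * (\<Sum>l\<in>tuples q X. F l)"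
proof -
  have "(\<Sum>l\<in>tuples q X. \<Sum>x\<in>X. F (l[i := x])) = (\<Sum>(l, x)\<in>tuples q X \<times> X. F (l[i := x]))"
    by (simp add: sum.cartesian_product)
  also have "\<dots> = (\<Sum>(l, x)\<in>tuples q X \<times> X. F l)"
    using assms
    by (intro sum.reindex_bij_witness[where i="\<lambda>(l, x). (l[i := x], l ! i)" and j="\<lambda>(l, x). (l[i := x], l ! i)"])
       (auto simp: tuples_def dest: set_update_subset_insert[THEN subsetD])
  also have "\<dots> = real (card X) * (\<Sum>l\<in>tuples q X. F l)"
    by (simp add: sum.cartesian_product[symmetric] sum_distrib_left)
  finally show ?thesis .
qed

text \<open>Fixing all coordinates but those of \<open>d\<close>, every other edge sees at most one of the two, so
  the product over the other edges is of the form \<open>f x * g y\<close>.\<close>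

lemma replace_edge_kernel:
  assumes X: "finite X" and E: "E \<subseteq> edges q" "d \<in> edges q" "d \<notin> E"
    and u: "cut_le X \<gamma> u" and w: "\<And>e x y. e \<in> E \<Longrightarrow> 0 \<le> w e x y \<and> w e x y \<le> (1::real)"
  shows "\<bar>\<Sum>l\<in>tuples q X. u (low l d) (high l d) * (\<Prod>e\<in>E. w e (low l e) (high l e))\<bar> \<le> \<gamma> * real (card X) ^ q"
proof -
  obtain a b where d: "1 \<le> a" "a < b" "b \<le> q" "d = {a, b}" "Min d = a" "Max d = b"
    using E(2) by (rule edgeE)
  define i where "i = a - 1"
  define j where "j = b - 1"
  have ij: "i < j" "j < q" "Min d - 1 = i" "Max d - 1 = j" "a = Suc i" "b = Suc j"
    using d by (auto simp: i_def j_def)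
  have finE: "finite E" using E finite_subset finite_edges by blast
  let ?F = "\<lambda>l. u (low l d) (high l d) * (\<Prod>e\<in>E. w e (low l e) (high l e))"
  let ?N = "real (card X)"
  have main: "\<bar>\<Sum>x\<in>X. \<Sum>y\<in>X. ?F ((l[i := x])[j := y])\<bar> \<le> \<gamma> * ?N ^ 2" if l: "l \<in> tuples q X" for l
  proof -
    have len: "length l = q" using l by (simp add: tuples_def)
    define E1 where "E1 = {e \<in> E. a \<in> e}"
    define E2 where "E2 = {e \<in> E. a \<notin> e}"
    define f where "f x = (\<Prod>e\<in>E1. w e (low (l[i := x]) e) (high (l[i := x]) e))" for x
    define g where "g y = (\<Prod>e\<in>E2. w e (low (l[j := y]) e) (high (l[j := y]) e))" for y
    have Es: "E = E1 \<union> E2" "E1 \<inter> E2 = {}" "finite E1" "finite E2" using finE by (auto simp: E1_def E2_def)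
    have "?F ((l[i := x])[j := y]) = f x * g y * u x y" for x y
    proof -
      have "w e (low (l[i := x, j := y]) e) (high (l[i := x, j := y]) e) = w e (low (l[i := x]) e) (high (l[i := x]) e)"
        if e: "e \<in> E1" for e
      proof -
        have "e \<in> edges q" "e \<noteq> d" "a \<in> e" using e E by (auto simp: E1_def)
        then obtain a' b' where e': "1 \<le> a'" "a' < b'" "e = {a', b'}" "Min e = a'" "Max e = b'" "{a', b'} \<noteq> {a, b}" "a \<in> {a', b'}"
          using d by (elim edgeE) blast
        have "a' \<noteq> b" "b' \<noteq> b" using e' d(2) by auto
        then have "Min e - 1 \<noteq> j" "Max e - 1 \<noteq> j" using e' d j_def by auto
        then show ?thesis by (simp add: low_def high_def)
      qed
      moreover have "w e (low (l[i := x, j := y]) e) (high (l[i := x, j := y]) e) = w e (low (l[j := y]) e) (high (l[j := y]) e)"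
        if e: "e \<in> E2" for e
      proof -
        have "e \<in> edges q" "e \<noteq> d" "a \<notin> e" using e E by (auto simp: E2_def)
        then obtain a' b' where e': "1 \<le> a'" "a' < b'" "e = {a', b'}" "Min e = a'" "Max e = b'" "a \<notin> {a', b'}"
          by (elim edgeE) blast
        then have "Min e - 1 \<noteq> i" "Max e - 1 \<noteq> i" using d i_def by auto
        moreover have "l[i := x, j := y] = l[j := y, i := x]" using ij by (simp add: list_update_swap)
        ultimately show ?thesis by (simp add: low_def high_def)
      qed
      ultimately have "(\<Prod>e\<in>E. w e (low (l[i := x, j := y]) e) (high (l[i := x, j := y]) e)) = f x * g y"
        using Es by (simp add: prod.union_disjoint f_def g_def)
      moreover have "low (l[i := x, j := y]) d = x" "high (l[i := x, j := y]) d = y"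
        using ij len by (auto simp: low_def high_def)
      ultimately show ?thesis by simp
    qed
    moreover have "\<bar>\<Sum>x\<in>X. \<Sum>y\<in>X. f x * g y * u x y\<bar> \<le> \<gamma> * ?N ^ 2"
      using w by (intro cut_le_bilinear[OF X u])
        (auto simp: f_def g_def E1_def E2_def intro!: prod_nonneg prod_le_1)
    ultimately show ?thesis by simp
  qed
  show ?thesis
  proof (cases "X = {}")
    case True
    then show ?thesis using d by (simp add: tuples_def) (auto simp: power_0_left intro!: sum.neutral)
  next
    case False
    then have N: "?N > 0" using X by (simp add: card_gt_0_iff)
    have "(\<Sum>l\<in>tuples q X. \<Sum>x\<in>X. \<Sum>y\<in>X. ?F (l[i := x, j := y])) = ?N * (?N * (\<Sum>l\<in>tuples q X. ?F l))"
    proof -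
      have "(\<Sum>l\<in>tuples q X. \<Sum>x\<in>X. \<Sum>y\<in>X. ?F (l[i := x, j := y])) = ?N * (\<Sum>l\<in>tuples q X. \<Sum>y\<in>X. ?F (l[j := y]))"
        using ij by (intro sum_tuples_update) simp
      also have "(\<Sum>l\<in>tuples q X. \<Sum>y\<in>X. ?F (l[j := y])) = ?N * (\<Sum>l\<in>tuples q X. ?F l)"
        using ij by (intro sum_tuples_update)
      finally show ?thesis .
    qed
    then have "?N * (?N * \<bar>\<Sum>l\<in>tuples q X. ?F l\<bar>) = \<bar>\<Sum>l\<in>tuples q X. \<Sum>x\<in>X. \<Sum>y\<in>X. ?F (l[i := x, j := y])\<bar>"
      using N by (simp add: abs_mult)
    also have "\<dots> \<le> (\<Sum>l\<in>tuples q X. \<gamma> * ?N ^ 2)"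
      by (intro order_trans[OF sum_abs] sum_mono main)
    also have "\<dots> = ?N * (?N * (\<gamma> * ?N ^ q))"
      using X by (simp add: card_tuples power2_eq_square)
    finally show ?thesis using N by simp
  qed
qed

text \<open>A hybrid argument: the edges in \<open>D\<close> already carry \<open>u\<close>, the
  others still \<open>v\<close>, and moving one edge changes a single factor.\<close>

lemma counting_lemma:
  assumes X: "finite X"
    and u: "\<And>e x y. e \<in> edges q \<Longrightarrow> 0 \<le> u e x y \<and> u e x y \<le> (1::real)"
    and v: "\<And>e x y. e \<in> edges q \<Longrightarrow> 0 \<le> v e x y \<and> v e x y \<le> (1::real)"
    and uv: "\<And>e. e \<in> edges q \<Longrightarrow> cut_le X \<gamma> (\<lambda>x y. u e x y - v e x y)"
  shows "\<bar>(\<Sum>l\<in>tuples q X. \<Prod>e\<in>edges q. u e (low l e) (high l e))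
        - (\<Sum>l\<in>tuples q X. \<Prod>e\<in>edges q. v e (low l e) (high l e))\<bar>
      \<le> real (card (edges q)) * \<gamma> * real (card X) ^ q"
proof -
  define w where "w D e = (if e \<in> D then u e else v e)" for D e
  define f where "f D = (\<Sum>l\<in>tuples q X. \<Prod>e\<in>edges q. w D e (low l e) (high l e))" for D
  have "\<bar>f D - f {}\<bar> \<le> real (card D) * \<gamma> * real (card X) ^ q" if "finite D" "D \<subseteq> edges q" for D
    using that
  proof (induction D rule: finite_induct)
    case empty
    then show ?case by simp
  next
    case (insert d D)
    have *: "(\<Prod>e\<in>edges q. w D' e (low l e) (high l e))
        = w D' d (low l d) (high l d) * (\<Prod>e\<in>edges q - {d}. w D e (low l e) (high l e))"
      if "D' - {d} = D" for D' l
    proof -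
      have "(\<Prod>e\<in>edges q - {d}. w D' e (low l e) (high l e)) = (\<Prod>e\<in>edges q - {d}. w D e (low l e) (high l e))"
        using that by (intro prod.cong refl) (auto simp: w_def)
      then show ?thesis using insert.prems by (simp add: prod.remove[of "edges q" d])
    qed
    have D: "insert d D - {d} = D" "D - {d} = D" using insert.hyps by auto
    have "f (insert d D) - f D = (\<Sum>l\<in>tuples q X. (u d (low l d) (high l d) - v d (low l d) (high l d))
          * (\<Prod>e\<in>edges q - {d}. w D e (low l e) (high l e)))"
      unfolding f_def sum_subtractf[symmetric] *[OF D(1)] *[OF D(2)]
      using insert.hyps by (simp add: w_def[of _ d] algebra_simps)
    also have "\<bar>\<dots>\<bar> \<le> \<gamma> * real (card X) ^ q"
      using insert.prems u v uv
      by (intro replace_edge_kernel[OF X, where u="\<lambda>x y. u d x y - v d x y"]) (auto simp: w_def)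
    finally have "\<bar>f (insert d D) - f D\<bar> \<le> \<gamma> * real (card X) ^ q" .
    moreover have "real (card (insert d D)) * \<gamma> * real (card X) ^ q
        = real (card D) * \<gamma> * real (card X) ^ q + \<gamma> * real (card X) ^ q"
      using insert.hyps by (simp add: algebra_simps)
    ultimately show ?case using insert.IH insert.prems by auto
  qed
  from this[of "edges q"] show ?thesis by (simp add: f_def w_def)
qed

text \<open>The approximating quantity sees a vertex only through its type \<open>\<tau> x\<close>,
  so statistics of graphs on different vertex sets become comparable through the frequencies of
  types. The number of patterns enters because the counting lemma is applied to each of
  them.\<close>

lemma stat_near_kernel_density:
  fixes C :: "nat set \<Rightarrow> 'd::finite"
  assumes X: "finite X" "X \<noteq> {}"
    and B: "\<And>c s t. 0 \<le> B c s t \<and> B c s t \<le> (1::real)"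
    and cut: "\<And>c. cut_le X \<gamma> (\<lambda>x y. color_kernel C c x y - B c (\<tau> x) (\<tau> y))"
    and h: "\<And>t. 0 \<le> h t \<and> h t \<le> 1"
  shows "\<bar>stat q X h C - tuple_mean q X (\<lambda>l. kernel_density q h B (map \<tau> l))\<bar>
       \<le> real (card (ordered_graphs q :: 'd ograph set)) * (real (card (edges q)) * \<gamma>)"
proof -
  let ?N = "real (card X) ^ q"
  have N: "?N > 0" using X by (simp add: card_gt_0_iff)
  let ?u = "\<lambda>t l. \<Prod>e\<in>edges q. color_kernel C (t e) (low l e) (high l e)"
  let ?v = "\<lambda>t l. \<Prod>e\<in>edges q. B (t e) (\<tau> (low l e)) (\<tau> (high l e))"
  have "stat q X h C * ?N = (\<Sum>l\<in>tuples q X. \<Sum>t\<in>ordered_graphs q. h t * ?u t l)"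
  proof -
    have "stat q X h C * ?N = (\<Sum>l\<in>tuples q X. if sorted_wrt (<) l then h (pattern q C l) else 0)"
      using N by (simp add: stat_def tuple_mean_def)
    also have "\<dots> = (\<Sum>l\<in>tuples q X. kernel_density q h (color_kernel C) l)"
      by (intro sum.cong refl pattern_indicator_eq_kernel_density) (simp add: tuples_def)
    finally show ?thesis by (simp only: kernel_density_def)
  qed
  also have "\<dots> = (\<Sum>t\<in>ordered_graphs q. h t * (\<Sum>l\<in>tuples q X. ?u t l))"
    unfolding sum_distrib_left by (rule sum.swap)
  finally have 1: "stat q X h C * ?N = (\<Sum>t\<in>ordered_graphs q. h t * (\<Sum>l\<in>tuples q X. ?u t l))" .
  have "tuple_mean q X (\<lambda>l. kernel_density q h B (map \<tau> l)) * ?N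
      = (\<Sum>l\<in>tuples q X. \<Sum>t\<in>ordered_graphs q. h t * ?v t l)"
  proof -
    have "low (map \<tau> l) e = \<tau> (low l e) \<and> high (map \<tau> l) e = \<tau> (high l e)"
      if "l \<in> tuples q X" "e \<in> edges q" for l e
      using that(2,1) by (elim edgeE) (auto simp: low_def high_def tuples_def)
    then have "kernel_density q h B (map \<tau> l) = (\<Sum>t\<in>ordered_graphs q. h t * ?v t l)" if "l \<in> tuples q X" for l
      using that unfolding kernel_density_def by (intro sum.cong refl arg_cong2[where f="(*)"] prod.cong) auto
    then show ?thesis using N by (simp add: tuple_mean_def)
  qed
  also have "\<dots> = (\<Sum>t\<in>ordered_graphs q. h t * (\<Sum>l\<in>tuples q X. ?v t l))"
    unfolding sum_distrib_left by (rule sum.swap)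
  finally have 2: "tuple_mean q X (\<lambda>l. kernel_density q h B (map \<tau> l)) * ?N
      = (\<Sum>t\<in>ordered_graphs q. h t * (\<Sum>l\<in>tuples q X. ?v t l))" .
  have "\<bar>stat q X h C - tuple_mean q X (\<lambda>l. kernel_density q h B (map \<tau> l))\<bar> * ?N
      = \<bar>(\<Sum>t\<in>ordered_graphs q. h t * (\<Sum>l\<in>tuples q X. ?u t l)) - (\<Sum>t\<in>ordered_graphs q. h t * (\<Sum>l\<in>tuples q X. ?v t l))\<bar>"
    using N unfolding 1[symmetric] 2[symmetric] left_diff_distrib[symmetric] by (simp add: abs_mult)
  also have "\<dots> = \<bar>\<Sum>t\<in>ordered_graphs q. h t * ((\<Sum>l\<in>tuples q X. ?u t l) - (\<Sum>l\<in>tuples q X. ?v t l))\<bar>"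
    by (simp add: right_diff_distrib sum_subtractf)
  also have "\<dots> \<le> (\<Sum>t\<in>(ordered_graphs q :: 'd ograph set). real (card (edges q)) * \<gamma> * ?N)"
  proof (intro order_trans[OF sum_abs] sum_mono)
    fix t :: "'d ograph"
    have "\<bar>(\<Sum>l\<in>tuples q X. ?u t l) - (\<Sum>l\<in>tuples q X. ?v t l)\<bar> \<le> real (card (edges q)) * \<gamma> * ?N"
      using B cut by (intro counting_lemma[OF X(1), where v="\<lambda>e x y. B (t e) (\<tau> x) (\<tau> y)"]) (auto simp: color_kernel_def)
    then have "\<bar>h t\<bar> * \<bar>(\<Sum>l\<in>tuples q X. ?u t l) - (\<Sum>l\<in>tuples q X. ?v t l)\<bar> \<le> 1 * (real (card (edges q)) * \<gamma> * ?N)"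
      using h[of t] by (intro mult_mono) auto
    then show "\<bar>h t * ((\<Sum>l\<in>tuples q X. ?u t l) - (\<Sum>l\<in>tuples q X. ?v t l))\<bar> \<le> real (card (edges q)) * \<gamma> * ?N"
      by (simp add: abs_mult)
  qed
  also have "\<dots> = real (card (ordered_graphs q :: 'd ograph set)) * (real (card (edges q)) * \<gamma>) * ?N" by simp
  finally show ?thesis using N by (simp only: mult_le_cancel_right_pos)
qed

lemma abs_kernel_density_le:
  fixes h :: "'d::finite ograph \<Rightarrow> real"
  assumes B: "\<And>c s t. 0 \<le> B c s t \<and> B c s t \<le> (1::real)" and h: "\<And>t. 0 \<le> h t \<and> h t \<le> 1"
  shows "\<bar>kernel_density q h B l\<bar> \<le> real (card (ordered_graphs q :: 'd ograph set))"
proof -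
  have "\<bar>kernel_density q h B l\<bar> \<le> (\<Sum>t\<in>(ordered_graphs q :: 'd ograph set). 1)"
    unfolding kernel_density_def
  proof (intro order_trans[OF sum_abs] sum_mono)
    fix t :: "'d ograph"
    have "0 \<le> (\<Prod>e\<in>edges q. B (t e) (low l e) (high l e))" "(\<Prod>e\<in>edges q. B (t e) (low l e) (high l e)) \<le> 1"
      using B by (auto intro!: prod_nonneg prod_le_1)
    then show "\<bar>h t * (\<Prod>e\<in>edges q. B (t e) (low l e) (high l e))\<bar> \<le> 1"
      using h[of t] by (auto simp: abs_mult intro!: mult_le_one)
  qed
  then show ?thesis by simp
qed

section \<open>Comparing two vertex sets through the frequencies of their types\<close>

definition fiber_dist :: "'t set \<Rightarrow> 'a set \<Rightarrow> ('a \<Rightarrow> 't) \<Rightarrow> 'b set \<Rightarrow> ('b \<Rightarrow> 't) \<Rightarrow> real" where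
  "fiber_dist T X \<tau> Y \<sigma> = (\<Sum>t\<in>T. \<bar>real (card {x \<in> X. \<tau> x = t}) / card X - real (card {y \<in> Y. \<sigma> y = t}) / card Y\<bar>)"

text \<open>Grouping by type turns both means into integrals of \<open>G\<close> against the two
  distributions of types; \<open>fiber_dist\<close> is the L1 distance of these
  distributions.\<close>

lemma mean_pullback_diff:
  fixes G :: "'t \<Rightarrow> real"
  assumes fin: "finite X" "finite Y" "finite T" and im: "\<tau> ` X \<subseteq> T" "\<sigma> ` Y \<subseteq> T" and G: "\<And>t. \<bar>G t\<bar> \<le> c"
  shows "\<bar>(\<Sum>x\<in>X. G (\<tau> x)) / card X - (\<Sum>y\<in>Y. G (\<sigma> y)) / card Y\<bar> \<le> c * fiber_dist T X \<tau> Y \<sigma>"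
proof -
  have gr: "(\<Sum>x\<in>Z. G (f x)) = (\<Sum>t\<in>T. real (card {x \<in> Z. f x = t}) * G t)"
    if "finite Z" "f ` Z \<subseteq> T" for Z :: "'z set" and f
    using sum.group[OF that(1) fin(3) that(2), of "\<lambda>x. G (f x)"] by simp
  have "(\<Sum>x\<in>X. G (\<tau> x)) / card X - (\<Sum>y\<in>Y. G (\<sigma> y)) / card Y
      = (\<Sum>t\<in>T. (real (card {x \<in> X. \<tau> x = t}) / card X - real (card {y \<in> Y. \<sigma> y = t}) / card Y) * G t)"
    using fin im by (simp add: gr sum_divide_distrib sum_subtractf left_diff_distrib)
  also have "\<bar>\<dots>\<bar> \<le> (\<Sum>t\<in>T. \<bar>real (card {x \<in> X. \<tau> x = t}) / card X - real (card {y \<in> Y. \<sigma> y = t}) / card Y\<bar> * c)"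
    using G by (intro order_trans[OF sum_abs] sum_mono) (auto simp: abs_mult intro!: mult_left_mono)
  also have "\<dots> = c * fiber_dist T X \<tau> Y \<sigma>" by (simp only: fiber_dist_def sum_distrib_right mult.commute[of c])
  finally show ?thesis .
qed

lemma tuple_mean_Suc:
  "tuple_mean (Suc r) X h = (\<Sum>x\<in>X. tuple_mean r X (\<lambda>l. h (x # l))) / card X"
  by (simp add: tuple_mean_def sum_tuples_Suc sum_divide_distrib[symmetric] mult.commute)

text \<open>The \<open>r\<close> coordinates are moved from \<open>X\<close> to \<open>Y\<close> one
  at a time, each at the cost given by \<open>mean_pullback_diff\<close>.\<close>

lemma tuple_mean_pullback_diff:
  fixes g :: "'t list \<Rightarrow> real"
  assumes fin: "finite X" "finite Y" "finite T" "X \<noteq> {}"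
    and im: "\<tau> ` X \<subseteq> T" "\<sigma> ` Y \<subseteq> T" and g: "\<And>l. \<bar>g l\<bar> \<le> c"
  shows "\<bar>tuple_mean r X (\<lambda>l. g (map \<tau> l)) - tuple_mean r Y (\<lambda>l. g (map \<sigma> l))\<bar> \<le> r * c * fiber_dist T X \<tau> Y \<sigma>"
  using g
proof (induction r arbitrary: g)
  case 0
  then show ?case by (simp add: tuple_mean_def)
next
  case (Suc r)
  let ?d = "fiber_dist T X \<tau> Y \<sigma>"
  have c: "c \<ge> 0" using Suc.prems[of "[]"] by linarith
  define A where "A t = tuple_mean r X (\<lambda>l. g (t # map \<tau> l))" for t
  define B where "B t = tuple_mean r Y (\<lambda>l. g (t # map \<sigma> l))" for t
  have "\<bar>A t - B t\<bar> \<le> r * c * ?d" for t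
    unfolding A_def B_def using Suc.IH[of "\<lambda>l. g (t # l)"] Suc.prems by simp
  then have "\<bar>\<Sum>x\<in>X. A (\<tau> x) - B (\<tau> x)\<bar> \<le> (\<Sum>x\<in>X. r * c * ?d)"
    by (intro order_trans[OF sum_abs] sum_mono) auto
  then have "\<bar>\<Sum>x\<in>X. A (\<tau> x) - B (\<tau> x)\<bar> / card X \<le> r * c * ?d"
    using fin by (simp add: divide_le_eq card_gt_0_iff mult_ac)
  then have 1: "\<bar>(\<Sum>x\<in>X. A (\<tau> x)) / card X - (\<Sum>x\<in>X. B (\<tau> x)) / card X\<bar> \<le> r * c * ?d"
    by (simp add: sum_subtractf abs_divide diff_divide_distrib[symmetric])
  have 2: "\<bar>(\<Sum>x\<in>X. B (\<tau> x)) / card X - (\<Sum>y\<in>Y. B (\<sigma> y)) / card Y\<bar> \<le> c * ?d"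
    unfolding B_def using fin im Suc.prems c by (intro mean_pullback_diff abs_tuple_mean_le) auto
  have "real (Suc r) * c * ?d = r * c * ?d + c * ?d" by (simp add: algebra_simps)
  moreover have "tuple_mean (Suc r) X (\<lambda>l. g (map \<tau> l)) = (\<Sum>x\<in>X. A (\<tau> x)) / card X"
    "tuple_mean (Suc r) Y (\<lambda>l. g (map \<sigma> l)) = (\<Sum>y\<in>Y. B (\<sigma> y)) / card Y"
    by (simp_all add: tuple_mean_Suc A_def B_def)
  ultimately show ?case using 1 2 by linarith
qed

text \<open>Class \<open>i\<close> offers \<open>c i\<close> slots, rounded up. These are at least
  \<open>card A\<close> slots, so \<open>A\<close> injects into them. Upper bounds on the fibers are
  enough for \<open>transfer_partition\<close>.\<close>

lemma integral_rounding:
  fixes c :: "nat \<Rightarrow> real"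
  assumes A: "finite A" and c: "\<And>i. i < K \<Longrightarrow> c i \<ge> 0" "(\<Sum>i<K. c i) = card A"
  obtains f where "\<And>x. x \<in> A \<Longrightarrow> f x < K" "\<And>i. i < K \<Longrightarrow> real (card {x \<in> A. f x = i}) \<le> c i + 1"
proof -
  define B where "B = (SIGMA i:{..<K}. {..<nat \<lceil>c i\<rceil>})"
  have "real (card A) \<le> (\<Sum>i<K. real (nat \<lceil>c i\<rceil>))"
    unfolding c(2)[symmetric] by (intro sum_mono) (auto simp: real_nat_ceiling_ge)
  also have "\<dots> = real (card B)" by (simp add: B_def)
  finally have "card A \<le> card B" by simp
  moreover have fB: "finite B" by (simp add: B_def)
  ultimately obtain g where g: "g ` A \<subseteq> B" "inj_on g A"
    using card_le_inj[OF A] by blast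
  show ?thesis
  proof (rule that[of "fst \<circ> g"])
    fix x assume "x \<in> A"
    then show "(fst \<circ> g) x < K" using g by (auto simp: B_def)
  next
    fix i assume i: "i < K"
    have "card {x \<in> A. (fst \<circ> g) x = i} \<le> card ({i} \<times> {..<nat \<lceil>c i\<rceil>})"
    proof (rule card_inj_on_le)
      show "inj_on g {x \<in> A. (fst \<circ> g) x = i}" using g(2) by (rule inj_on_subset) auto
      show "g ` {x \<in> A. (fst \<circ> g) x = i} \<subseteq> {i} \<times> {..<nat \<lceil>c i\<rceil>}" using g(1) by (force simp: B_def)
    qed simp
    also have "\<dots> = nat \<lceil>c i\<rceil>" by (simp add: card_cartesian_product)
    finally have "real (card {x \<in> A. (fst \<circ> g) x = i}) \<le> real (nat \<lceil>c i\<rceil>)" by simp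
    also have "\<dots> \<le> c i + 1" using c(1)[OF i] by linarith
    finally show "real (card {x \<in> A. (fst \<circ> g) x = i}) \<le> c i + 1" .
  qed
qed

lemma sum_fibers_card:
  assumes "finite X" "finite T" "f ` X \<subseteq> T"
  shows "(\<Sum>t\<in>T. real (card {x \<in> X. f x = t})) = card X"
  using sum.group[OF assms, of "\<lambda>_. 1::real"] by simp

text \<open>Inside each part of \<open>V\<close> the labels are given out in the proportions in
  which \<open>\<rho>\<close> divides the corresponding part of \<open>S\<close>. Per cell, the
  discrepancy of the part sizes costs at most \<open>\<xi>\<close> and rounding costs at most one
  vertex.\<close>

lemma transfer_partition:
  fixes \<pi> :: "'a \<Rightarrow> nat" and \<pi>' :: "'b \<Rightarrow> nat" and \<rho> :: "'b \<Rightarrow> nat"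
  assumes V: "finite V" "V \<noteq> {}" and S: "finite S" "S \<noteq> {}"
    and \<pi>: "\<And>x. x \<in> V \<Longrightarrow> \<pi> x < k" "\<And>x. x \<in> S \<Longrightarrow> \<pi>' x < k" and \<rho>: "\<And>x. x \<in> S \<Longrightarrow> \<rho> x < K"
    and close: "\<And>l. l < k \<Longrightarrow> \<bar>real (card {x \<in> S. \<pi>' x = l}) / card S - real (card {x \<in> V. \<pi> x = l}) / card V\<bar> \<le> \<xi>"
  obtains \<rho>' where "\<And>x. x \<in> V \<Longrightarrow> \<rho>' x < K"
    "fiber_dist ({..<K} \<times> {..<k}) V (\<lambda>x. (\<rho>' x, \<pi> x)) S (\<lambda>x. (\<rho> x, \<pi>' x)) \<le> 2 * K * k * (\<xi> + 1 / card V)"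
proof -
  let ?Vl = "\<lambda>l. {x \<in> V. \<pi> x = l}" and ?Sl = "\<lambda>l. {x \<in> S. \<pi>' x = l}"
  let ?n = "real (card V)" and ?m = "real (card S)"
  have nm: "?n > 0" "?m > 0" using V S by (auto simp: card_gt_0_iff)
  have K: "K > 0" using S \<rho> by (metis all_not_in_conv less_nat_zero_code not_gr_zero)
  have "\<exists>f. (\<forall>x\<in>?Vl l. f x < K) \<and> (\<forall>i<K. real (card {x \<in> ?Vl l. f x = i}) / ?n
      \<le> real (card {x \<in> ?Sl l. \<rho> x = i}) / ?m + (\<xi> + 1 / ?n))" if l: "l < k" for l
  proof (cases "?Sl l = {}")
    \<comment> \<open>The sample misses this part, so there are no proportions to copy. But then the
      part is at most a fraction \<open>\<xi>\<close> of \<open>V\<close>, and all of it may get the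
      label 0.\<close>
    case True
    have "real (card {x \<in> ?Vl l. (\<lambda>_. 0) x = i}) / ?n \<le> real (card {x \<in> ?Sl l. \<rho> x = i}) / ?m + (\<xi> + 1 / ?n)" for i :: nat
    proof -
      have "real (card {x \<in> ?Vl l. (\<lambda>_. 0) x = i}) / ?n \<le> real (card (?Vl l)) / ?n"
        using V by (intro divide_right_mono) (auto intro!: card_mono)
      also have "\<dots> \<le> \<xi>" using close[OF l] True by simp
      also have "\<dots> \<le> real (card {x \<in> ?Sl l. \<rho> x = i}) / ?m + (\<xi> + 1 / ?n)" using nm by simp
      finally show ?thesis .
    qed
    then show ?thesis using K by (intro exI[of _ "\<lambda>_. 0"]) auto
  next
    case False
    let ?M = "real (card (?Sl l))" and ?N = "real (card (?Vl l))"
    have M: "?M > 0" using False S by (simp add: card_gt_0_iff)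
    define c where "c i = ?N * (real (card {x \<in> ?Sl l. \<rho> x = i}) / ?M)" for i
    have "(\<Sum>i<K. c i) = ?N * ((\<Sum>i<K. real (card {x \<in> ?Sl l. \<rho> x = i})) / ?M)"
      by (simp add: c_def sum_distrib_left sum_divide_distrib)
    also have "(\<Sum>i<K. real (card {x \<in> ?Sl l. \<rho> x = i})) = ?M"
      using S \<rho> by (intro sum_fibers_card) auto
    finally have c: "(\<Sum>i<K. c i) = ?N" using M by simp
    obtain f where f: "\<And>x. x \<in> ?Vl l \<Longrightarrow> f x < K" "\<And>i. i < K \<Longrightarrow> real (card {x \<in> ?Vl l. f x = i}) \<le> c i + 1"
      using integral_rounding[of "?Vl l" K c] V c by (auto simp: c_def)
    have "real (card {x \<in> ?Vl l. f x = i}) / ?n \<le> real (card {x \<in> ?Sl l. \<rho> x = i}) / ?m + (\<xi> + 1 / ?n)" if "i < K" for i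
    proof -
      let ?r = "real (card {x \<in> ?Sl l. \<rho> x = i})"
      have "card {x \<in> ?Sl l. \<rho> x = i} \<le> card (?Sl l)" using S by (intro card_mono) auto
      then have r1: "?r / ?M \<le> 1" using M by simp
      have "?N / ?n \<le> ?M / ?m + \<xi>" and \<xi>: "\<xi> \<ge> 0" using close[OF l] by linarith+
      then have "?N / ?n * (?r / ?M) \<le> (?M / ?m + \<xi>) * (?r / ?M)" by (intro mult_right_mono) auto
      also have "\<dots> = ?r / ?m + \<xi> * (?r / ?M)" using M by (simp add: field_simps)
      also have "\<dots> \<le> ?r / ?m + \<xi> * 1" using r1 \<xi> by (intro add_left_mono mult_left_mono)
      finally have "c i / ?n \<le> ?r / ?m + \<xi>" by (simp add: c_def mult.commute)
      moreover have "real (card {x \<in> ?Vl l. f x = i}) / ?n \<le> (c i + 1) / ?n"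
        using f(2)[OF that] nm by (intro divide_right_mono) auto
      ultimately show ?thesis by (simp add: add_divide_distrib)
    qed
    then show ?thesis using f by blast
  qed
  then have "\<forall>l. \<exists>f. l < k \<longrightarrow> (\<forall>x\<in>?Vl l. f x < K) \<and> (\<forall>i<K. real (card {x \<in> ?Vl l. f x = i}) / ?n
      \<le> real (card {x \<in> ?Sl l. \<rho> x = i}) / ?m + (\<xi> + 1 / ?n))" by blast
  from choice[OF this] obtain f where "\<forall>l. l < k \<longrightarrow> (\<forall>x\<in>?Vl l. f l x < K) \<and> (\<forall>i<K. real (card {x \<in> ?Vl l. f l x = i}) / ?n
      \<le> real (card {x \<in> ?Sl l. \<rho> x = i}) / ?m + (\<xi> + 1 / ?n))" ..
  then have f: "\<And>l x. l < k \<Longrightarrow> x \<in> ?Vl l \<Longrightarrow> f l x < K"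
    "\<And>l i. l < k \<Longrightarrow> i < K \<Longrightarrow> real (card {x \<in> ?Vl l. f l x = i}) / ?n
      \<le> real (card {x \<in> ?Sl l. \<rho> x = i}) / ?m + (\<xi> + 1 / ?n)"
    by blast+
  define \<rho>' where "\<rho>' x = f (\<pi> x) x" for x
  let ?T = "{..<K} \<times> {..<k}"
  define d where "d t = real (card {x \<in> V. (\<rho>' x, \<pi> x) = t}) / ?n - real (card {x \<in> S. (\<rho> x, \<pi>' x) = t}) / ?m" for t
  have \<rho>': "\<rho>' x < K" if "x \<in> V" for x using f(1)[of "\<pi> x" x] \<pi> that by (auto simp: \<rho>'_def)
  have d: "d t \<le> \<xi> + 1 / ?n" if t: "t \<in> ?T" for t
  proof -
    obtain i l where il: "t = (i, l)" "i < K" "l < k" using t by auto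
    have "{x \<in> V. (\<rho>' x, \<pi> x) = t} = {x \<in> ?Vl l. f l x = i}" "{x \<in> S. (\<rho> x, \<pi>' x) = t} = {x \<in> ?Sl l. \<rho> x = i}"
      by (auto simp: il \<rho>'_def)
    then show ?thesis using f(2)[OF il(3,2)] by (simp add: d_def)
  qed
  have e0: "\<xi> + 1 / ?n \<ge> 0" if "t \<in> ?T" for t
  proof -
    have "\<xi> \<ge> 0" using that close[of "snd t"] by (auto intro: order_trans[OF abs_ge_zero])
    then show ?thesis by simp
  qed
  \<comment> \<open>Both distributions have total mass 1, so positive and negative deviations
    balance: upper bounds on \<open>d\<close> bound the L1 distance, at the price of a factor
    2.\<close>
  have "(\<Sum>t\<in>?T. d t) = 0"
  proof -
    have "(\<Sum>t\<in>?T. real (card {x \<in> V. (\<rho>' x, \<pi> x) = t})) = ?n"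
      using V \<rho>' \<pi> by (intro sum_fibers_card) auto
    moreover have "(\<Sum>t\<in>?T. real (card {x \<in> S. (\<rho> x, \<pi>' x) = t})) = ?m"
      using S \<rho> \<pi> by (intro sum_fibers_card) auto
    ultimately show ?thesis using nm by (simp only: d_def sum_subtractf sum_divide_distrib[symmetric]) simp
  qed
  then have "(\<Sum>t\<in>?T. \<bar>d t\<bar>) = (\<Sum>t\<in>?T. 2 * max (d t) 0 - d t)"
    by (intro sum.cong refl) (auto simp: max_def)
  also have "\<dots> = (\<Sum>t\<in>?T. 2 * max (d t) 0)" using \<open>(\<Sum>t\<in>?T. d t) = 0\<close> by (simp only: sum_subtractf)
  also have "\<dots> \<le> (\<Sum>t\<in>?T. 2 * (\<xi> + 1 / ?n))"
    using d e0 by (intro sum_mono mult_left_mono max.boundedI) auto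
  also have "\<dots> = 2 * K * k * (\<xi> + 1 / card V)" by (simp add: card_cartesian_product)
  finally show ?thesis using \<rho>' by (intro that) (auto simp: fiber_dist_def d_def)
qed

section \<open>Lifting a recoloring\<close>

lemma c4_sum_cartesian:
  "c4_sum X u = (\<Sum>(x, x', y, y')\<in>X \<times> X \<times> X \<times> X. u x y * u x' y * u x y' * u x' y')"
  by (simp add: c4_sum_def sum.cartesian_product)

text \<open>With independent edge colors, a term of the 4-cycle sum vanishes in expectation unless
  \<open>x = x'\<close> or \<open>y = y'\<close>.\<close>

lemma random_recoloring:
  fixes p :: "nat set \<Rightarrow> 'c::finite \<Rightarrow> real" and G :: "nat set \<Rightarrow> 'b::finite"
  assumes p: "\<And>e c. e \<in> edges n \<Longrightarrow> p e c \<ge> 0" "\<And>e. e \<in> edges n \<Longrightarrow> (\<Sum>c\<in>UNIV. p e c) = 1"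
  obtains H where "H \<in> ordered_graphs n" "\<And>e. e \<in> edges n \<Longrightarrow> p e (H e) > 0"
    "\<And>a b. c4_sum {1..n} (\<lambda>x y. of_bool (x < y \<and> G {x, y} = a) * (of_bool (H {x, y} = b) - p {x, y} b))
       \<le> real CARD('b) * real CARD('c) * (2 * real n ^ 3)"
proof -
  let ?X = "{1..n}" and ?\<Omega> = "ordered_graphs n :: 'c ograph set"
  define v where "v a b e c = of_bool (G e = a) * (of_bool (c = b) - p e b)" for a b e c
  define u where "u a b H x y = of_bool (x < y) * v a b {x, y} (H {x, y})" for a b and H :: "'c ograph" and x y
  define W where "W H = (\<Prod>e\<in>edges n. p e (H e))" for H
  let ?t = "\<lambda>a b H (x, x', y, y'). u a b H x y * u a b H x' y * u a b H x y' * u a b H x' y'"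
  let ?Q = "?X \<times> ?X \<times> ?X \<times> ?X"
  have W0: "W H \<ge> 0" for H using p by (auto simp: W_def intro!: prod_nonneg)
  have W1: "(\<Sum>H\<in>?\<Omega>. W H) = 1"
    unfolding W_def ordered_graphs_def using p(2) by (subst prod_sum_PiE[symmetric]) auto
  have p1: "p e c \<le> 1" if "e \<in> edges n" for e c
    using p(1)[OF that] member_le_sum[of c UNIV "p e"] p(2)[OF that] by auto
  have u1: "\<bar>u a b H x y\<bar> \<le> 1" if "x \<in> ?X" "y \<in> ?X" for a b H x y
  proof (cases "x < y")
    case True
    then have "{x, y} \<in> edges n" using that by auto
    then show ?thesis using p(1)[of "{x, y}" b] p1[of "{x, y}" b] by (auto simp: u_def v_def of_bool_def)
  qed (simp add: u_def)
  have zero: "(\<Sum>H\<in>?\<Omega>. W H * ?t a b H (x, x', y, y')) = 0"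
    if X: "x \<in> ?X" "x' \<in> ?X" "y \<in> ?X" "y' \<in> ?X" and ne: "x \<noteq> x'" "y \<noteq> y'" for a b x x' y y'
  proof (cases "x < y \<and> x' < y \<and> x < y' \<and> x' < y'")
    case True
    define e1 e2 e3 e4 where "e1 = {x, y}" and "e2 = {x', y}" and "e3 = {x, y'}" and "e4 = {x', y'}"
    have E: "e1 \<in> edges n" "e2 \<in> edges n" "e3 \<in> edges n" "e4 \<in> edges n"
      using X True by (auto simp: e1_def e2_def e3_def e4_def)
    have ne': "e1 \<noteq> e2" "e1 \<noteq> e3" "e1 \<noteq> e4"
      using ne True by (auto simp: e1_def e2_def e3_def e4_def doubleton_eq_iff)
    \<comment> \<open>Spreads the four factors over a product over all edges, so that the
      expectation factors. The edge \<open>e1\<close> differs from the other three, hence its factor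
      is \<open>v a b e1\<close> alone, which has mean 0.\<close>
    define \<phi> where "\<phi> e c = (if e = e1 then v a b e1 c else 1) * (if e = e2 then v a b e2 c else 1)
       * (if e = e3 then v a b e3 c else 1) * (if e = e4 then v a b e4 c else 1)" for e c
    have one: "(\<Prod>e\<in>edges n. if e = f then v a b f (H e) else 1) = v a b f (H f)" if "f \<in> edges n" for f H
      using that by (subst prod.remove[of _ f]) (auto intro!: prod.neutral)
    have "(\<Sum>H\<in>?\<Omega>. W H * ?t a b H (x, x', y, y')) = (\<Sum>H\<in>?\<Omega>. \<Prod>e\<in>edges n. p e (H e) * \<phi> e (H e))"
    proof (rule sum.cong[OF refl])
      fix H
      have "(\<Prod>e\<in>edges n. \<phi> e (H e)) = v a b e1 (H e1) * v a b e2 (H e2) * v a b e3 (H e3) * v a b e4 (H e4)"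
        using E by (simp only: \<phi>_def prod.distrib one)
      also have "\<dots> = ?t a b H (x, x', y, y')"
        using True by (simp add: u_def e1_def e2_def e3_def e4_def)
      finally show "W H * ?t a b H (x, x', y, y') = (\<Prod>e\<in>edges n. p e (H e) * \<phi> e (H e))"
        by (simp add: W_def prod.distrib)
    qed
    also have "\<dots> = (\<Prod>e\<in>edges n. \<Sum>c\<in>UNIV. p e c * \<phi> e c)"
      unfolding ordered_graphs_def by (subst prod_sum_PiE) auto
    also have "\<dots> = 0"
    proof (rule prod_zero)
      have "(\<Sum>c\<in>UNIV. p e1 c * \<phi> e1 c) = (\<Sum>c\<in>UNIV. p e1 c * v a b e1 c)"
        using ne' by (simp add: \<phi>_def)
      also have "\<dots> = of_bool (G e1 = a) * ((\<Sum>c\<in>UNIV. if c = b then p e1 c else 0) - (\<Sum>c\<in>UNIV. p e1 c) * p e1 b)"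
        unfolding v_def sum_distrib_right sum_subtractf[symmetric] unfolding sum_distrib_left
        by (intro sum.cong refl) (simp add: algebra_simps)
      also have "\<dots> = 0" using p(2)[OF E(1)] by simp
      finally show "\<exists>e\<in>edges n. (\<Sum>c\<in>UNIV. p e c * \<phi> e c) = 0" using E(1) by blast
    qed simp
    finally show ?thesis .
  next
    case False
    then show ?thesis by (auto simp: u_def)
  qed
  \<comment> \<open>The condition \<open>x = x'\<close> leaves \<open>n ^ 3\<close> quadruples, and
    so does \<open>y = y'\<close>; each term is at most 1.\<close>
  have E: "(\<Sum>H\<in>?\<Omega>. W H * c4_sum ?X (u a b H)) \<le> 2 * real n ^ 3" for a b
  proof -
    have "(\<Sum>H\<in>?\<Omega>. W H * c4_sum ?X (u a b H)) = (\<Sum>H\<in>?\<Omega>. \<Sum>z\<in>?Q. W H * ?t a b H z)"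
      by (simp add: c4_sum_cartesian sum_distrib_left)
    also have "\<dots> = (\<Sum>z\<in>?Q. \<Sum>H\<in>?\<Omega>. W H * ?t a b H z)" by (rule sum.swap)
    also have "\<dots> \<le> (\<Sum>z\<in>?Q. case z of (x, x', y, y') \<Rightarrow> of_bool (x = x') + of_bool (y = y'))"
    proof (rule sum_mono)
      fix z assume "z \<in> ?Q"
      then obtain x x' y y' where z: "z = (x, x', y, y')" and X: "x \<in> ?X" "x' \<in> ?X" "y \<in> ?X" "y' \<in> ?X" by auto
      show "(\<Sum>H\<in>?\<Omega>. W H * ?t a b H z) \<le> (case z of (x, x', y, y') \<Rightarrow> of_bool (x = x') + of_bool (y = y'))"
      proof (cases "x \<noteq> x' \<and> y \<noteq> y'")
        case True
        then show ?thesis using zero[OF X] z by simp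
      next
        case False
        have "(\<Sum>H\<in>?\<Omega>. W H * ?t a b H z) \<le> (\<Sum>H\<in>?\<Omega>. W H * 1)"
        proof (intro sum_mono mult_left_mono W0)
          fix H :: "'c ograph"
          have "\<bar>?t a b H z\<bar> \<le> 1" unfolding z prod.case abs_mult
            using u1 X by (intro mult_le_one mult_nonneg_nonneg) auto
          then show "?t a b H z \<le> 1" by linarith
        qed
        then have "(\<Sum>H\<in>?\<Omega>. W H * ?t a b H z) \<le> 1" using W1 by simp
        also have "(1::real) \<le> (case z of (x, x', y, y') \<Rightarrow> of_bool (x = x') + of_bool (y = y'))"
          using False z by auto
        finally show ?thesis .
      qed
    qed
    also have "\<dots> = (\<Sum>x\<in>?X. \<Sum>x'\<in>?X. \<Sum>y\<in>?X. \<Sum>y'\<in>?X. of_bool (x = x') + of_bool (y = y'))"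
      by (simp add: sum.cartesian_product)
    also have "\<dots> = (\<Sum>x\<in>?X. \<Sum>x'\<in>?X. real n ^ 2 * of_bool (x = x') + real n)"
    proof (intro sum.cong refl)
      fix x x' :: nat
      have "(\<Sum>y\<in>?X. \<Sum>y'\<in>?X. of_bool (y = y')) = real n" by (simp add: of_bool_def)
      then show "(\<Sum>y\<in>?X. \<Sum>y'\<in>?X. of_bool (x = x') + of_bool (y = y')) = real n ^ 2 * of_bool (x = x') + real n"
        by (simp only: sum.distrib) (simp add: power2_eq_square)
    qed
    also have "\<dots> = (\<Sum>x\<in>?X. real n ^ 2 * (\<Sum>x'\<in>?X. of_bool (x = x')) + real n ^ 2)"
      by (simp only: sum.distrib sum_distrib_left[symmetric]) (simp add: power2_eq_square)
    also have "\<dots> = (\<Sum>x\<in>?X. 2 * real n ^ 2)" by (simp add: of_bool_def)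
    also have "\<dots> = 2 * real n ^ 3" by (simp add: power3_eq_cube power2_eq_square)
    finally show ?thesis .
  qed
  \<comment> \<open>4-cycle sums are sums of squares, so a bound on their total \<open>Z\<close>
    bounds every pair of colors with the same \<open>H\<close>. An \<open>H\<close> of positive
    weight is wanted besides, since then every edge has a color of positive probability.\<close>
  define Z where "Z H = (\<Sum>(a, b)\<in>UNIV. c4_sum ?X (u a b H))" for H
  let ?c = "real CARD('b) * real CARD('c) * (2 * real n ^ 3)"
  have "(\<Sum>H\<in>?\<Omega>. W H * Z H) = (\<Sum>(a, b)\<in>UNIV. \<Sum>H\<in>?\<Omega>. W H * c4_sum ?X (u a b H))"
    unfolding Z_def sum_distrib_left case_prod_unfold by (rule sum.swap)
  also have "\<dots> \<le> (\<Sum>(a, b)\<in>(UNIV :: ('b \<times> 'c) set). 2 * real n ^ 3)"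
    using E by (intro sum_mono) auto
  also have "\<dots> = ?c" by (simp add: case_prod_unfold)
  finally have EZ: "(\<Sum>H\<in>?\<Omega>. W H * Z H) \<le> ?c" .
  have "\<exists>H\<in>?\<Omega>. W H > 0 \<and> Z H \<le> ?c"
  proof (rule ccontr)
    assume "\<not> ?thesis"
    then have n: "W H > 0 \<Longrightarrow> Z H > ?c" if "H \<in> ?\<Omega>" for H using that by (auto simp: not_le)
    have "\<exists>H\<in>?\<Omega>. W H \<noteq> 0"
    proof (rule ccontr)
      assume "\<not> ?thesis"
      then have "sum W ?\<Omega> = 0" by (intro sum.neutral) auto
      then show False using W1 by simp
    qed
    then obtain H0 where H0: "H0 \<in> ?\<Omega>" "W H0 > 0" using W0 by (metis less_eq_real_def)
    have "(\<Sum>H\<in>?\<Omega>. W H * ?c) < (\<Sum>H\<in>?\<Omega>. W H * Z H)"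
    proof (rule sum_strict_mono_ex1)
      show "\<forall>H\<in>?\<Omega>. W H * ?c \<le> W H * Z H"
      proof
        fix H assume "H \<in> ?\<Omega>"
        then show "W H * ?c \<le> W H * Z H" using n[of H] W0[of H]
          by (cases "W H = 0") (auto intro!: mult_left_mono simp: less_eq_real_def)
      qed
      show "\<exists>H\<in>?\<Omega>. W H * ?c < W H * Z H" using H0 n by (intro bexI[of _ H0] mult_strict_left_mono) auto
    qed simp
    then show False using EZ W1 by (simp add: sum_distrib_right[symmetric])
  qed
  then obtain H where H: "H \<in> ?\<Omega>" "W H > 0" "Z H \<le> ?c" by blast
  show ?thesis
  proof (rule that[OF H(1)])
    fix e assume e: "e \<in> edges n"
    have "p e (H e) \<noteq> 0"
    proof
      assume "p e (H e) = 0"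
      then have "W H = 0" unfolding W_def using e by (intro prod_zero) auto
      then show False using H(2) by simp
    qed
    then show "p e (H e) > 0" using p(1)[OF e, of "H e"] by simp
  next
    fix a b
    have "c4_sum ?X (u a b H) \<le> Z H"
      unfolding Z_def using member_le_sum[of "(a, b)" UNIV "\<lambda>(a, b). c4_sum ?X (u a b H)"]
      by (auto simp: c4_sum_eq_codegree_squares sum_nonneg)
    moreover have "u a b H = (\<lambda>x y. of_bool (x < y \<and> G {x, y} = a) * (of_bool (H {x, y} = b) - p {x, y} b))"
      by (auto simp: u_def v_def fun_eq_iff of_bool_def)
    ultimately show "c4_sum {1..n} (\<lambda>x y. of_bool (x < y \<and> G {x, y} = a) * (of_bool (H {x, y} = b) - p {x, y} b)) \<le> ?c"
      using H(3) by simp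
  qed
qed

text \<open>A single step function \<open>B\<close>, recoloring probability \<open>p\<close> times
  density \<open>D\<close>, approximates both the pair \<open>(t, F)\<close> on the sample and the
  pair \<open>(G, H)\<close> on the whole graph. On either side \<open>\<gamma>\<close> accounts for
  the recoloring and the term with \<open>\<zeta>\<close> for the graph being recolored; the rest is
  the difference in the frequencies of types. \<open>H\<close> is fixed before \<open>q\<close> and
  \<open>h\<close>, since distance and acceptance must be controlled for one and the same
  recoloring.\<close>

lemma recoloring_lift:
  fixes G t F :: "nat set \<Rightarrow> 'c::finite" and \<kappa> :: "'c \<Rightarrow> 'k" and k M :: nat and \<pi> \<pi>' :: "nat \<Rightarrow> nat"
  assumes nm: "n > 0" "m > 0"
    and \<gamma>: "\<gamma> > 0" "real M * \<gamma>\<^sup>2 > real (CARD('c) ^ 2)" "2 * real (CARD('c) ^ 2) / n \<le> \<gamma> ^ 4"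
    and D: "\<And>a i j. 0 \<le> D a i j \<and> D a i j \<le> (1::real)"
    and GV: "\<And>a. cut_le {1..n} \<zeta> (\<lambda>x y. color_kernel G a x y - D a (\<pi> x) (\<pi> y))" "\<And>x. x \<in> {1..n} \<Longrightarrow> \<pi> x < k"
    and tS: "\<And>a. cut_le {1..m} \<zeta> (\<lambda>x y. color_kernel t a x y - D a (\<pi>' x) (\<pi>' y))" "\<And>x. x \<in> {1..m} \<Longrightarrow> \<pi>' x < k"
    and close: "\<And>l. l < k \<Longrightarrow> \<bar>real (card {x \<in> {1..m}. \<pi>' x = l}) / m - real (card {x \<in> {1..n}. \<pi> x = l}) / n\<bar> \<le> \<xi>"
    and F: "\<And>e. e \<in> edges m \<Longrightarrow> \<kappa> (F e) = \<kappa> (t e)"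
  obtains H where "H \<in> ordered_graphs n" "\<And>e. e \<in> edges n \<Longrightarrow> \<kappa> (H e) = \<kappa> (G e)"
    "\<And>q h. (\<And>z. 0 \<le> h z \<and> h z \<le> 1) \<Longrightarrow>
       \<bar>stat q {1..n} h (\<lambda>e. (G e, H e)) - stat q {1..m} h (\<lambda>e. (t e, F e))\<bar>
         \<le> real (card (ordered_graphs q :: ('c \<times> 'c) ograph set)) *
           (2 * (real (card (edges q)) * (\<gamma> + real (4 ^ M) ^ 2 * \<zeta>)) + q * (2 * real (4 ^ M) * k * (\<xi> + 1 / n)))"
proof -
  let ?V = "{1..n}" and ?S = "{1..m}" and ?K = "4 ^ M :: nat"
  define u where "u = (\<lambda>c. color_kernel (\<lambda>e. (t e, F e)) (c :: 'c \<times> 'c))"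
  define w where "w = (\<lambda>c :: 'c \<times> 'c. color_kernel t (fst c))"
  have uw: "0 \<le> u c x y \<and> u c x y \<le> w c x y \<and> w c x y \<le> 1" for c x y
    by (auto simp: u_def w_def color_kernel_def)
  have "real (card (UNIV :: ('c \<times> 'c) set)) < real M * \<gamma>\<^sup>2" using \<gamma> by (simp add: power2_eq_square)
  then obtain \<rho> where \<rho>: "\<And>x. \<rho> x < ?K"
    and reg: "\<And>c. cut_le ?S \<gamma> (\<lambda>x y. u c x y - cell_density ?S \<rho> (u c) (w c) (\<rho> x) (\<rho> y) * w c x y)"
    using relative_weak_regularity[of ?S "UNIV :: ('c \<times> 'c) set" \<gamma> M u w] \<gamma>(1) uw by auto
  define p0 where "p0 c i j = cell_density ?S \<rho> (u c) (w c) i j" for c i j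
  define cell where "cell i j = {z \<in> ?S \<times> ?S. (\<rho> (fst z), \<rho> (snd z)) = (i, j)}" for i j
  define U where "U c i j = (\<Sum>z\<in>cell i j. u c (fst z) (snd z))" for c i j
  define W where "W a i j = (\<Sum>z\<in>cell i j. color_kernel t a (fst z) (snd z))" for a i j
  have p0: "p0 c i j = U c i j / W (fst c) i j" for c i j
    by (simp add: p0_def cell_density_def cell_ratio_def U_def W_def w_def cell_def case_prod_unfold)
  have p0_bounds: "0 \<le> p0 c i j" "p0 c i j \<le> 1" for c i j
    unfolding p0_def cell_density_def by (rule cell_ratio_bounds; use uw in \<open>simp add: case_prod_unfold\<close>)+
  have fin_cell: "finite (cell i j)" for i j unfolding cell_def by (rule finite_subset[of _ "?S \<times> ?S"]) auto
  have sumU: "(\<Sum>b\<in>UNIV. U (a, b) i j) = W a i j" for a i j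
  proof -
    have "(\<Sum>b\<in>UNIV. u (a, b) x y) = color_kernel t a x y" for x y
      by (auto simp: u_def color_kernel_def of_bool_def)
    then show ?thesis unfolding U_def W_def by (subst sum.swap) simp
  qed
  \<comment> \<open>If the sample has no edge of color \<open>fst c\<close> in a cell, all the
    \<open>p0\<close> are 0 there. Keeping the color instead makes the probabilities sum to 1 and
    respects \<open>\<kappa>\<close>.\<close>
  define p where "p c i j = (if W (fst c) i j = 0 then of_bool (fst c = snd c) else p0 c i j)" for c i j
  have p_bounds: "0 \<le> p c i j \<and> p c i j \<le> 1" for c i j using p0_bounds by (auto simp: p_def)
  have p_sum: "(\<Sum>b\<in>UNIV. p (a, b) i j) = 1" for a i j
  proof (cases "W a i j = 0")
    case True
    then show ?thesis by (simp add: p_def of_bool_def)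
  next
    case False
    then show ?thesis using sumU by (simp add: p_def p0 sum_divide_distrib[symmetric])
  qed
  \<comment> \<open>Positive probability means that \<open>b = a\<close> or that \<open>F\<close>
    gives \<open>b\<close> to some sample edge of color \<open>a\<close> in the cell, to which the
    hypothesis on \<open>F\<close> applies.\<close>
  have p_supp: "\<kappa> b = \<kappa> a" if "p (a, b) i j > 0" for a b i j
  proof (cases "W a i j = 0")
    case True
    then show ?thesis using that by (auto simp: p_def split: if_splits)
  next
    case False
    then have "U (a, b) i j \<noteq> 0" using that by (auto simp: p_def p0)
    then obtain z where z: "z \<in> cell i j" "u (a, b) (fst z) (snd z) \<noteq> 0"
      unfolding U_def by (meson sum.neutral)
    then have "{fst z, snd z} \<in> edges m" "t {fst z, snd z} = a" "F {fst z, snd z} = b"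
      by (auto simp: u_def color_kernel_def cell_def)
    then show ?thesis using F by auto
  qed
  \<comment> \<open>The two versions differ only on cells where \<open>w c\<close> vanishes, so the
    regularity of \<open>F\<close> carries over from \<open>p0\<close> to \<open>p\<close>.\<close>
  have pw: "p0 c (\<rho> x) (\<rho> y) * w c x y = p c (\<rho> x) (\<rho> y) * w c x y" if "x \<in> ?S" "y \<in> ?S" for c x y
  proof (cases "W (fst c) (\<rho> x) (\<rho> y) = 0")
    case True
    have "(x, y) \<in> cell (\<rho> x) (\<rho> y)" using that by (simp add: cell_def)
    moreover have "\<forall>z\<in>cell (\<rho> x) (\<rho> y). color_kernel t (fst c) (fst z) (snd z) = 0"
      using True fin_cell unfolding W_def by (subst (asm) sum_nonneg_eq_0_iff) (auto simp: color_kernel_def)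
    ultimately show ?thesis by (force simp: w_def)
  next
    case False
    then show ?thesis by (simp add: p_def)
  qed
  have cardV: "card ?V = n" and cardS: "card ?S = m" by auto
  obtain \<rho>' where \<rho>': "\<And>x. x \<in> ?V \<Longrightarrow> \<rho>' x < ?K"
    and fd: "fiber_dist ({..<?K} \<times> {..<k}) ?V (\<lambda>x. (\<rho>' x, \<pi> x)) ?S (\<lambda>x. (\<rho> x, \<pi>' x)) \<le> 2 * ?K * k * (\<xi> + 1 / n)"
    using transfer_partition[of ?V ?S \<pi> k \<pi>' \<rho> ?K \<xi>] nm GV(2) tS(2) \<rho> close by auto
  \<comment> \<open>Cells are ordered pairs of parts, the first one belonging to the smaller
    endpoint.\<close>
  define pe where "pe e b = p (G e, b) (\<rho>' (Min e)) (\<rho>' (Max e))" for e b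
  obtain H where H: "H \<in> ordered_graphs n" "\<And>e. e \<in> edges n \<Longrightarrow> pe e (H e) > 0"
    and c4: "\<And>a b. c4_sum ?V (\<lambda>x y. of_bool (x < y \<and> G {x, y} = a) * (of_bool (H {x, y} = b) - pe {x, y} b))
       \<le> real CARD('c) * real CARD('c) * (2 * real n ^ 3)"
    using random_recoloring[of n pe G] p_bounds p_sum by (auto simp: pe_def)
  define B where "B c s s' = p c (fst s) (fst s') * D (fst c) (snd s) (snd s')" for c and s s' :: "nat \<times> nat"
  have B: "0 \<le> B c s s' \<and> B c s s' \<le> 1" for c s s'
    using p_bounds[of c "fst s" "fst s'"] D[of "fst c" "snd s" "snd s'"] by (auto simp: B_def intro!: mult_le_one)
  let ?g = "\<gamma> + real ?K ^ 2 * \<zeta>"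
  have cutS: "cut_le ?S ?g (\<lambda>x y. color_kernel (\<lambda>e. (t e, F e)) c x y - B c (\<rho> x, \<pi>' x) (\<rho> y, \<pi>' y))" for c
  proof -
    have "cut_le ?S \<gamma> (\<lambda>x y. u c x y - p c (\<rho> x) (\<rho> y) * w c x y)"
      using reg[of c] pw by (subst (asm) cut_le_cong[where v="\<lambda>x y. u c x y - p c (\<rho> x) (\<rho> y) * w c x y"]) (auto simp: p0_def)
    moreover have "cut_le ?S (real ?K ^ 2 * \<zeta>) (\<lambda>x y. p c (\<rho> x) (\<rho> y) * (color_kernel t (fst c) x y - D (fst c) (\<pi>' x) (\<pi>' y)))"
      using tS(1) \<rho> p_bounds by (intro cut_le_step_mult) auto
    ultimately have "cut_le ?S ?g (\<lambda>x y. u c x y - p c (\<rho> x) (\<rho> y) * w c x y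
        + p c (\<rho> x) (\<rho> y) * (color_kernel t (fst c) x y - D (fst c) (\<pi>' x) (\<pi>' y)))"
      by (rule cut_le_add)
    then show ?thesis by (simp add: u_def w_def B_def algebra_simps)
  qed
  have cutV: "cut_le ?V ?g (\<lambda>x y. color_kernel (\<lambda>e. (G e, H e)) c x y - B c (\<rho>' x, \<pi> x) (\<rho>' y, \<pi> y))" for c
  proof -
    obtain a b where c: "c = (a, b)" by (cases c)
    \<comment> \<open>The random choice leaves a 4-cycle sum of order \<open>n ^ 3\<close>, which
      for large \<open>n\<close> is negligible against \<open>n ^ 4\<close>.\<close>
    have "real CARD('c) * real CARD('c) * (2 * real n ^ 3) = 2 * real (CARD('c) ^ 2) / n * real n ^ 4"
      using nm by (simp add: power2_eq_square eval_nat_numeral)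
    also have "\<dots> \<le> \<gamma> ^ 4 * real n ^ 4" using \<gamma>(3) by (intro mult_right_mono) auto
    finally have "cut_le ?V \<gamma> (\<lambda>x y. of_bool (x < y \<and> G {x, y} = a) * (of_bool (H {x, y} = b) - pe {x, y} b))"
      using \<gamma>(1) c4[of a b] by (intro cut_le_of_c4) auto
    moreover have "of_bool (x < y \<and> G {x, y} = a) * (of_bool (H {x, y} = b) - pe {x, y} b)
        = color_kernel (\<lambda>e. (G e, H e)) c x y - p c (\<rho>' x) (\<rho>' y) * color_kernel G a x y" for x y
      by (auto simp: color_kernel_def c pe_def min_def max_def)
    ultimately have 1: "cut_le ?V \<gamma> (\<lambda>x y. color_kernel (\<lambda>e. (G e, H e)) c x y - p c (\<rho>' x) (\<rho>' y) * color_kernel G a x y)"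
      by simp
    have "cut_le ?V (real ?K ^ 2 * \<zeta>) (\<lambda>x y. p c (\<rho>' x) (\<rho>' y) * (color_kernel G a x y - D a (\<pi> x) (\<pi> y)))"
      using GV(1) \<rho>' p_bounds by (intro cut_le_step_mult) auto
    from cut_le_add[OF 1 this] show ?thesis by (simp add: B_def c algebra_simps)
  qed
  show ?thesis
  proof (rule that[OF H(1)])
    fix e assume "e \<in> edges n"
    from H(2)[OF this] show "\<kappa> (H e) = \<kappa> (G e)" unfolding pe_def by (rule p_supp)
  next
    fix q and h :: "('c \<times> 'c) ograph \<Rightarrow> real" assume h: "\<And>z. 0 \<le> h z \<and> h z \<le> 1"
    let ?O = "real (card (ordered_graphs q :: ('c \<times> 'c) ograph set))"
    let ?\<tau> = "\<lambda>x. (\<rho>' x, \<pi> x)" and ?\<sigma> = "\<lambda>x. (\<rho> x, \<pi>' x)"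
    have a: "\<bar>stat q ?V h (\<lambda>e. (G e, H e)) - tuple_mean q ?V (\<lambda>l. kernel_density q h B (map ?\<tau> l))\<bar> \<le> ?O * (real (card (edges q)) * ?g)"
      using nm by (intro stat_near_kernel_density B cutV h) auto
    have b: "\<bar>stat q ?S h (\<lambda>e. (t e, F e)) - tuple_mean q ?S (\<lambda>l. kernel_density q h B (map ?\<sigma> l))\<bar> \<le> ?O * (real (card (edges q)) * ?g)"
      using nm by (intro stat_near_kernel_density B cutS h) auto
    have "\<bar>tuple_mean q ?V (\<lambda>l. kernel_density q h B (map ?\<tau> l)) - tuple_mean q ?S (\<lambda>l. kernel_density q h B (map ?\<sigma> l))\<bar>
        \<le> q * ?O * fiber_dist ({..<?K} \<times> {..<k}) ?V ?\<tau> ?S ?\<sigma>"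
      using nm \<rho> \<rho>' GV(2) tS(2) B h by (intro tuple_mean_pullback_diff abs_kernel_density_le) auto
    also have "\<dots> \<le> q * ?O * (2 * ?K * k * (\<xi> + 1 / n))"
      using fd by (intro mult_left_mono) auto
    finally have c: "\<bar>tuple_mean q ?V (\<lambda>l. kernel_density q h B (map ?\<tau> l)) - tuple_mean q ?S (\<lambda>l. kernel_density q h B (map ?\<sigma> l))\<bar>
        \<le> ?O * (q * (2 * real ?K * k * (\<xi> + 1 / n)))" by (simp add: mult_ac)
    have "\<bar>stat q ?V h (\<lambda>e. (G e, H e)) - stat q ?S h (\<lambda>e. (t e, F e))\<bar>
      \<le> ?O * (real (card (edges q)) * ?g) + ?O * (real (card (edges q)) * ?g) + ?O * (q * (2 * real ?K * k * (\<xi> + 1 / n)))"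
      using a b c by linarith
    also have "\<dots> = ?O * (2 * (real (card (edges q)) * ?g) + q * (2 * real ?K * k * (\<xi> + 1 / n)))"
      by (simp add: distrib_left)
    finally show "\<bar>stat q ?V h (\<lambda>e. (G e, H e)) - stat q ?S h (\<lambda>e. (t e, F e))\<bar>
      \<le> ?O * (2 * (real (card (edges q)) * ?g) + q * (2 * real ?K * k * (\<xi> + 1 / n)))" .
  qed
qed

section \<open>Passing to a sample\<close>

definition enum :: "nat set \<Rightarrow> nat \<Rightarrow> nat" where
  "enum S i = sorted_list_of_set S ! (i - 1)"

lemma enum_strict_mono: "finite S \<Longrightarrow> 1 \<le> i \<Longrightarrow> i < j \<Longrightarrow> j \<le> card S \<Longrightarrow> enum S i < enum S j"
  unfolding enum_def
  using sorted_wrt_nth_less[OF strict_sorted_list_of_set[of S], of "i - 1" "j - 1"] by simp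

lemma enum_less_iff:
  assumes "finite S" "i \<in> {1..card S}" "j \<in> {1..card S}"
  shows "enum S i < enum S j \<longleftrightarrow> i < j"
  using enum_strict_mono[of S i j] enum_strict_mono[of S j i] assms by (metis atLeastAtMost_iff linorder_neqE_nat order_less_asym order_less_irrefl)

lemma bij_betw_enum:
  assumes "finite S"
  shows "bij_betw (enum S) {1..card S} S"
proof -
  have "bij_betw (nth (sorted_list_of_set S)) {..<card S} S"
    using assms by (intro bij_betw_nth) auto
  moreover have "bij_betw (\<lambda>i. i - 1) {1..card S} {..<card S}"
    by (rule bij_betw_byWitness[where f'="\<lambda>i. i + 1"]) auto
  ultimately have "bij_betw (nth (sorted_list_of_set S) \<circ> (\<lambda>i. i - 1)) {1..card S} S"
    by (rule bij_betw_trans[rotated])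
  then show ?thesis by (simp add: comp_def enum_def[abs_def])
qed

lemma enum_in: "finite S \<Longrightarrow> i \<in> {1..card S} \<Longrightarrow> enum S i \<in> S"
  using bij_betw_enum bij_betwE by blast

lemma induced_tuple_enum:
  "induced_tuple S C = (\<lambda>e\<in>edges (card S). C (enum S ` e))"
  by (simp add: induced_tuple_def enum_def[abs_def])

lemma enum_image_edge:
  assumes S: "finite S" "S \<subseteq> {1..n}" and e: "e \<in> edges (card S)"
  shows "enum S ` e \<in> edges n"
proof -
  have "e \<subseteq> {1..card S}" using e by (simp add: edges_def)
  then have "enum S ` e \<subseteq> S" "inj_on (enum S) e"
    using enum_in[OF S(1)] bij_betw_enum[OF S(1)] by (auto simp: bij_betw_def intro: inj_on_subset)
  then show ?thesis using e S(2) by (auto simp: edges_def card_image)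
qed

lemma tuple_mean_bij:
  assumes "bij_betw s X S"
  shows "tuple_mean r S h = tuple_mean r X (\<lambda>l. h (map s l))"
proof -
  have inj: "inj_on s X" and im: "s ` X = S" using assms by (auto simp: bij_betw_def)
  have "bij_betw (map s) (tuples r X) (tuples r S)"
  proof (rule bij_betw_byWitness[where f'="map (inv_into X s)"])
    show "\<forall>l\<in>tuples r X. map (inv_into X s) (map s l) = l"
      using inj by (auto simp: tuples_def map_idI subset_iff inv_into_f_f)
    show "\<forall>l\<in>tuples r S. map s (map (inv_into X s) l) = l"
      using im by (auto simp: tuples_def map_idI subset_iff f_inv_into_f)
    show "map s ` tuples r X \<subseteq> tuples r S" using im by (force simp: tuples_def)
    show "map (inv_into X s) ` tuples r S \<subseteq> tuples r X"
      using im by (auto simp: tuples_def intro!: inv_into_into)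
  qed
  then have "(\<Sum>l\<in>tuples r S. h l) = (\<Sum>l\<in>tuples r X. h (map s l))"
    by (rule sum.reindex_bij_betw[symmetric])
  then show ?thesis using bij_betw_same_card[OF assms] by (simp add: tuple_mean_def)
qed

lemma sorted_wrt_less_map_enum:
  assumes "finite S" "set l \<subseteq> {1..card S}"
  shows "sorted_wrt (<) (map (enum S) l) \<longleftrightarrow> sorted_wrt (<) l"
  unfolding sorted_wrt_iff_nth_less using assms
  by (auto simp: enum_less_iff subset_iff)

lemma low_high_in:
  assumes "l \<in> tuples q X" "e \<in> edges q"
  shows "low l e \<in> X" "high l e \<in> X"
  using assms(2,1) by (elim edgeE; auto simp: low_def high_def tuples_def)+

lemma low_less_high:
  assumes "sorted_wrt (<) l" "length l = q" "e \<in> edges q"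
  shows "low l e < high l e"
  using assms(3,1,2) by (elim edgeE) (auto simp: low_def high_def sorted_wrt_iff_nth_less)

lemma low_high_map:
  assumes "length l = q" "e \<in> edges q"
  shows "low (map f l) e = f (low l e)" "high (map f l) e = f (high l e)"
  using assms(2,1) by (elim edgeE; auto simp: low_def high_def)+

lemma stat_induced:
  assumes S: "finite S" "card S = m"
  shows "stat q {1..m} h (induced_tuple S C) = stat q S h C"
proof -
  have "stat q S h C = tuple_mean q {1..m} (\<lambda>l. if sorted_wrt (<) (map (enum S) l) then h (pattern q C (map (enum S) l)) else 0)"
    unfolding stat_def using tuple_mean_bij[OF bij_betw_enum[OF S(1)]] S by simp
  also have "\<dots> = stat q {1..m} h (induced_tuple S C)"
    unfolding stat_def tuple_mean_def
  proof (intro arg_cong2[where f="(/)"] sum.cong refl)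
    fix l assume l: "l \<in> tuples q {1..m}"
    then have s: "sorted_wrt (<) (map (enum S) l) \<longleftrightarrow> sorted_wrt (<) l"
      using S by (intro sorted_wrt_less_map_enum) (auto simp: tuples_def)
    \<comment> \<open>Restricted to increasing tuples: with repeated vertices \<open>pattern\<close>
      would evaluate \<open>induced_tuple\<close> outside \<open>edges m\<close>, where it is
      undefined.\<close>
    have "pattern q C (map (enum S) l) = pattern q (induced_tuple S C) l" if "sorted_wrt (<) l"
    proof (rule ordered_graphs_eqI[OF pattern_in_ordered_graphs pattern_in_ordered_graphs])
      fix e assume e: "e \<in> edges q"
      have len: "length l = q" using l by (simp add: tuples_def)
      have "{low l e, high l e} \<in> edges m"
        using low_less_high[OF that len e] low_high_in[OF l e] by simp
      then show "pattern q C (map (enum S) l) e = pattern q (induced_tuple S C) l e"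
        using e len S unfolding pattern_def by (simp only: restrict_apply' image_edge low_high_map induced_tuple_enum) simp
    qed
    then show "(if sorted_wrt (<) (map (enum S) l) then h (pattern q C (map (enum S) l)) else 0)
        = (if sorted_wrt (<) l then h (pattern q (induced_tuple S C) l) else 0)"
      using s by simp
  qed
  finally show ?thesis by simp
qed

lemma stat_cong:
  assumes "\<And>e. e \<in> edges m \<Longrightarrow> C e = C' e"
  shows "stat q {1..m} h C = stat q {1..m} h C'"
  unfolding stat_def tuple_mean_def
proof (intro arg_cong2[where f="(/)"] sum.cong refl)
  fix l assume l: "l \<in> tuples q {1..m}"
  have "pattern q C l = pattern q C' l" if "sorted_wrt (<) l"
  proof (rule ordered_graphs_eqI[OF pattern_in_ordered_graphs pattern_in_ordered_graphs])
    fix e assume e: "e \<in> edges q"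
    have len: "length l = q" using l by (simp add: tuples_def)
    have "{low l e, high l e} \<in> edges m"
      using low_less_high[OF that len e] low_high_in[OF l e] by simp
    then show "pattern q C l e = pattern q C' l e"
      using e assms unfolding pattern_def by (simp only: restrict_apply' image_edge)
  qed
  then show "(if sorted_wrt (<) l then h (pattern q C l) else 0) = (if sorted_wrt (<) l then h (pattern q C' l) else 0)"
    by simp
qed

lemma stat_induced_pair:
  assumes "finite S" "card S = m"
  shows "stat q {1..m} h (\<lambda>e. (induced_tuple S G e, induced_tuple S H e)) = stat q S h (\<lambda>e. (G e, H e))"
  unfolding stat_induced[OF assms, symmetric]
  by (rule stat_cong) (simp add: induced_tuple_def assms)

text \<open>Increasing tuples correspond to \<open>q\<close>-sets. This links \<open>stat\<close>
  with canonical tests, which average over sets.\<close>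

lemma stat_eq_subset_sum:
  assumes "n > 0"
  shows "stat q {1..n} h C = (\<Sum>S\<in>subsets_of_card q {1..n}. h (induced_tuple S C)) / real n ^ q"
proof -
  have "(\<Sum>l\<in>tuples q {1..n}. if sorted_wrt (<) l then h (pattern q C l) else 0)
      = (\<Sum>l\<in>{l \<in> tuples q {1..n}. sorted_wrt (<) l}. h (pattern q C l))"
    by (simp add: sum.inter_filter)
  also have "\<dots> = (\<Sum>S\<in>subsets_of_card q {1..n}. h (induced_tuple S C))"
  proof (rule sum.reindex_bij_witness[where i=sorted_list_of_set and j=set])
    fix l assume l: "l \<in> {l \<in> tuples q {1..n}. sorted_wrt (<) l}"
    then have d: "distinct l" "sorted l" by (auto simp: strict_sorted_iff)
    then show 1: "sorted_list_of_set (set l) = l" by (simp add: sorted_list_of_set.idem_if_sorted_distinct)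
    show "set l \<in> subsets_of_card q {1..n}" using l d by (auto simp: subsets_of_card_def tuples_def distinct_card)
    have "card (set l) = q" using l d by (simp add: tuples_def distinct_card)
    then show "h (induced_tuple (set l) C) = h (pattern q C l)"
      unfolding induced_tuple_def pattern_def 1 by simp
  next
    fix S assume "S \<in> subsets_of_card q {1..n}"
    then have "finite S" "card S = q" "S \<subseteq> {1..n}" by (auto simp: subsets_of_card_def intro: finite_subset)
    then show "set (sorted_list_of_set S) = S" "sorted_list_of_set S \<in> {l \<in> tuples q {1..n}. sorted_wrt (<) l}"
      by (auto simp: tuples_def strict_sorted_list_of_set)
  qed
  finally show ?thesis by (simp add: stat_def tuple_mean_def)
qed

lemma c4_sum_tuple_mean:
  assumes "finite X" "X \<noteq> {}"
  shows "c4_sum X u = tuple_mean 4 X (\<lambda>l. u (l ! 0) (l ! 2) * u (l ! 1) (l ! 2) * u (l ! 0) (l ! 3) * u (l ! 1) (l ! 3)) * real (card X) ^ 4"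
  using assms by (simp add: c4_sum_def tuple_mean_def eval_nat_numeral sum_tuples_Suc card_gt_0_iff)

lemma c4_sum_bij:
  assumes "bij_betw s X S"
  shows "c4_sum S u = c4_sum X (\<lambda>x y. u (s x) (s y))"
  unfolding c4_sum_def by (simp only: sum.reindex_bij_betw[OF assms, symmetric])

lemma c4_sum_cong:
  "(\<And>x y. x \<in> X \<Longrightarrow> y \<in> X \<Longrightarrow> u x y = v x y) \<Longrightarrow> c4_sum X u = c4_sum X v"
  unfolding c4_sum_def by (intro sum.cong refl) simp

lemma color_kernel_induced:
  assumes "finite S" "card S = m" "x \<in> {1..m}" "y \<in> {1..m}"
  shows "color_kernel (induced_tuple S G) a x y = color_kernel G a (enum S x) (enum S y)"
  using assms enum_less_iff[of S x y] by (auto simp: color_kernel_def induced_tuple_enum)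

lemma tuple_mean_1:
  assumes "finite X"
  shows "tuple_mean 1 X (\<lambda>l. of_bool (P (l ! 0))) = real (card {x \<in> X. P x}) / real (card X)"
  using assms by (simp add: tuple_mean_def sum_tuples_Suc of_bool_def sum.If_cases Int_def)

lemma card_filter_bij:
  assumes "bij_betw s X S"
  shows "card {x \<in> X. P (s x)} = card {y \<in> S. P y}"
proof (rule bij_betw_same_card[of s])
  show "bij_betw s {x \<in> X. P (s x)} {y \<in> S. P y}"
    using assms by (auto simp: bij_betw_def inj_on_def)
qed

text \<open>\<open>F\<close> is quantified inside, so this is an event about \<open>G\<close> and
  \<open>S\<close> that copes with all recolorings of the sample simultaneously. The arity 2 is for
  the Hamming distance, \<open>q\<close> for the acceptance probability of the given test.\<close>

definition liftable_sample ::
  "('c::finite \<Rightarrow> 'k) \<Rightarrow> nat \<Rightarrow> real \<Rightarrow> nat \<Rightarrow> (nat set \<Rightarrow> 'c) \<Rightarrow> nat set \<Rightarrow> bool" where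
  "liftable_sample \<kappa> q \<epsilon> n G S \<longleftrightarrow>
     (\<forall>F. (\<forall>e\<in>edges (card S). \<kappa> (F e) = \<kappa> (induced_tuple S G e)) \<longrightarrow>
        (\<exists>H\<in>ordered_graphs n. (\<forall>e\<in>edges n. \<kappa> (H e) = \<kappa> (G e)) \<and>
           (\<forall>r\<in>{2, q}. \<forall>h. (\<forall>z. 0 \<le> h z \<and> h z \<le> 1) \<longrightarrow>
              \<bar>stat r {1..n} h (\<lambda>e. (G e, H e))
               - stat r {1..card S} h (\<lambda>e. (induced_tuple S G e, F e))\<bar> \<le> \<epsilon>)))"

text \<open>A sample that reproduces the 4-cycle sum of each color and the frequency of each part
  satisfies the hypotheses of \<open>recoloring_lift\<close> for every \<open>F\<close>. The
  threshold \<open>m0\<close> precedes \<open>n\<close> and \<open>G\<close> because neither number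
  of parts depends on them.\<close>

lemma sampled_recoloring_lift:
  fixes \<kappa> :: "'c::finite \<Rightarrow> 'k" and q :: nat
  assumes e0: "e0 > 0"
  shows "\<exists>m0. \<forall>m n G. m0 \<le> m \<longrightarrow> m \<le> n \<longrightarrow>
     2 / 3 * real (n choose m) \<le> real (card {S \<in> subsets_of_card m {1..n}. liftable_sample \<kappa> q e0 n G S})"
proof -
  let ?C = "real CARD('c)"
  define O' where "O' r = real (card (ordered_graphs r :: ('c \<times> 'c) ograph set))" for r
  \<comment> \<open>The bound of \<open>recoloring_lift\<close> is at most
    \<open>cst r * \<beta>\<close> once the cut error and the type error there are each at most
    \<open>\<beta>\<close>.\<close>
  define cst where "cst r = O' r * (2 * real (card (edges r)) + r)" for r
  define \<beta> where "\<beta> = e0 / (cst 2 + cst q + 1)"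
  have cst: "cst r \<ge> 0" for r by (simp add: cst_def O'_def)
  have \<beta>: "\<beta> > 0" using e0 cst[of 2] cst[of q] by (simp add: \<beta>_def)
  have cst_\<beta>: "cst r * \<beta> \<le> e0" if "r \<in> {2, q}" for r
  proof -
    have "cst r * \<beta> \<le> (cst 2 + cst q + 1) * \<beta>"
      using that cst[of 2] cst[of q] \<beta> by (intro mult_right_mono) auto
    also have "\<dots> = e0" using cst[of 2] cst[of q] by (simp add: \<beta>_def)
    finally show ?thesis .
  qed
  define \<gamma> where "\<gamma> = \<beta> / 2"
  have \<gamma>: "\<gamma> > 0" using \<beta> by (simp add: \<gamma>_def)
  obtain M where M: "real M * \<gamma>\<^sup>2 > real (CARD('c) ^ 2)" using \<gamma> ex_less_of_nat_mult[of "\<gamma>\<^sup>2"] by auto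
  define K where "K = (4::nat) ^ M"
  have K: "K > 0" by (simp add: K_def)
  \<comment> \<open>After the loss of \<open>K\<^sup>2\<close> in \<open>cut_le_step_mult\<close>
    this contributes half of \<open>\<beta>\<close>; \<open>\<gamma>\<close> is the other
    half.\<close>
  define \<zeta> where "\<zeta> = \<beta> / (2 * real K ^ 2)"
  have \<zeta>: "\<zeta> > 0" using \<beta> K by (simp add: \<zeta>_def)
  have \<gamma>\<zeta>: "\<gamma> + real K ^ 2 * \<zeta> = \<beta>" using K by (simp add: \<gamma>_def \<zeta>_def)
  \<comment> \<open>Cut error \<open>\<zeta>0\<close> on \<open>G\<close> gives a mean 4-cycle value
    of at most \<open>4 * \<zeta>0 \<le> \<zeta> ^ 4 / 2\<close>. Sampling adds at most
    \<open>\<xi>\<close>, again at most \<open>\<zeta> ^ 4 / 2\<close>, and the total is what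
    \<open>cut_le_of_c4\<close> needs for cut error \<open>\<zeta>\<close> on the sample.\<close>
  define \<zeta>0 where "\<zeta>0 = min \<zeta> (\<zeta> ^ 4 / 8)"
  have \<zeta>0: "\<zeta>0 > 0" "\<zeta>0 \<le> \<zeta>" "4 * \<zeta>0 \<le> \<zeta> ^ 4 / 2" using \<zeta> by (auto simp: \<zeta>0_def)
  obtain M' where M': "real M' * \<zeta>0\<^sup>2 > ?C" using \<zeta>0 ex_less_of_nat_mult[of "\<zeta>0\<^sup>2"] by auto
  define k where "k = (4::nat) ^ M'"
  have k: "k > 0" by (simp add: k_def)
  \<comment> \<open>The second bound is for the frequencies of types: multiplied by
    \<open>2 * K * k\<close>, each of \<open>\<xi>\<close> and \<open>1 / n\<close> takes at most
    half of \<open>\<beta>\<close>.\<close>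
  define \<xi> where "\<xi> = min (\<zeta> ^ 4 / 2) (\<beta> / (4 * K * k))"
  have \<xi>: "\<xi> > 0" "\<xi> \<le> \<zeta> ^ 4 / 2" "\<xi> \<le> \<beta> / (4 * K * k)" using \<zeta> \<beta> K k by (auto simp: \<xi>_def)
  \<comment> \<open>The first summand is the demand of \<open>sampling_lemma\<close> for
    \<open>?C + k\<close> statistics of at most 4 vertices, and 8 is twice 4. The last two make
    \<open>n\<close> large, by \<open>m \<le> n\<close>.\<close>
  define m0 where "m0 = nat \<lceil>72 * 4 ^ 2 * (?C + k) / \<xi>\<^sup>2\<rceil> + 8 + nat \<lceil>4 * K * k / \<beta>\<rceil> + nat \<lceil>2 * real (CARD('c) ^ 2) / \<gamma> ^ 4\<rceil>"
  show ?thesis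
  proof (intro exI[of _ m0] allI impI)
    fix m n and G :: "nat set \<Rightarrow> 'c"
    assume m: "m0 \<le> m" "m \<le> n"
    have m1: "real m \<ge> 72 * 4 ^ 2 * (?C + k) / \<xi>\<^sup>2" "m \<ge> 8" and m2: "real n \<ge> 4 * K * k / \<beta>" "real n \<ge> 2 * real (CARD('c) ^ 2) / \<gamma> ^ 4"
      using m unfolding m0_def by linarith+
    have n: "n > 0" "m > 0" using m m1 by auto
    have n1: "2 * real (CARD('c) ^ 2) / n \<le> \<gamma> ^ 4"
      using m2(2) n \<gamma> by (simp add: divide_le_eq mult.commute)
    have n2: "2 * real K * k * (\<xi> + 1 / n) \<le> \<beta>"
    proof -
      have "1 / n \<le> \<beta> / (4 * K * k)" using m2(1) n \<beta> K k by (simp add: divide_le_eq le_divide_eq mult.commute)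
      then have "2 * real K * k * (\<xi> + 1 / n) \<le> 2 * real K * k * (\<beta> / (4 * K * k) + \<beta> / (4 * K * k))"
        using \<xi>(3) by (intro mult_left_mono add_mono) auto
      also have "\<dots> = \<beta>" using K k by (simp add: field_simps)
      finally show ?thesis .
    qed
    let ?V = "{1..n}"
    obtain \<pi> :: "nat \<Rightarrow> nat" where \<pi>: "\<And>x. \<pi> x < k"
      and reg: "\<And>a. cut_le ?V \<zeta>0 (\<lambda>x y. color_kernel G a x y - cell_density ?V \<pi> (color_kernel G a) (\<lambda>_ _. 1) (\<pi> x) (\<pi> y))"
      using relative_weak_regularity[of ?V "UNIV :: 'c set" \<zeta>0 M' "color_kernel G" "\<lambda>_ _ _. 1"] \<zeta>0 M'
      unfolding k_def by (auto simp: color_kernel_def)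
    define D where "D a i j = cell_density ?V \<pi> (color_kernel G a) (\<lambda>_ _. 1) i j" for a i j
    have D: "0 \<le> D a i j \<and> D a i j \<le> 1" for a i j
      unfolding D_def cell_density_def
      by (intro conjI; rule cell_ratio_bounds) (auto simp: color_kernel_def)
    define u where "u a x y = color_kernel G a x y - D a (\<pi> x) (\<pi> y)" for a x y
    have u1: "\<bar>u a x y\<bar> \<le> 1" for a x y
      using D[of a "\<pi> x" "\<pi> y"] by (auto simp: u_def color_kernel_def)
    have cutV: "cut_le ?V \<zeta>0 (u a)" for a using reg by (simp add: u_def[abs_def] D_def)
    \<comment> \<open>Left injections carry the 4-cycle term of a color, right injections the
      indicator of a part; \<open>r\<close> gives the arities 4 and 1.\<close>
    define h where "h = case_sum (\<lambda>a l. u a (l ! 0) (l ! 2) * u a (l ! 1) (l ! 2) * u a (l ! 0) (l ! 3) * u a (l ! 1) (l ! 3))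
      (\<lambda>i l. of_bool (\<pi> (l ! 0) = i))"
    define r where "r = case_sum (\<lambda>_ :: 'c. 4 :: nat) (\<lambda>_ :: nat. 1)"
    let ?I = "(UNIV :: 'c set) <+> {..<k}"
    let ?good = "\<lambda>S. \<forall>i\<in>?I. \<bar>tuple_mean (r i) S (h i) - tuple_mean (r i) ?V (h i)\<bar> \<le> \<xi>"
    have "\<bar>h i l\<bar> \<le> 1" for i l
    proof (cases i)
      case (Inl a)
      then show ?thesis unfolding h_def sum.case abs_mult
        by (simp only: sum.case abs_mult) (intro mult_le_one mult_nonneg_nonneg u1 abs_ge_zero)
    qed (simp add: h_def)
    moreover have "r i \<le> 4" for i by (cases i) (simp_all add: r_def)
    ultimately have "2 / 3 * real (n choose m) \<le> real (card {S \<in> subsets_of_card m ?V. ?good S})"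
      using sampling_lemma[of ?V m ?I "?C + k" r 4 h \<xi>] m m1 n \<xi>(1)
      by (simp add: card_Plus)
    also have "\<dots> \<le> real (card {S \<in> subsets_of_card m {1..n}. liftable_sample \<kappa> q e0 n G S})"
    proof (intro of_nat_mono card_mono Collect_mono impI conjI)
      fix S assume S: "S \<in> subsets_of_card m ?V \<and> ?good S"
      then show "S \<in> subsets_of_card m {1..n}" by blast
      show "liftable_sample \<kappa> q e0 n G S"
        unfolding liftable_sample_def
      proof (intro allI impI)
        fix F :: "nat set \<Rightarrow> 'c"
        have fS: "finite S" "card S = m" "S \<noteq> {}"
          using S n by (auto simp: subsets_of_card_def intro: finite_subset)
        have bij: "bij_betw (enum S) {1..m} S" using bij_betw_enum[OF fS(1)] fS by simp
        assume "\<forall>e\<in>edges (card S). \<kappa> (F e) = \<kappa> (induced_tuple S G e)"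
        then have F: "\<forall>e\<in>edges m. \<kappa> (F e) = \<kappa> (induced_tuple S G e)" using fS by simp
        have cutS: "cut_le {1..m} \<zeta> (\<lambda>x y. color_kernel (induced_tuple S G) a x y - D a (\<pi> (enum S x)) (\<pi> (enum S y)))" for a
        proof (rule cut_le_of_c4)
          have "c4_sum ?V (u a) \<le> 4 * \<zeta>0 * real n ^ 4"
            using c4_le_of_cut[OF _ cutV u1] by simp
          then have cv: "tuple_mean 4 ?V (h (Inl a)) \<le> \<zeta> ^ 4 / 2"
            using \<zeta>0(3) n by (simp add: c4_sum_tuple_mean h_def)
          have "\<bar>tuple_mean (r (Inl a)) S (h (Inl a)) - tuple_mean (r (Inl a)) ?V (h (Inl a))\<bar> \<le> \<xi>"
            using S by blast
          then have cs: "tuple_mean 4 S (h (Inl a)) \<le> \<zeta> ^ 4"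
            using cv \<xi>(2) by (simp add: r_def)
          have "c4_sum {1..m} (\<lambda>x y. color_kernel (induced_tuple S G) a x y - D a (\<pi> (enum S x)) (\<pi> (enum S y))) = c4_sum S (u a)"
            unfolding c4_sum_bij[OF bij] by (rule c4_sum_cong) (simp add: u_def color_kernel_induced[OF fS(1,2)])
          also have "\<dots> = tuple_mean 4 S (h (Inl a)) * real m ^ 4"
            using fS by (simp add: c4_sum_tuple_mean h_def)
          also have "\<dots> \<le> \<zeta> ^ 4 * real m ^ 4" using cs by (intro mult_right_mono) auto
          finally show "c4_sum {1..m} (\<lambda>x y. color_kernel (induced_tuple S G) a x y - D a (\<pi> (enum S x)) (\<pi> (enum S y)))
            \<le> \<zeta> ^ 4 * real (card {1..m}) ^ 4" by simp
        qed (use \<zeta> in auto)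
        have close: "\<bar>real (card {x \<in> {1..m}. \<pi> (enum S x) = l}) / m - real (card {x \<in> ?V. \<pi> x = l}) / n\<bar> \<le> \<xi>"
          if "l < k" for l
        proof -
          have "\<bar>tuple_mean (r (Inr l)) S (h (Inr l)) - tuple_mean (r (Inr l)) ?V (h (Inr l))\<bar> \<le> \<xi>"
            using S that by blast
          then show ?thesis
            using tuple_mean_1[OF fS(1), of "\<lambda>x. \<pi> x = l"] tuple_mean_1[of ?V "\<lambda>x. \<pi> x = l"] fS(2)
              card_filter_bij[OF bij, of "\<lambda>x. \<pi> x = l"]
            by (simp add: r_def h_def)
        qed
        have cutV': "cut_le ?V \<zeta> (\<lambda>x y. color_kernel G a x y - D a (\<pi> x) (\<pi> y))" for a
          using cut_le_mono[OF cutV \<zeta>0(2)] by (simp add: u_def[abs_def])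
        obtain H where H: "H \<in> ordered_graphs n" "\<And>e. e \<in> edges n \<Longrightarrow> \<kappa> (H e) = \<kappa> (G e)"
          and st: "\<And>q h. (\<And>z. 0 \<le> h z \<and> h z \<le> 1) \<Longrightarrow>
            \<bar>stat q ?V h (\<lambda>e. (G e, H e)) - stat q {1..m} h (\<lambda>e. (induced_tuple S G e, F e))\<bar>
             \<le> O' q * (2 * (real (card (edges q)) * (\<gamma> + real K ^ 2 * \<zeta>)) + q * (2 * real K * k * (\<xi> + 1 / n)))"
          unfolding O'_def K_def
          using recoloring_lift[of n m \<gamma> M D \<zeta> G \<pi> k "induced_tuple S G" "\<lambda>x. \<pi> (enum S x)" \<xi> \<kappa> F]
            n \<gamma> M n1 D cutV' \<pi> cutS close F by blast
        have "\<bar>stat r ?V h (\<lambda>e. (G e, H e)) - stat r {1..m} h (\<lambda>e. (induced_tuple S G e, F e))\<bar> \<le> e0"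
          if r: "r \<in> {2, q}" and h: "\<forall>z. 0 \<le> h z \<and> h z \<le> 1" for r h
        proof -
          have "\<bar>stat r ?V h (\<lambda>e. (G e, H e)) - stat r {1..m} h (\<lambda>e. (induced_tuple S G e, F e))\<bar>
            \<le> O' r * (2 * (real (card (edges r)) * (\<gamma> + real K ^ 2 * \<zeta>)) + r * (2 * real K * k * (\<xi> + 1 / n)))"
            using h by (intro st) auto
          also have "\<dots> \<le> O' r * (2 * (real (card (edges r)) * \<beta>) + r * \<beta>)"
            unfolding \<gamma>\<zeta> using n2 by (intro mult_left_mono add_left_mono) (auto simp: O'_def)
          also have "\<dots> = cst r * \<beta>" by (simp add: cst_def algebra_simps)
          also have "\<dots> \<le> e0" using r by (rule cst_\<beta>)
          finally show ?thesis .
        qed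
        then show "\<exists>H\<in>ordered_graphs n. (\<forall>e\<in>edges n. \<kappa> (H e) = \<kappa> (G e)) \<and>
             (\<forall>r\<in>{2, q}. \<forall>h. (\<forall>z. 0 \<le> h z \<and> h z \<le> 1) \<longrightarrow>
                \<bar>stat r {1..n} h (\<lambda>e. (G e, H e)) - stat r {1..card S} h (\<lambda>e. (induced_tuple S G e, F e))\<bar> \<le> e0)"
          using H fS(2) by blast
      qed
    qed simp
    finally show "2 / 3 * real (n choose m) \<le> real (card {S \<in> subsets_of_card m {1..n}. liftable_sample \<kappa> q e0 n G S})" .
  qed
qed

section \<open>Tests\<close>

lemma expectation_subsets:
  assumes "m \<le> n"
  shows "pmf (bind_pmf (pmf_of_set {S. S \<subseteq> {1..n} \<and> card S = m}) f) b = subset_mean m {1..n} (\<lambda>S. pmf (f S) b)"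
proof -
  have ne: "subsets_of_card m {1..n} \<noteq> {}" "finite (subsets_of_card m {1..n})"
    using assms obtain_subset_with_card_n[of m "{1..n}"] by (auto simp: subsets_of_card_def)
  have "pmf (bind_pmf (pmf_of_set (subsets_of_card m {1..n})) f) b
      = (\<Sum>S\<in>subsets_of_card m {1..n}. pmf (f S) b) / real (card (subsets_of_card m {1..n}))"
    unfolding pmf_bind using ne by (rule integral_pmf_of_set)
  then show ?thesis by (simp add: subsets_of_card_def subset_mean_def n_subsets)
qed

lemma subset_mean_ge:
  assumes "finite V" "m \<le> card V" "good \<subseteq> subsets_of_card m V" "real (card good) \<ge> c * real (card V choose m)"
    and "\<And>S. S \<in> good \<Longrightarrow> f S \<ge> 1" "\<And>S. f S \<ge> 0"
  shows "subset_mean m V f \<ge> c"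
proof -
  have "c * real (card V choose m) \<le> (\<Sum>S\<in>good. 1)" using assms(4) by simp
  also have "\<dots> \<le> (\<Sum>S\<in>good. f S)" using assms by (intro sum_mono) auto
  also have "\<dots> \<le> (\<Sum>S\<in>subsets_of_card m V. f S)" using assms by (intro sum_mono2) auto
  finally show ?thesis using assms(2) by (simp add: subset_mean_def le_divide_eq)
qed

text \<open>A nonadaptive tree: all edges on the list are queried, and the answer for
  \<open>s e\<close> is stored in \<open>z\<close> under the index \<open>e\<close>.\<close>

primrec query_all :: "('c ograph \<Rightarrow> bool) \<Rightarrow> (nat set \<Rightarrow> nat set) \<Rightarrow> nat set list \<Rightarrow> 'c ograph \<Rightarrow> 'c query_tree" where
  "query_all B s [] z = Answer (B z)"
| "query_all B s (e # es) z = Query (s e) (\<lambda>c. query_all B s es (z(e := c)))"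

lemma run_query_all:
  "run_tree G (query_all B s es z) = B (\<lambda>e. if e \<in> set es then G (s e) else z e)"
proof (induction es arbitrary: z)
  case (Cons e es)
  have "(\<lambda>f. if f \<in> set es then G (s f) else (z(e := G (s e))) f) = (\<lambda>f. if f \<in> set (e # es) then G (s f) else z f)"
    by auto
  then show ?case using Cons by simp
qed simp

lemma query_all_queries:
  "s ` set es \<subseteq> edges n \<Longrightarrow> length es \<le> q \<Longrightarrow> tree_queries_le n q (query_all B s es z)"
proof (induction es arbitrary: z q)
  case Nil
  then show ?case by (simp add: tree_queries_le.intros)
next
  case (Cons e es)
  then obtain q' where "q = Suc q'" by (cases q) auto
  then show ?case using Cons by (auto intro!: tree_queries_le.intros)
qed

text \<open>Drawing \<open>S\<close> amounts to drawing a tree that queries every edge inside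
  \<open>S\<close>. The tree is deterministic, hence the decision \<open>B\<close> is a truth value
  here.\<close>

lemma query_test_of_canonical:
  fixes B :: "nat \<Rightarrow> 'c ograph \<Rightarrow> bool"
  shows "query_test (card (edges M))
    (\<lambda>n G. bind_pmf (pmf_of_set {S. S \<subseteq> {1..n} \<and> card S = min M n}) (\<lambda>S. return_pmf (B n (induced_tuple S G))))"
proof -
  have "\<exists>es. set es = edges m \<and> distinct es" for m by (rule finite_distinct_list) simp
  then obtain es where es: "\<And>m. set (es m) = edges m" "\<And>m. distinct (es m)" by metis
  define tree where "tree n S = query_all (B n) ((`) (enum S)) (es (card S)) (\<lambda>_. undefined)" for n S
  define T where "T n = map_pmf (tree n) (pmf_of_set {S. S \<subseteq> {1..n} \<and> card S = min M n})" for n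
  have run: "run_tree G (tree n S) = B n (induced_tuple S G)" for G n S
    by (simp add: tree_def run_query_all es induced_tuple_enum restrict_def)
  have "tree_queries_le n (card (edges M)) t" if t: "t \<in> set_pmf (T n)" for n t
  proof -
    have fin: "finite {S. S \<subseteq> {1..n} \<and> card S = min M n}" by simp
    have ne: "{S. S \<subseteq> {1..n} \<and> card S = min M n} \<noteq> {}"
    proof -
      have "min M n \<le> card {1..n}" by simp
      then obtain S where "S \<subseteq> {1..n}" "card S = min M n" by (rule obtain_subset_with_card_n)
      then show ?thesis by blast
    qed
    obtain S where S: "S \<subseteq> {1..n}" "card S = min M n" "t = tree n S"
      using t set_pmf_of_set[OF ne fin] by (auto simp: T_def)
    have fS: "finite S" using S(1) finite_subset by auto
    have "enum S ` e \<in> edges n" if "e \<in> edges (card S)" for e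
      using fS S(1) that by (rule enum_image_edge)
    moreover have "length (es (card S)) \<le> card (edges M)"
    proof -
      have "length (es (card S)) = card (edges (card S))" using es distinct_card by metis
      also have "\<dots> \<le> card (edges M)" using S(2) by (intro card_mono) (auto simp: edges_def)
      finally show ?thesis .
    qed
    ultimately show ?thesis unfolding S(3) tree_def using es by (intro query_all_queries) auto
  qed
  moreover have "(\<lambda>n G. bind_pmf (pmf_of_set {S. S \<subseteq> {1..n} \<and> card S = min M n}) (\<lambda>S. return_pmf (B n (induced_tuple S G))))
      = (\<lambda>n G. map_pmf (run_tree G) (T n))"
    by (simp add: T_def map_pmf_comp run flip: map_pmf_def)
  ultimately show ?thesis unfolding query_test_def by blast
qed

lemma induced_tuple_all:
  assumes "G \<in> ordered_graphs n"
  shows "induced_tuple {1..n} G = G"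
proof (rule ordered_graphs_eqI[OF _ assms])
  show "induced_tuple {1..n} G \<in> ordered_graphs n" by (auto simp: induced_tuple_def ordered_graphs_def)
  fix e assume e: "e \<in> edges n"
  have "enum {1..n} i = i" if "i \<in> {1..n}" for i
  proof -
    have "sorted_list_of_set {1..n} = [1..<Suc n]"
      by (metis atLeastLessThanSuc_atLeastAtMost sorted_list_of_set_range)
    then show ?thesis using that by (simp add: enum_def nth_upt del: upt_Suc)
  qed
  then have "enum {1..n} ` e = e" using e by (force simp: edges_def)
  then show "induced_tuple {1..n} G e = G e" using e by (simp add: induced_tuple_enum)
qed

text \<open>There are finitely many graphs, so the infimum is attained; if \<open>P n\<close> is
  empty it is infinite, and neither side holds.\<close>

lemma close_iff:
  fixes P :: "('c::finite) ograph_family"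
  assumes "P n \<subseteq> ordered_graphs n"
  shows "close \<epsilon> P n G \<longleftrightarrow> (\<exists>H\<in>P n. hamming_dist n G H \<le> \<epsilon>)"
proof
  have fin: "finite (P n)" using assms finite_subset finite_ordered_graphs by blast
  assume c: "close \<epsilon> P n G"
  have ne: "P n \<noteq> {}"
    using c by (auto simp: far_def dist_to_property_def top_ereal_def)
  have "dist_to_property P n G = Min ((\<lambda>H. ereal (hamming_dist n G H)) ` P n)"
    unfolding dist_to_property_def using fin ne by (simp add: Min_Inf)
  also have "\<dots> \<in> (\<lambda>H. ereal (hamming_dist n G H)) ` P n" using fin ne by (intro Min_in) auto
  finally obtain H where "H \<in> P n" "dist_to_property P n G = ereal (hamming_dist n G H)" by blast
  then show "\<exists>H\<in>P n. hamming_dist n G H \<le> \<epsilon>" using c by (intro bexI[of _ H]) (simp_all add: far_def)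
next
  assume "\<exists>H\<in>P n. hamming_dist n G H \<le> \<epsilon>"
  then obtain H where H: "H \<in> P n" "hamming_dist n G H \<le> \<epsilon>" by blast
  have "dist_to_property P n G \<le> ereal (hamming_dist n G H)"
    unfolding dist_to_property_def using H(1) by (rule INF_lower)
  also have "\<dots> \<le> ereal \<epsilon>" using H by simp
  finally show "close \<epsilon> P n G" by (simp add: far_def)
qed

lemma hamming_dist_triangle: "hamming_dist n G K \<le> hamming_dist n G H + hamming_dist n H K"
proof -
  have "card {e \<in> edges n. G e \<noteq> K e} \<le> card ({e \<in> edges n. G e \<noteq> H e} \<union> {e \<in> edges n. H e \<noteq> K e})"
    by (intro card_mono) auto
  also have "\<dots> \<le> card {e \<in> edges n. G e \<noteq> H e} + card {e \<in> edges n. H e \<noteq> K e}" by (rule card_Un_le)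
  finally show ?thesis
    by (simp add: hamming_dist_def add_divide_distrib[symmetric] divide_right_mono flip: of_nat_add)
qed

text \<open>\<open>{1, 2}\<close> is the only edge of a pattern on two vertices, so the statistic of
  arity 2 is the Hamming distance up to normalization.\<close>

definition differ :: "('c \<times> 'c) ograph \<Rightarrow> real" where
  "differ z = of_bool (fst (z {1, 2}) \<noteq> snd (z {1, 2}))"

lemma stat_differ:
  assumes "n > 0"
  shows "stat 2 {1..n} differ (\<lambda>e. (G e, H e)) = hamming_dist n G H * (real (n choose 2) / real n ^ 2)"
proof -
  have sc: "subsets_of_card 2 {1..n} = edges n" by (auto simp: subsets_of_card_def edges_def)
  have "differ (induced_tuple S (\<lambda>e. (G e, H e))) = of_bool (G S \<noteq> H S)" if S: "S \<in> edges n" for S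
  proof -
    have fS: "finite S" "card S = 2" using S by (auto simp: edges_def intro: finite_subset)
    have "enum S ` {1..2} = S" using bij_betw_enum[OF fS(1)] fS(2) by (simp add: bij_betw_def)
    moreover have "{1..2::nat} = {1, 2}" by auto
    ultimately have "enum S ` {1, 2} = S" by simp
    then show ?thesis using fS by (simp add: differ_def induced_tuple_enum)
  qed
  then have "(\<Sum>S\<in>edges n. differ (induced_tuple S (\<lambda>e. (G e, H e)))) = (\<Sum>S\<in>edges n. of_bool (G S \<noteq> H S))"
    by (intro sum.cong refl)
  also have "\<dots> = real (card {e \<in> edges n. G e \<noteq> H e})"
    by (simp add: of_bool_def sum.If_cases Int_def)
  finally have "stat 2 {1..n} differ (\<lambda>e. (G e, H e)) = real (card {e \<in> edges n. G e \<noteq> H e}) / real n ^ 2"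
    by (simp only: stat_eq_subset_sum[OF assms] sc)
  also have "\<dots> = hamming_dist n G H * (real (n choose 2) / real n ^ 2)"
  proof (cases "n choose 2 = 0")
    \<comment> \<open>Here \<open>hamming_dist\<close> divides by 0, but there are no edges and both
      sides are 0.\<close>
    case True
    then have "n < 2" by (simp add: binomial_eq_0_iff)
    then have "edges n = {}" by (auto elim!: edgeE)
    then show ?thesis by (simp add: hamming_dist_def)
  qed (simp add: hamming_dist_def)
  finally show ?thesis .
qed

text \<open>The restriction is applied anew because \<open>snd undefined\<close> need not be
  \<open>undefined\<close>; only so do the second components form a pattern again.\<close>

definition second_stat :: "nat \<Rightarrow> ('c ograph \<Rightarrow> real) \<Rightarrow> ('c \<times> 'c) ograph \<Rightarrow> real" where
  "second_stat q h z = h (\<lambda>e\<in>edges q. snd (z e))"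

lemma stat_second: "stat q X (second_stat q h) (\<lambda>e. (G e, H e)) = stat q X h H"
proof -
  have "second_stat q h (pattern q (\<lambda>e. (G e, H e)) l) = h (pattern q H l)" for l
    unfolding second_stat_def by (rule arg_cong[where f=h]) (auto simp: pattern_def fun_eq_iff restrict_def)
  then show ?thesis by (simp add: stat_def cong: if_cong)
qed

text \<open>\<open>sampling_lemma\<close> for two statistics, with \<open>q + 2\<close> as a common
  bound for the arities 2 and \<open>q\<close>; hence 144 = 2 * 72.\<close>

lemma two_statistics_sampled:
  fixes G H :: "'c ograph"
  assumes e0: "e0 > 0" and m: "m \<le> n" "real m \<ge> 144 * real (q + 2) ^ 2 / e0\<^sup>2" "2 * (q + 2) \<le> m" "m > 0"
    and h: "\<And>z. 0 \<le> h z \<and> h z \<le> 1"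
  shows "real (card {S \<in> subsets_of_card m {1..n}.
      \<bar>stat 2 S differ (\<lambda>e. (G e, H e)) - stat 2 {1..n} differ (\<lambda>e. (G e, H e))\<bar> \<le> e0 \<and>
      \<bar>stat q S h H - stat q {1..n} h H\<bar> \<le> e0}) \<ge> 2 / 3 * real (n choose m)"
proof -
  define g where "g b = (\<lambda>l. if sorted_wrt (<) l then
      (if b then differ (pattern 2 (\<lambda>e. (G e, H e)) l) else h (pattern q H l)) else 0)" for b
  define r where "r b = (if b then 2 else q)" for b
  have "\<bar>g b l\<bar> \<le> 1" for b l using h[of "pattern q H l"] by (auto simp: g_def differ_def)
  then have "2 / 3 * real (card {1..n} choose m) \<le> real (card {S \<in> subsets_of_card m {1..n}.
      \<forall>b\<in>UNIV. \<bar>tuple_mean (r b) S (g b) - tuple_mean (r b) {1..n} (g b)\<bar> \<le> e0})"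
    using m e0 by (intro sampling_lemma[where N=2 and q="q + 2"]) (auto simp: r_def)
  also have "{S \<in> subsets_of_card m {1..n}. \<forall>b\<in>UNIV. \<bar>tuple_mean (r b) S (g b) - tuple_mean (r b) {1..n} (g b)\<bar> \<le> e0}
      = {S \<in> subsets_of_card m {1..n}.
      \<bar>stat 2 S differ (\<lambda>e. (G e, H e)) - stat 2 {1..n} differ (\<lambda>e. (G e, H e))\<bar> \<le> e0 \<and>
      \<bar>stat q S h H - stat q {1..n} h H\<bar> \<le> e0}"
    by (auto simp: UNIV_bool r_def g_def stat_def cong: if_cong)
  finally show ?thesis by simp
qed

lemma canonical_test_acceptance:
  assumes A: "A = (\<lambda>n G. bind_pmf (pmf_of_set {S. S \<subseteq> {1..n} \<and> card S = min q n}) (\<lambda>S. D n (induced_tuple S G)))"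
    and n: "q \<le> n" "n > 0"
  shows "stat q {1..n} (\<lambda>z. pmf (D n z) True) G = pmf (A n G) True * (real (n choose q) / real n ^ q)"
proof -
  have "pmf (A n G) True = subset_mean q {1..n} (\<lambda>S. pmf (D n (induced_tuple S G)) True)"
    using n expectation_subsets[OF n(1)] by (simp add: A min_absorb1)
  then show ?thesis
    using n unfolding stat_eq_subset_sum[OF n(2)] by (simp add: subset_mean_def)
qed

text \<open>The tester accepts a sample if it can be recolored, within the distance budget, into a graph
  that the given test accepts with probability about 1/2. The number \<open>ratio\<close> converts between
  averages over subsets and averages over tuples.\<close>

lemma canonically_testable_imp_estimable:
  fixes U P :: "('c::finite) ograph_family" and \<kappa> :: "'c \<Rightarrow> 'k"
  assumes U: "\<And>n. U n \<subseteq> ordered_graphs n"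
    and compatible: "\<And>n G G' e. G \<in> U n \<Longrightarrow> G' \<in> U n \<Longrightarrow> e \<in> edges n \<Longrightarrow> \<kappa> (G e) = \<kappa> (G' e)"
    and closed: "\<And>n G H. G \<in> U n \<Longrightarrow> H \<in> ordered_graphs n \<Longrightarrow> (\<And>e. e \<in> edges n \<Longrightarrow> \<kappa> (H e) = \<kappa> (G e)) \<Longrightarrow> H \<in> U n"
    and P: "\<And>n. P n \<subseteq> U n" and testable: "canonically_testable U P"
  shows "estimable U P \<and> canonically_estimable U P"
proof -
  have "\<exists>q A. canonical_test q A \<and> tolerant_test U P \<epsilon> \<eta> A \<and> (\<exists>q'. query_test q' A)"
    if \<eta>: "tolerance_function \<eta>" and \<epsilon>: "\<epsilon> \<in> {0<..<1}" for \<eta> \<epsilon>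
  proof -
    have \<eta>1: "0 < \<eta> \<epsilon>" "\<eta> \<epsilon> < \<epsilon>" "\<epsilon> < 1" using \<eta> \<epsilon> by (auto simp: tolerance_function_def)
    define \<delta> where "\<delta> = \<epsilon> - \<eta> \<epsilon>"
    have \<delta>: "\<delta> > 0" "\<delta> < 1" using \<eta>1 by (auto simp: \<delta>_def)
    obtain q A where A: "canonical_test q A" "eps_test U P (\<delta> / 4) A"
      using testable \<delta>(1) unfolding canonically_testable_def by (metis zero_less_divide_iff zero_less_numeral)
    obtain D where D: "A = (\<lambda>n G. bind_pmf (pmf_of_set {S. S \<subseteq> {1..n} \<and> card S = min q n}) (\<lambda>S. D n (induced_tuple S G)))"
      using A(1) unfolding canonical_test_def by blast
    define d where "d n z = pmf (D n z) True" for n z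
    have d: "0 \<le> d n z \<and> d n z \<le> 1" for n z by (simp add: d_def pmf_le_1)
    define ratio where "ratio n = real (n choose q) / real n ^ q" for n
    \<comment> \<open>A lower bound on \<open>ratio n\<close> independent of \<open>n\<close>, so
      that one sampling error \<open>e0\<close> is small against all of them.\<close>
    define c where "c = 1 / real q ^ q"
    have c: "c > 0" by (cases "q = 0") (auto simp: c_def)
    have ratio: "c \<le> ratio n" if "q \<le> n" "n > 0" for n
    proof -
      have "(real n / real q) ^ q \<le> real (n choose q)" using that by (intro binomial_ge_n_over_k_pow_k)
      then show ?thesis using that by (simp add: c_def ratio_def power_divide field_simps)
    qed
    have accept: "stat q {1..n} (d n) G = pmf (A n G) True * ratio n" if "q \<le> n" "n > 0" for n G
      unfolding d_def ratio_def using that by (intro canonical_test_acceptance[OF D]) auto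
    \<comment> \<open>The acceptance thresholds 2/3, 1/2 and 1/3, scaled by \<open>ratio n\<close>,
      are at least \<open>ratio n / 6\<close> apart, which exceeds \<open>c / 7\<close>. The second
      bound keeps the error in the distance small against the slack \<open>\<delta>\<close>.\<close>
    define e0 where "e0 = min (c / 7) (\<delta> / 16)"
    have e0: "e0 > 0" "e0 \<le> c / 7" "e0 \<le> \<delta> / 16" using c \<delta> by (auto simp: e0_def)
    obtain m0 where lift: "\<forall>m n G. m0 \<le> m \<longrightarrow> m \<le> n \<longrightarrow>
        2 / 3 * real (n choose m) \<le> real (card {S \<in> subsets_of_card m {1..n}. liftable_sample \<kappa> q e0 n G S})"
      using sampled_recoloring_lift[OF e0(1)] ..
    define M where "M = m0 + nat \<lceil>144 * real (q + 2) ^ 2 / e0\<^sup>2\<rceil> + 2 * (q + 2) + nat \<lceil>16 / \<delta>\<rceil>"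
    have M: "m0 \<le> M" "real M \<ge> 144 * real (q + 2) ^ 2 / e0\<^sup>2" "2 * (q + 2) \<le> M" "real M \<ge> 16 / \<delta>"
      unfolding M_def by linarith+
    \<comment> \<open>With at most \<open>M\<close> vertices the whole graph is seen and decided
      exactly. Otherwise the budget is half the midpoint of \<open>\<eta> \<epsilon>\<close> and
      \<open>\<epsilon>\<close>, since \<open>stat 2\<close> of \<open>differ\<close> is about half
      the Hamming distance. The decision rule inside the sample is the one for \<open>n\<close>
      vertices, not for \<open>M\<close>.\<close>
    define B where "B n t \<longleftrightarrow> (if n \<le> M then close (\<eta> \<epsilon>) P n t else
       (\<exists>F. (\<forall>e\<in>edges M. \<kappa> (F e) = \<kappa> (t e)) \<and>
          stat 2 {1..M} differ (\<lambda>e. (t e, F e)) \<le> \<eta> \<epsilon> / 2 + \<delta> / 4 \<and>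
          stat q {1..M} (d n) F \<ge> ratio n / 2))" for n t
    define T where "T = (\<lambda>n G. bind_pmf (pmf_of_set {S. S \<subseteq> {1..n} \<and> card S = min M n}) (\<lambda>S. return_pmf (B n (induced_tuple S G))))"
    have "tolerant_test U P \<epsilon> \<eta> T"
      unfolding tolerant_test_def
    proof (intro allI ballI)
      fix n G assume G: "G \<in> U n"
      then have Gn: "G \<in> ordered_graphs n" using U by blast
      have Pn: "P n \<subseteq> ordered_graphs n" using U P by blast
      show "(close (\<eta> \<epsilon>) P n G \<longrightarrow> pmf (T n G) True \<ge> 2 / 3) \<and> (far \<epsilon> P n G \<longrightarrow> pmf (T n G) False \<ge> 2 / 3)"
      proof (cases "n \<le> M")
        case True
        have "{S. S \<subseteq> {1..n} \<and> card S = n} = {{1..n}}"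
          using card_subset_eq[of "{1..n}"] by auto
        then have "T n G = return_pmf (close (\<eta> \<epsilon>) P n G)"
          using True by (simp add: T_def min_absorb2 pmf_of_set_singleton bind_return_pmf induced_tuple_all[OF Gn] B_def del: One_nat_def)
        moreover have "close (\<eta> \<epsilon>) P n G \<Longrightarrow> close \<epsilon> P n G"
          unfolding close_iff[of P n, OF Pn] using \<eta>1 by force
        ultimately show ?thesis by (cases "close (\<eta> \<epsilon>) P n G") auto
      next
        case False
        then have n: "M \<le> n" "n > 0" "q \<le> n" using M(3) by auto
        have T: "pmf (T n G) b = subset_mean M {1..n} (\<lambda>S. of_bool (B n (induced_tuple S G) = b))" for b
        proof -
          have "pmf (T n G) b = subset_mean M {1..n} (\<lambda>S. pmf (return_pmf (B n (induced_tuple S G))) b)"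
            unfolding T_def using n(1) by (simp only: min_absorb1 expectation_subsets)
          then show ?thesis by (simp add: indicator_def of_bool_def)
        qed
        have rn: "7 * e0 \<le> ratio n" using ratio[OF n(3,2)] e0(2) by simp
        have choose2: "real (n choose 2) / real n ^ 2 = (1 - 1 / real n) / 2"
        proof -
          have "real (n choose 2) = real n * (real n - 1) / 2"
            using n(2) by (simp add: choose_two real_of_nat_div of_nat_diff)
          then show ?thesis using n(2) by (simp add: power2_eq_square field_simps)
        qed
        show ?thesis
        proof (intro conjI impI)
          assume "close (\<eta> \<epsilon>) P n G"
          then obtain H where H: "H \<in> P n" "hamming_dist n G H \<le> \<eta> \<epsilon>" unfolding close_iff[of P n, OF Pn] by blast
          have HU: "H \<in> U n" using H(1) P by blast
          have "pmf (A n H) True \<ge> 2 / 3" using A(2) HU H(1) unfolding eps_test_def by blast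
          then have sq: "stat q {1..n} (d n) H \<ge> 2 / 3 * ratio n"
            unfolding accept[OF n(3,2)] using rn e0(1) by (intro mult_right_mono) auto
          have "hamming_dist n G H * ((1 - 1 / real n) / 2) \<le> \<eta> \<epsilon> * (1 / 2)"
            using H(2) n(2) \<eta>1 by (intro mult_mono) (auto simp: hamming_dist_def)
          then have s2: "stat 2 {1..n} differ (\<lambda>e. (G e, H e)) \<le> \<eta> \<epsilon> / 2"
            unfolding stat_differ[OF n(2)] choose2 by simp
          let ?good = "{S \<in> subsets_of_card M {1..n}.
            \<bar>stat 2 S differ (\<lambda>e. (G e, H e)) - stat 2 {1..n} differ (\<lambda>e. (G e, H e))\<bar> \<le> e0 \<and>
            \<bar>stat q S (d n) H - stat q {1..n} (d n) H\<bar> \<le> e0}"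
          have good: "2 / 3 * real (n choose M) \<le> real (card ?good)"
            using e0(1) n(1) M d by (intro two_statistics_sampled) auto
          have "B n (induced_tuple S G)" if S: "S \<in> ?good" for S
          proof -
            have fS: "finite S" "card S = M" "S \<subseteq> {1..n}" using S by (auto simp: subsets_of_card_def intro: finite_subset)
            have "\<kappa> (induced_tuple S H e) = \<kappa> (induced_tuple S G e)" if e: "e \<in> edges M" for e
            proof -
              have "enum S ` e \<in> edges n" using fS e by (intro enum_image_edge) auto
              then show ?thesis using compatible[OF HU G] e fS by (simp add: induced_tuple_enum)
            qed
            moreover have "stat 2 {1..M} differ (\<lambda>e. (induced_tuple S G e, induced_tuple S H e)) \<le> \<eta> \<epsilon> / 2 + \<delta> / 4"
            proof -
              have "\<bar>stat 2 S differ (\<lambda>e. (G e, H e)) - stat 2 {1..n} differ (\<lambda>e. (G e, H e))\<bar> \<le> e0" using S by blast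
              then show ?thesis unfolding stat_induced_pair[OF fS(1,2)] using s2 e0(3) \<delta> by linarith
            qed
            moreover have "stat q {1..M} (d n) (induced_tuple S H) \<ge> ratio n / 2"
            proof -
              have "\<bar>stat q S (d n) H - stat q {1..n} (d n) H\<bar> \<le> e0" using S by blast
              then show ?thesis unfolding stat_induced[OF fS(1,2)] using sq rn by linarith
            qed
            ultimately show ?thesis using False unfolding B_def by auto
          qed
          then show "pmf (T n G) True \<ge> 2 / 3"
            unfolding T using n(1) good by (intro subset_mean_ge[where good="?good"]) auto
        next
          assume far: "far \<epsilon> P n G"
          let ?good = "{S \<in> subsets_of_card M {1..n}. liftable_sample \<kappa> q e0 n G S}"
          have good: "2 / 3 * real (n choose M) \<le> real (card ?good)" using M(1) n(1) lift by blast
          have "\<not> B n (induced_tuple S G)" if S: "S \<in> ?good" for S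
          proof
            assume "B n (induced_tuple S G)"
            then obtain F where F: "\<forall>e\<in>edges M. \<kappa> (F e) = \<kappa> (induced_tuple S G e)"
               "stat 2 {1..M} differ (\<lambda>e. (induced_tuple S G e, F e)) \<le> \<eta> \<epsilon> / 2 + \<delta> / 4"
               "stat q {1..M} (d n) F \<ge> ratio n / 2"
              using False by (auto simp: B_def)
            obtain H where H: "H \<in> ordered_graphs n" "\<forall>e\<in>edges n. \<kappa> (H e) = \<kappa> (G e)"
              and st: "\<forall>r\<in>{2, q}. \<forall>h. (\<forall>z. 0 \<le> h z \<and> h z \<le> 1) \<longrightarrow>
              \<bar>stat r {1..n} h (\<lambda>e. (G e, H e)) - stat r {1..M} h (\<lambda>e. (induced_tuple S G e, F e))\<bar> \<le> e0"
              using S F(1) unfolding liftable_sample_def by (auto simp: subsets_of_card_def)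
            have HU: "H \<in> U n" using closed[OF G H(1)] H(2) by blast
            have "\<bar>stat q {1..n} (d n) H - stat q {1..M} (d n) F\<bar> \<le> e0"
              using st[rule_format, of q "second_stat q (d n)"] d by (simp add: stat_second second_stat_def)
            then have "pmf (A n H) True * ratio n > 1 / 3 * ratio n"
              unfolding accept[OF n(3,2), symmetric] using F(3) rn e0(1) by linarith
            then have "pmf (A n H) True > 1 / 3" using rn e0(1) by (simp only: mult_less_cancel_right_pos)
            \<comment> \<open>A graph far from \<open>P\<close> would be rejected with probability
              at least 2/3, so acceptance above 1/3 already shows that \<open>H\<close> is
              close.\<close>
            then have "\<not> pmf (A n H) False \<ge> 2 / 3" by (simp add: pmf_False_conv_True)
            then have "close (\<delta> / 4) P n H" using A(2) HU unfolding eps_test_def by blast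
            then obtain H' where H': "H' \<in> P n" "hamming_dist n H H' \<le> \<delta> / 4" unfolding close_iff[of P n, OF Pn] by blast
            have "\<bar>stat 2 {1..n} differ (\<lambda>e. (G e, H e)) - stat 2 {1..M} differ (\<lambda>e. (induced_tuple S G e, F e))\<bar> \<le> e0"
              using st by (auto simp: differ_def)
            then have s2: "hamming_dist n G H * ((1 - 1 / real n) / 2) \<le> \<eta> \<epsilon> / 2 + \<delta> / 4 + \<delta> / 16"
              unfolding stat_differ[OF n(2)] choose2 using F(2) e0(3) by linarith
            \<comment> \<open>Doubling the estimate gives
              \<open>\<eta> \<epsilon> + 5 * \<delta> / 8\<close>, and the factor
              \<open>1 - 1 / n\<close> costs at most \<open>\<delta> / 16\<close> more. The
              remaining quarter of \<open>\<delta>\<close> is spent on the distance from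
              \<open>H\<close> to \<open>P\<close>.\<close>
            have "hamming_dist n G H \<le> \<eta> \<epsilon> + 3 * \<delta> / 4"
            proof (rule ccontr)
              assume "\<not> ?thesis"
              then have gt: "\<eta> \<epsilon> + 3 * \<delta> / 4 < hamming_dist n G H" by simp
              have "real n \<ge> 16 / \<delta>" using M(4) n(1) by linarith
              then have n16: "1 / real n \<le> \<delta> / 16" using n(2) \<delta> by (simp add: field_simps)
              have pos: "1 - 1 / real n > 0" using n16 \<delta> by simp
              have "(\<eta> \<epsilon> + 3 * \<delta> / 4) * (1 - 1 / real n) < hamming_dist n G H * (1 - 1 / real n)"
                using gt pos by (rule mult_strict_right_mono)
              moreover have "(\<eta> \<epsilon> + 3 * \<delta> / 4) * (1 - 1 / real n)
                  = (\<eta> \<epsilon> + 3 * \<delta> / 4) - (\<eta> \<epsilon> + 3 * \<delta> / 4) * (1 / real n)"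
                by (simp add: right_diff_distrib)
              moreover have "hamming_dist n G H * (1 - 1 / real n) \<le> \<eta> \<epsilon> + 5 * \<delta> / 8"
              proof -
                define y where "y = hamming_dist n G H * (1 - 1 / real n)"
                show ?thesis using s2 unfolding times_divide_eq_right y_def[symmetric] by simp
              qed
              moreover have "(\<eta> \<epsilon> + 3 * \<delta> / 4) * (1 / real n) \<le> 1 * (\<delta> / 16)"
              proof (rule mult_mono)
                have "4 * (\<eta> \<epsilon>) + 3 * \<delta> \<le> 4" using \<eta>1 by (simp add: \<delta>_def right_diff_distrib)
                then show "\<eta> \<epsilon> + 3 * \<delta> / 4 \<le> 1" by simp
              qed (use n16 in auto)
              ultimately show False using \<delta> by linarith
            qed
            then have "hamming_dist n G H' \<le> \<epsilon>"
            proof -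
              have "\<eta> \<epsilon> + \<delta> = \<epsilon>" by (simp add: \<delta>_def)
              then show "hamming_dist n G H \<le> \<eta> \<epsilon> + 3 * \<delta> / 4 \<Longrightarrow> hamming_dist n G H' \<le> \<epsilon>"
                using hamming_dist_triangle[of n G H' H] H'(2) by linarith
            qed
            then show False using far H'(1) close_iff[of P n, OF Pn] by blast
          qed
          then show "pmf (T n G) False \<ge> 2 / 3"
            unfolding T using n(1) good by (intro subset_mean_ge[where good="?good"]) auto
        qed
      qed
    qed
    moreover have "canonical_test M T"
      unfolding canonical_test_def T_def by (intro exI[of _ "\<lambda>n t. return_pmf (B n t)"]) simp
    moreover have "query_test (card (edges M)) T" unfolding T_def by (rule query_test_of_canonical)
    ultimately show ?thesis by blast
  qed
  then show ?thesis unfolding estimable_def canonically_estimable_def by blast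
qed

text \<open>The positions of \<open>None\<close> are the same for all images of a given size. A
  recoloring that preserves them has a proper color on every edge between the two halves, and these
  colors can be read back as pixels.\<close>

lemma image_graph_recoloring:
  assumes f: "f \<in> images n" and H: "H \<in> ordered_graphs (2 * n)"
    and none: "\<And>e. e \<in> edges (2 * n) \<Longrightarrow> H e = None \<longleftrightarrow> image_graph n f e = None"
  shows "\<exists>g\<in>images n. H = image_graph n g"
proof
  define g where "g = (\<lambda>(x, y)\<in>{1..n} \<times> {1..n}. the (H {x, n + y}))"
  show "g \<in> images n" by (auto simp: g_def images_def)
  show "H = image_graph n g"
  proof (rule ordered_graphs_eqI[OF H])
    show "image_graph n g \<in> ordered_graphs (2 * n)" by (auto simp: image_graph_def ordered_graphs_def)
    fix e assume e: "e \<in> edges (2 * n)"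
    then obtain a b where ab: "1 \<le> a" "a < b" "b \<le> 2 * n" "e = {a, b}" "Min e = a" "Max e = b" by (rule edgeE)
    show "H e = image_graph n g e"
    proof (cases "a \<le> n \<and> n < b")
      case True
      then have "H e \<noteq> None" using none[OF e] e ab by (simp add: image_graph_def)
      moreover have "g (a, b - n) = the (H {a, b})" using True ab by (auto simp: g_def)
      ultimately show ?thesis using True e ab by (simp add: image_graph_def)
    next
      case False
      then show ?thesis using none[OF e] e ab by (auto simp: image_graph_def)
    qed
  qed
qed

theorem theorem3:
  fixes P :: "'c::finite ograph_family" and Q :: "'c image_family"
  shows "(graph_property P \<and> canonically_testable ordered_graphs P \<longrightarrow>
            estimable ordered_graphs P \<and> canonically_estimable ordered_graphs P) \<and>
         (image_property Q \<and> canonically_testable (image_graphs images) (image_graphs Q) \<longrightarrow>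
            estimable (image_graphs images) (image_graphs Q) \<and>
            canonically_estimable (image_graphs images) (image_graphs Q))"
proof (intro conjI[of "_ \<longrightarrow> _"] impI; elim conjE)
  assume "graph_property P" "canonically_testable ordered_graphs P"
  \<comment> \<open>With a constant \<open>\<kappa>\<close> every recoloring of a graph is
    admissible.\<close>
  then show "estimable ordered_graphs P \<and> canonically_estimable ordered_graphs P"
    by (intro canonically_testable_imp_estimable[where \<kappa>="\<lambda>_. ()"]) (auto simp: graph_property_def)
next
  assume Q: "image_property Q" "canonically_testable (image_graphs images) (image_graphs Q)"
  \<comment> \<open>Here \<open>\<kappa>\<close> tells the extra color from all others, so the
    admissible recolorings are exactly those that represent images.\<close>
  show "estimable (image_graphs images) (image_graphs Q) \<and> canonically_estimable (image_graphs images) (image_graphs Q)"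
  proof (rule canonically_testable_imp_estimable[where \<kappa>="\<lambda>c. c = None"])
    show "image_graphs images n \<subseteq> ordered_graphs n" for n
      by (auto simp: image_graphs_def image_graph_def ordered_graphs_def)
    show "image_graphs Q n \<subseteq> image_graphs images n" for n
      using Q(1) by (auto simp: image_graphs_def image_property_def)
    show "(G e = None) = (G' e = None)"
      if "G \<in> image_graphs images n" "G' \<in> image_graphs images n" "e \<in> edges n" for n G G' e
      using that by (auto simp: image_graphs_def image_graph_def)
    show "H \<in> image_graphs images n"
      if G: "G \<in> image_graphs images n" and H: "H \<in> ordered_graphs n"
        and eq: "\<And>e. e \<in> edges n \<Longrightarrow> (H e = None) = (G e = None)" for n G H
    proof -
      obtain k f where f: "G = image_graph k f" "n = 2 * k" "f \<in> images k" using G by (auto simp: image_graphs_def)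
      then show ?thesis using image_graph_recoloring[of f k H] H eq by (auto simp: image_graphs_def)
    qed
  qed (rule Q(2))
qed

end
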